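(* Let $A$ be a finite dimensional non-nilpotent associative algebra over an algebraically closed field $F$ of characteristic $0$. Suppose a finite dimensional Hopf algebra $H$ acts on $A$ (i.e. $A$ is an $H$-module algebra) in such a way that the Jacobson radical $J:=J(A)$ is $H$-invariant and $A=B\oplus J$ (direct sum of $H$-submodules), where $B$ is a subalgebra and $B=B_1\oplus\dots\oplus B_q$ (direct sum of $H$-invariant ideals of $B$) with $B_i$ being $H$-simple semisimple algebras. Then there exist constants $C_1,C_2>0$, $r_1,r_2\in\mathbb{R}$, $d\in\mathbb{N}$ such that $$C_1n^{r_1}d^n\leqslant c_n^H(A)\leqslant C_2n^{r_2}d^n\quad\text{for all } n\in\mathbb{N}.$$
   Context: Algebras acted upon are not assumed to be unital; $\mathbb{N}=\{1,2,\dots\}$. An algebra $A$ over $F$ is an $H$-module algebra (an algebra with an $H$-action) if it is endowed with a homomorphism of algebras with $1$, $H\to\mathrm{End}_F(A)$, such that $h(ab)=(h_{(1)}a)(h_{(2)}b)$ for all $h\in H$, $a,b\in A$, where $\Delta h=h_{(1)}\otimes h_{(2)}$ is Sweedler's notation for the comultiplication. An $H$-simple algebra is a nonzero algebra with $H$-action having no $H$-invariant two-sided ideals except $0$ and itself. Let $(\gamma_\beta)_{\beta\in\Lambda}$ be a basis of $H$. $F\langle X|H\rangle$ is the free associative algebra over $F$ with free formal generators $x_i^{\gamma_\beta}$, $\beta\in\Lambda$, $i\in\mathbb{N}$; for $h=\sum_\beta\alpha_\beta\gamma_\beta$ put $x_i^h:=\sum_\beta\alpha_\beta x_i^{\gamma_\beta}$,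 and $x_i:=x_i^1$. Its elements are called $H$-polynomials. An $H$-polynomial $f(x_1,\dots,x_n)$ is evaluated at $a_1,\dots,a_n\in A$ by substituting $ha_i$ for $x_i^h$. It is an $H$-identity of $A$ if $f(a_1,\dots,a_n)=0$ for all $a_i\in A$; $\mathrm{Id}^H(A)$ is the set of $H$-identities. Let $$P_n^H=\langle x^{h_1}_{\sigma(1)}x^{h_2}_{\sigma(2)}\cdots x^{h_n}_{\sigma(n)}\mid h_i\in H,\ \sigma\in S_n\rangle_F\subset F\langle X|H\rangle.$$ The $n$th $H$-codimension of $A$ is $c_n^H(A):=\dim\bigl(P_n^H/(P_n^H\cap\mathrm{Id}^H(A))\bigr)$. $A$ is nilpotent if all products of $p$ elements of $A$ vanish for some $p\in\mathbb{N}$. *)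

theory Defs
  imports Complex_Main "HOL-Library.Poly_Mapping" "HOL-Computational_Algebra.Polynomial"
    "HOL-Combinatorics.Permutations"
begin

section \<open>Formal linear combinations and quotients\<close>

definition pm_scale :: "'f::semiring_0 \<Rightarrow> ('k \<Rightarrow>\<^sub>0 'f) \<Rightarrow> ('k \<Rightarrow>\<^sub>0 'f)" where
  "pm_scale c p = Poly_Mapping.map ((*) c) p"

lemma lookup_pm_scale: "Poly_Mapping.lookup (pm_scale c p) k = c * Poly_Mapping.lookup p k"
  by (simp add: pm_scale_def Poly_Mapping.map.rep_eq "when_def")

lemma vector_space_pm_scale: "vector_space (pm_scale :: 'f::field \<Rightarrow> ('k \<Rightarrow>\<^sub>0 'f) \<Rightarrow> _)"
  by standard
    (auto intro!: poly_mapping_eqI simp: lookup_pm_scale Poly_Mapping.lookup_add algebra_simps)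

text \<open>The linear extension of a map \<open>g\<close> defined on the keys; with keys in \<open>H \<times> H\<close> it expresses
  Sweedler sums.\<close>

definition lin_ext ::
  "('f::zero \<Rightarrow> 'v \<Rightarrow> 'v) \<Rightarrow> ('k \<Rightarrow> 'v::comm_monoid_add) \<Rightarrow> ('k \<Rightarrow>\<^sub>0 'f) \<Rightarrow> 'v" where
  "lin_ext s g t = (\<Sum>k \<in> Poly_Mapping.keys t. s (Poly_Mapping.lookup t k) (g k))"

definition finite_dim :: "('f::field \<Rightarrow> 'v::ab_group_add \<Rightarrow> 'v) \<Rightarrow> bool" where
  "finite_dim s \<longleftrightarrow> (\<exists>B. finite B \<and> module.span s B = UNIV)"

text \<open>\<open>B\<close> consists of representatives of the elements of a basis of \<open>V / W\<close>, one for each.\<close>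

definition quotient_basis ::
  "('f::field \<Rightarrow> 'v::ab_group_add \<Rightarrow> 'v) \<Rightarrow> 'v set \<Rightarrow> 'v set \<Rightarrow> 'v set \<Rightarrow> bool" where
  "quotient_basis s V W B \<longleftrightarrow>
     B \<subseteq> V \<and> V \<subseteq> module.span s (B \<union> W) \<and>
     (\<forall>T c. finite T \<and> T \<subseteq> B \<and> (\<Sum>v\<in>T. s (c v) v) \<in> W \<longrightarrow> (\<forall>v\<in>T. c v = 0))"

definition quotient_dim ::
  "('f::field \<Rightarrow> 'v::ab_group_add \<Rightarrow> 'v) \<Rightarrow> 'v set \<Rightarrow> 'v set \<Rightarrow> nat" where
  "quotient_dim s V W = card (SOME B. quotient_basis s V W B)"

lemma quotient_basis_union:
  assumes "vector_space s" and W: "module.subspace s W" and C: "\<not> module.dependent s C" "module.span s C = W"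
   and B: "quotient_basis s V W B" and V: "module.subspace s V" and WV: "W \<subseteq> V"
  shows "\<not> module.dependent s (B \<union> C)" "B \<inter> C = {}" "module.span s (B \<union> C) = V"
proof -
  interpret vector_space s by fact
  have Vsp: "span V = V" using V by (simp add: span_eq_iff)
  have CW: "C \<subseteq> W" using C(2) span_superset by blast
  have B1: "B \<subseteq> V" "V \<subseteq> span (B \<union> W)"
    using B unfolding quotient_basis_def by simp_all
  have B2: "\<forall>v\<in>T. c v = 0" if "finite T" "T \<subseteq> B" "(\<Sum>v\<in>T. s (c v) v) \<in> W" for T c
    using B that unfolding quotient_basis_def by simp
  show disj: "B \<inter> C = {}"
  proof (rule ccontr)
    assume "B \<inter> C \<noteq> {}"
    then obtain v where "v \<in> B" "v \<in> W" using CW by blast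
    then show False using B2[of "{v}" "\<lambda>_. 1"] by auto
  qed
  show "independent (B \<union> C)"
    unfolding independent_explicit_module
  proof (intro allI impI)
    fix t u v assume t: "finite t" "t \<subseteq> B \<union> C" "(\<Sum>v\<in>t. s (u v) v) = 0" "v \<in> t"
    have sm: "(\<Sum>v\<in>t\<inter>B. s (u v) v) + (\<Sum>v\<in>t\<inter>C. s (u v) v) = 0"
    proof -
      have "(t \<inter> B) \<union> (t \<inter> C) = t" "(t \<inter> B) \<inter> (t \<inter> C) = {}" using t(2) disj by blast+
      then show ?thesis
        using t(1,3) sum.union_disjoint[of "t \<inter> B" "t \<inter> C" "\<lambda>v. s (u v) v"] by simp
    qed
    have cW: "(\<Sum>v\<in>t\<inter>C. s (u v) v) \<in> W"
      using CW W by (intro subspace_sum subspace_scale) auto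
    then have "- (\<Sum>v\<in>t\<inter>C. s (u v) v) \<in> W" using W by (rule subspace_neg[rotated])
    then have bW: "(\<Sum>v\<in>t\<inter>B. s (u v) v) \<in> W" using sm by (metis eq_neg_iff_add_eq_0)
    have b0: "\<forall>v\<in>t\<inter>B. u v = 0" using B2[OF _ _ bW] t(1) by auto
    then have "(\<Sum>v\<in>t\<inter>C. s (u v) v) = 0" using sm by simp
    then have "\<forall>v\<in>t\<inter>C. u v = 0" using C(1) t(1) unfolding independent_explicit_module by blast
    then show "u v = 0" using b0 t by blast
  qed
  have "B \<union> W \<subseteq> span (B \<union> C)"
    using C(2) span_superset[of "B \<union> C"] span_mono[of C "B \<union> C"] by blast
  then have "V \<subseteq> span (B \<union> C)"
    using B1(2) span_mono[of "B \<union> W" "span (B \<union> C)"] by (simp add: span_span)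
  moreover have "span (B \<union> C) \<subseteq> V"
    using B1(1) CW WV span_mono[of "B \<union> C" V] Vsp by auto
  ultimately show "span (B \<union> C) = V" by simp
qed

lemma quotient_dim_eq:
  assumes "vector_space s" and W: "module.subspace s W" and V: "module.subspace s V" and WV: "W \<subseteq> V"
    and fin: "finite F" "V \<subseteq> module.span s F"
  shows "quotient_dim s V W = vector_space.dim s V - vector_space.dim s W"
proof -
  interpret vector_space s by fact
  obtain C where C: "C \<subseteq> W" "independent C" "W \<subseteq> span C" "card C = dim W"
    using basis_exists by blast
  have CW: "span C = W" using C W by (metis span_eq_iff span_mono subset_antisym)
  obtain D where D: "C \<subseteq> D" "D \<subseteq> V" "independent D" "V \<subseteq> span D"
    using maximal_independent_subset_extend[of C V] C WV by (metis subset_trans)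
  have "quotient_basis s V W (D - C)"
    unfolding quotient_basis_def
  proof (intro conjI allI impI)
    show "D - C \<subseteq> V" using D by blast
    have "D \<subseteq> (D - C) \<union> W" using C by blast
    then show "V \<subseteq> span ((D - C) \<union> W)" using D by (meson span_mono subset_trans)
    fix T c assume T: "finite T \<and> T \<subseteq> D - C \<and> (\<Sum>v\<in>T. s (c v) v) \<in> W"
    then obtain t r where t: "finite t" "t \<subseteq> C" "(\<Sum>v\<in>T. s (c v) v) = (\<Sum>a\<in>t. s (r a) a)"
      using CW unfolding span_explicit by blast
    have d: "T \<inter> t = {}" using T t by blast
    define u where "u v = (if v \<in> T then c v else - r v)" for v
    have "(\<Sum>v\<in>T\<union>t. s (u v) v) = (\<Sum>v\<in>T. s (u v) v) + (\<Sum>v\<in>t. s (u v) v)"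
      using T t d by (intro sum.union_disjoint) auto
    also have "(\<Sum>v\<in>T. s (u v) v) = (\<Sum>v\<in>T. s (c v) v)" by (intro sum.cong) (auto simp: u_def)
    also have "(\<Sum>v\<in>t. s (u v) v) = - (\<Sum>v\<in>t. s (r v) v)"
      unfolding sum_negf[symmetric] using d by (intro sum.cong) (auto simp: u_def)
    finally have "(\<Sum>v\<in>T\<union>t. s (u v) v) = 0" using t by simp
    then have "\<forall>v\<in>T\<union>t. u v = 0"
      using D(1,3) T t unfolding independent_explicit_module
      by (metis (no_types, lifting) Diff_subset Un_subset_iff finite_Un subset_trans)
    then have "\<forall>v\<in>T. u v = 0" by blast
    then show "\<forall>v\<in>T. c v = 0" by (simp add: u_def)
  qed
  then have ex: "quotient_basis s V W (SOME B. quotient_basis s V W B)" by (rule someI)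
  let ?B = "SOME B. quotient_basis s V W B"
  note u = quotient_basis_union[OF assms(1) W C(2) CW ex V WV]
  have "?B \<union> C \<subseteq> span F" using u(3) fin(2) span_superset[of "?B \<union> C"] by blast
  then have f: "finite (?B \<union> C)" using u(1) fin(1) independent_span_bound by blast
  have "dim V = card (?B \<union> C)" using u(1,3) by (metis dim_span dim_eq_card_independent)
  also have "\<dots> = card ?B + card C" using f u(2) by (simp add: card_Un_disjoint)
  finally show ?thesis using C(4) by (simp add: quotient_dim_def)
qed


section \<open>Hopf algebras\<close>

text \<open>Elements of \<open>H \<otimes> H\<close> and \<open>H \<otimes> H \<otimes> H\<close> are represented by formal linear combinations of pairs and
  triples, modulo the relations that make the tensor symbol multilinear. A map in \<open>slots\<close> inserts
  its argument at one position of a tuple whose other entries are fixed.\<close>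

definition multilinear_relations ::
  "('f::field \<Rightarrow> 'h::ab_group_add \<Rightarrow> 'h) \<Rightarrow> ('h \<Rightarrow> 'k) set \<Rightarrow> ('k \<Rightarrow>\<^sub>0 'f) set" where
  "multilinear_relations s slots = module.span pm_scale
     ({Poly_Mapping.single (p (x + y)) 1 - Poly_Mapping.single (p x) 1 - Poly_Mapping.single (p y) 1
        | p x y. p \<in> slots} \<union>
      {Poly_Mapping.single (p (s c x)) 1 - Poly_Mapping.single (p x) c | p c x. p \<in> slots})"

definition tensor2_eq ::
  "('f::field \<Rightarrow> 'h::ab_group_add \<Rightarrow> 'h) \<Rightarrow> ('h \<times> 'h \<Rightarrow>\<^sub>0 'f) \<Rightarrow> ('h \<times> 'h \<Rightarrow>\<^sub>0 'f) \<Rightarrow> bool" where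
  "tensor2_eq s t u \<longleftrightarrow>
     t - u \<in> multilinear_relations s ({\<lambda>x. (x, b) | b. True} \<union> {\<lambda>x. (a, x) | a. True})"

definition tensor3_eq ::
  "('f::field \<Rightarrow> 'h::ab_group_add \<Rightarrow> 'h) \<Rightarrow>
     ('h \<times> 'h \<times> 'h \<Rightarrow>\<^sub>0 'f) \<Rightarrow> ('h \<times> 'h \<times> 'h \<Rightarrow>\<^sub>0 'f) \<Rightarrow> bool" where
  "tensor3_eq s t u \<longleftrightarrow>
     t - u \<in> multilinear_relations s
       ({\<lambda>x. (x, b, c) | b c. True} \<union> {\<lambda>x. (a, x, c) | a c. True} \<union> {\<lambda>x. (a, b, x) | a b. True})"

locale assoc_algebra = vector_space scale
  for scale :: "'f::field \<Rightarrow> 'a::ring \<Rightarrow> 'a" +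
  assumes scale_mult_left: "scale c (x * y) = scale c x * y"
    and scale_mult_right: "scale c (x * y) = x * scale c y"

text \<open>\<open>\<Delta> h\<close> is a representative of the comultiplication at \<open>h\<close>.\<close>

locale hopf_algebra = assoc_algebra scale
  for scale :: "'f::field \<Rightarrow> 'h::ring_1 \<Rightarrow> 'h" +
  fixes \<Delta> :: "'h \<Rightarrow> ('h \<times> 'h \<Rightarrow>\<^sub>0 'f)"
    and \<epsilon> :: "'h \<Rightarrow> 'f"
    and S :: "'h \<Rightarrow> 'h"
  assumes comult_add: "tensor2_eq scale (\<Delta> (x + y)) (\<Delta> x + \<Delta> y)"
    and comult_scale: "tensor2_eq scale (\<Delta> (scale c x)) (pm_scale c (\<Delta> x))"
    and coassoc: "tensor3_eq scale
      (lin_ext pm_scale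
        (\<lambda>(a, b). lin_ext pm_scale (\<lambda>(a1, a2). Poly_Mapping.single (a1, a2, b) 1) (\<Delta> a)) (\<Delta> x))
      (lin_ext pm_scale
        (\<lambda>(a, b). lin_ext pm_scale (\<lambda>(b1, b2). Poly_Mapping.single (a, b1, b2) 1) (\<Delta> b)) (\<Delta> x))"
    and counit_linear: "Vector_Spaces.linear scale (*) \<epsilon>"
    and counit_left: "lin_ext scale (\<lambda>(a, b). scale (\<epsilon> a) b) (\<Delta> x) = x"
    and counit_right: "lin_ext scale (\<lambda>(a, b). scale (\<epsilon> b) a) (\<Delta> x) = x"
    and comult_one: "tensor2_eq scale (\<Delta> 1) (Poly_Mapping.single (1, 1) 1)"
    and comult_mult: "tensor2_eq scale (\<Delta> (x * y))
      (lin_ext pm_scale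
        (\<lambda>(a, b). lin_ext pm_scale (\<lambda>(c, d). Poly_Mapping.single (a * c, b * d) 1) (\<Delta> y)) (\<Delta> x))"
    and counit_one: "\<epsilon> 1 = 1"
    and counit_mult: "\<epsilon> (x * y) = \<epsilon> x * \<epsilon> y"
    and antipode_linear: "Vector_Spaces.linear scale scale S"
    and antipode_left: "lin_ext scale (\<lambda>(a, b). S a * b) (\<Delta> x) = scale (\<epsilon> x) 1"
    and antipode_right: "lin_ext scale (\<lambda>(a, b). a * S b) (\<Delta> x) = scale (\<epsilon> x) 1"

locale hopf_module_algebra =
  H: hopf_algebra scaleH \<Delta> \<epsilon> S + A: assoc_algebra scaleA
  for scaleH :: "'f::field \<Rightarrow> 'h::ring_1 \<Rightarrow> 'h"
    and \<Delta> :: "'h \<Rightarrow> ('h \<times> 'h \<Rightarrow>\<^sub>0 'f)"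
    and \<epsilon> :: "'h \<Rightarrow> 'f"
    and S :: "'h \<Rightarrow> 'h"
    and scaleA :: "'f \<Rightarrow> 'a::ring \<Rightarrow> 'a" +
  fixes act :: "'h \<Rightarrow> 'a \<Rightarrow> 'a"
  assumes act_linear: "Vector_Spaces.linear scaleA scaleA (act h)"
    and act_linear_left: "Vector_Spaces.linear scaleH scaleA (\<lambda>h. act h a)"
    and act_one: "act 1 a = a"
    and act_mult: "act (g * h) a = act g (act h a)"
    and act_prod: "act h (a * b) = lin_ext scaleA (\<lambda>(h1, h2). act h1 a * act h2 b) (\<Delta> h)"


section \<open>Subalgebras, ideals and radicals\<close>

text \<open>Algebras need not have a unit, so products are formed for nonempty lists only; the value at
  the empty list is immaterial.\<close>

fun prod_nonempty :: "'a::ring list \<Rightarrow> 'a" where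
  "prod_nonempty [] = 0"
| "prod_nonempty [x] = x"
| "prod_nonempty (x # y # zs) = x * prod_nonempty (y # zs)"

definition nilpotent_algebra :: "'a::ring itself \<Rightarrow> bool" where
  "nilpotent_algebra _ \<longleftrightarrow> (\<exists>p\<ge>1. \<forall>xs :: 'a list. length xs = p \<longrightarrow> prod_nonempty xs = 0)"

definition subalgebra :: "('f::field \<Rightarrow> 'a::ring \<Rightarrow> 'a) \<Rightarrow> 'a set \<Rightarrow> bool" where
  "subalgebra s B \<longleftrightarrow> module.subspace s B \<and> (\<forall>x\<in>B. \<forall>y\<in>B. x * y \<in> B)"

definition left_ideal :: "('f::field \<Rightarrow> 'a::ring \<Rightarrow> 'a) \<Rightarrow> 'a set \<Rightarrow> 'a set \<Rightarrow> bool" where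
  "left_ideal s B I \<longleftrightarrow> module.subspace s I \<and> I \<subseteq> B \<and> (\<forall>b\<in>B. \<forall>x\<in>I. b * x \<in> I)"

definition two_sided_ideal :: "('f::field \<Rightarrow> 'a::ring \<Rightarrow> 'a) \<Rightarrow> 'a set \<Rightarrow> 'a set \<Rightarrow> bool" where
  "two_sided_ideal s B I \<longleftrightarrow>
     module.subspace s I \<and> I \<subseteq> B \<and> (\<forall>b\<in>B. \<forall>x\<in>I. b * x \<in> I \<and> x * b \<in> I)"

definition maximal_modular_left_ideal ::
  "('f::field \<Rightarrow> 'a::ring \<Rightarrow> 'a) \<Rightarrow> 'a set \<Rightarrow> 'a set \<Rightarrow> bool" where
  "maximal_modular_left_ideal s B I \<longleftrightarrow>
     left_ideal s B I \<and> I \<noteq> B \<and> (\<exists>e\<in>B. \<forall>x\<in>B. x - x * e \<in> I) \<and>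
     (\<forall>K. left_ideal s B K \<and> I \<subseteq> K \<longrightarrow> K = I \<or> K = B)"

text \<open>The Jacobson radical of a not necessarily unital algebra \<open>B\<close> is the intersection of its
  maximal modular left ideals, which is \<open>B\<close> if there are none.\<close>

definition jacobson_radical :: "('f::field \<Rightarrow> 'a::ring \<Rightarrow> 'a) \<Rightarrow> 'a set \<Rightarrow> 'a set" where
  "jacobson_radical s B = B \<inter> \<Inter> {I. maximal_modular_left_ideal s B I}"

definition semisimple_algebra :: "('f::field \<Rightarrow> 'a::ring \<Rightarrow> 'a) \<Rightarrow> 'a set \<Rightarrow> bool" where
  "semisimple_algebra s B \<longleftrightarrow> jacobson_radical s B = {0}"

definition invariant :: "('h \<Rightarrow> 'a \<Rightarrow> 'a) \<Rightarrow> 'a set \<Rightarrow> bool" where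
  "invariant act M \<longleftrightarrow> (\<forall>h. \<forall>x\<in>M. act h x \<in> M)"

definition H_simple ::
  "('f::field \<Rightarrow> 'a::ring \<Rightarrow> 'a) \<Rightarrow> ('h \<Rightarrow> 'a \<Rightarrow> 'a) \<Rightarrow> 'a set \<Rightarrow> bool" where
  "H_simple s act B \<longleftrightarrow>
     B \<noteq> {0} \<and> (\<forall>I. two_sided_ideal s B I \<and> invariant act I \<longrightarrow> I = {0} \<or> I = B)"

definition direct_sum :: "'i set \<Rightarrow> ('i \<Rightarrow> 'a::comm_monoid_add set) \<Rightarrow> 'a set \<Rightarrow> bool" where
  "direct_sum I M V \<longleftrightarrow>
     V = {\<Sum>i\<in>I. f i | f. \<forall>i\<in>I. f i \<in> M i} \<and>
     (\<forall>f. (\<forall>i\<in>I. f i \<in> M i) \<and> (\<Sum>i\<in>I. f i) = 0 \<longrightarrow> (\<forall>i\<in>I. f i = 0))"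


section \<open>H-polynomials and codimensions\<close>

text \<open>With words as keys, \<open>'g free_monoid \<Rightarrow>\<^sub>0 'f\<close> is the free associative algebra with 1.\<close>

datatype 'g free_monoid = Word (letters: "'g list")

instantiation free_monoid :: (type) monoid_add
begin

definition zero_free_monoid :: "'a free_monoid" where
  "0 = Word []"

definition plus_free_monoid :: "'a free_monoid \<Rightarrow> 'a free_monoid \<Rightarrow> 'a free_monoid" where
  "u + v = Word (letters u @ letters v)"

instance
  by standard (simp_all add: zero_free_monoid_def plus_free_monoid_def)

end

text \<open>The letter \<open>(\<gamma>, i)\<close> stands for the generator \<open>x\<^sub>i\<^sup>\<gamma>\<close>, where \<open>\<gamma>\<close> belongs to the chosen
  basis \<open>\<Gamma>\<close> of \<open>H\<close>.\<close>

type_synonym ('h, 'f) H_poly = "('h \<times> nat) free_monoid \<Rightarrow>\<^sub>0 'f"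

text \<open>The free algebra without 1: a constant term cannot be evaluated in a nonunital algebra.\<close>

definition H_polynomials :: "'h set \<Rightarrow> ('h, 'f::field) H_poly set" where
  "H_polynomials \<Gamma> = {f. \<forall>w \<in> Poly_Mapping.keys f. w \<noteq> Word [] \<and> set (letters w) \<subseteq> \<Gamma> \<times> {1..}}"

text \<open>The element \<open>x\<^sub>i\<^sup>h\<close> for arbitrary \<open>h\<close>.\<close>

definition H_var ::
  "('f::field \<Rightarrow> 'h::ab_group_add \<Rightarrow> 'h) \<Rightarrow> 'h set \<Rightarrow> 'h \<Rightarrow> nat \<Rightarrow> ('h, 'f) H_poly" where
  "H_var scaleH \<Gamma> h i =
     (\<Sum>\<gamma> | module.representation scaleH \<Gamma> h \<gamma> \<noteq> 0.
        Poly_Mapping.single (Word [(\<gamma>, i)]) (module.representation scaleH \<Gamma> h \<gamma>))"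

definition H_eval ::
  "('f::field \<Rightarrow> 'a::ring \<Rightarrow> 'a) \<Rightarrow> ('h \<Rightarrow> 'a \<Rightarrow> 'a) \<Rightarrow> (nat \<Rightarrow> 'a) \<Rightarrow> ('h, 'f) H_poly \<Rightarrow> 'a" where
  "H_eval scaleA act a f =
     lin_ext scaleA (\<lambda>w. prod_nonempty (map (\<lambda>(\<gamma>, i). act \<gamma> (a i)) (letters w))) f"

definition H_identities ::
  "('f::field \<Rightarrow> 'a::ring \<Rightarrow> 'a) \<Rightarrow> ('h \<Rightarrow> 'a \<Rightarrow> 'a) \<Rightarrow> 'h set \<Rightarrow> ('h, 'f) H_poly set" where
  "H_identities scaleA act \<Gamma> = {f \<in> H_polynomials \<Gamma>. \<forall>a. H_eval scaleA act a f = 0}"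

definition multilinear_H_polynomials ::
  "('f::field \<Rightarrow> 'h::ab_group_add \<Rightarrow> 'h) \<Rightarrow> 'h set \<Rightarrow> nat \<Rightarrow> ('h, 'f) H_poly set" where
  "multilinear_H_polynomials scaleH \<Gamma> n = module.span pm_scale
     {prod_list (map (\<lambda>k. H_var scaleH \<Gamma> (h k) (\<sigma> k)) [1..<Suc n]) | h \<sigma>. \<sigma> permutes {1..n}}"

definition H_codimension ::
  "('f::field \<Rightarrow> 'h::ab_group_add \<Rightarrow> 'h) \<Rightarrow> ('f \<Rightarrow> 'a::ring \<Rightarrow> 'a) \<Rightarrow> ('h \<Rightarrow> 'a \<Rightarrow> 'a) \<Rightarrow>
     'h set \<Rightarrow> nat \<Rightarrow> nat" where
  "H_codimension scaleH scaleA act \<Gamma> n =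
     quotient_dim pm_scale (multilinear_H_polynomials scaleH \<Gamma> n)
       (multilinear_H_polynomials scaleH \<Gamma> n \<inter> H_identities scaleA act \<Gamma>)"

end

theory Submission
  imports Defs "HOL-Analysis.Convex"
begin

text \<open>The quotient of \<open>P\<^sub>n\<^sup>H\<close> by the identities of \<open>A\<close> is the space of functions \<open>A\<^sup>n \<Rightarrow> A\<close> spanned by the
monomials \<open>(a\<^sub>1, \<dots>, a\<^sub>n) \<mapsto> (h\<^sub>1 a\<^sub>\<sigma>\<^sub>1) \<dots> (h\<^sub>n a\<^sub>\<sigma>\<^sub>n)\<close>, so the codimension is the dimension of this space. Call a
set of components \<open>B\<^sub>i\<close> linked if all of them occur in one nonzero product of elements of \<open>A\<close>. The
number \<open>d\<close> is the largest total dimension of a linked set (\<open>linked\<close>, \<open>exponent\<close>).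

\<^bold>\<open>Upper bound.\<close> A multilinear function is determined by its values on tuples of basis vectors taken
from the \<open>B\<^sub>i\<close> and from \<open>J\<close>. If such a value is nonzero, then some product of translates \<open>h x\<close> of these
vectors is nonzero. Hence only boundedly many of them lie in \<open>J\<close>, which is nilpotent, and the
components of the others form a linked set (\<open>nonvanishing_basis_tuple\<close>). There are at most
polynomially many times \<open>d\<^sup>n\<close> tuples of this kind (\<open>H_codimension_upper_bound\<close>).

\<^bold>\<open>Lower bound.\<close> Let \<open>D\<close> be the sum of the components of a linked set of total dimension \<open>d\<close>. The trace
form \<open>tr (L\<^sub>x L\<^sub>y)\<close> of the left regular representation is nondegenerate on \<open>D\<close>: a nonnilpotent element of
its kernel would yield a nonzero idempotent in the kernel, but a nonzero idempotent has nonzero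
trace in characteristic 0; so the kernel is nil and lies in the radical. It follows that \<open>D\<close> has a
unit and that a basis of \<open>D\<close> has a dual basis (\<open>trace_form_dual_basis\<close>, \<open>unit_ex\<close>).

By H-simplicity and Burnside's theorem the maps \<open>x \<mapsto> b (h x) c\<close> span all linear maps of \<open>B\<^sub>i\<close>. If one
inserts maps of rank one into a nonzero product in which all components of \<open>D\<close> occur, and alternates,
one gets a function \<open>F\<close> that comes from an H-polynomial, alternates in \<open>d\<close> variables and does not
vanish when a basis of \<open>D\<close> is substituted for them (\<open>alternating_hfun_ex\<close>). For such \<open>F\<close> the sum of the
functions obtained by multiplying one of the \<open>d\<close> variables by \<open>y y'\<close> from the left equals
\<open>tr (L\<^sub>y L\<^sub>y\<^sub>') F\<close>, an observation of Razmyslov (\<open>trace_step_value\<close>). So \<open>F\<close> times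
\<open>\<Prod>\<^sub>j tr (y\<^sub>j y'\<^sub>\<sigma>\<^sub>j)\<close> comes from an H-polynomial for every permutation \<open>\<sigma>\<close> of \<open>m\<close> indices, while the
number of variables apart from the \<open>y\<^sub>j\<close> and \<open>y'\<^sub>j\<close> does not depend on \<open>m\<close>.

Evaluated at basis vectors \<open>y\<^sub>j\<close> and dual basis vectors \<open>y'\<^sub>j\<close>, these functions are the matrices by which
the symmetric group permutes the factors of \<open>D \<otimes> \<dots> \<otimes> D\<close>. Their span has dimension at least
\<open>d\<^sup>2\<^sup>m / (m + 1)\<^sup>k\<close> with \<open>k = d\<^sup>2\<close> (\<open>permutation_matrices_rank\<close>): by the Cauchy-Schwarz inequality a Gram
matrix \<open>G\<close> has rank at least \<open>(tr G)\<^sup>2 / tr (G\<^sup>2)\<close>, and here \<open>tr (G\<^sup>2)\<close> counts orbits of the symmetric group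
on words over an alphabet of \<open>d\<^sup>2\<close> letters. This replaces the asymptotics of the degrees of the
irreducible characters of the symmetric group.\<close>

section \<open>The rank of the permutation matrices\<close>

text \<open>Gram-Schmidt orthogonalisation for the restrictions of real functions to a finite set. The
orthonormal family may be shorter than the given one; only its length matters for the rank.\<close>

lemma gram_schmidt_on_finite_set:
  fixes v :: "'s \<Rightarrow> 'w \<Rightarrow> real"
  assumes "finite R" "finite W"
  shows "\<exists>(e :: nat \<Rightarrow> 'w \<Rightarrow> real) k. k \<le> card R \<and>
    (\<forall>i<k. \<forall>j<k. (\<Sum>w\<in>W. e i w * e j w) = (if i = j then 1 else 0)) \<and>
    (\<forall>r\<in>R. \<exists>a. \<forall>w\<in>W. v r w = (\<Sum>i<k. a i * e i w))"
  using assms(1)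
proof (induction R rule: finite_induct)
  case empty
  then show ?case by (intro exI[of _ undefined] exI[of _ 0]) auto
next
  case (insert r R)
  then obtain e k where k: "k \<le> card R"
    and on: "\<And>i j. i < k \<Longrightarrow> j < k \<Longrightarrow> (\<Sum>w\<in>W. e i w * e j w) = (if i = j then 1 else (0::real))"
    and rep: "\<And>r. r \<in> R \<Longrightarrow> \<exists>a. \<forall>w\<in>W. v r w = (\<Sum>i<k. a i * e i w)"
    by blast
  define a where "a i = (\<Sum>w\<in>W. v r w * e i w)" for i
  define u where "u w = v r w - (\<Sum>i<k. a i * e i w)" for w
  define N where "N = (\<Sum>w\<in>W. u w * u w)"
  have perp: "(\<Sum>w\<in>W. u w * e j w) = 0" if "j < k" for j
  proof -
    have "(\<Sum>w\<in>W. (\<Sum>i<k. a i * e i w) * e j w) = (\<Sum>i<k. a i * (\<Sum>w\<in>W. e i w * e j w))"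
      by (simp add: sum_distrib_left sum_distrib_right mult.assoc) (rule sum.swap)
    also have "\<dots> = (\<Sum>i<k. if i = j then a i else 0)"
      using that by (intro sum.cong) (auto simp: on)
    also have "\<dots> = a j" using that by simp
    finally show ?thesis by (simp add: u_def left_diff_distrib sum_subtractf a_def)
  qed
  show ?case
  proof (cases "N = 0")
    case True
    then have "\<forall>w\<in>W. u w = 0"
      unfolding N_def using assms(2) by (subst (asm) sum_nonneg_eq_0_iff) auto
    then have "\<forall>w\<in>W. v r w = (\<Sum>i<k. a i * e i w)" by (simp add: u_def)
    then show ?thesis using k on rep insert
      by (intro exI[of _ e] exI[of _ k]) auto
  next
    case False
    have "N \<ge> 0" unfolding N_def by (intro sum_nonneg) auto
    then have N: "N > 0" using False by simp
    define e' where "e' = e(k := (\<lambda>w. u w / sqrt N))"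
    have e'k: "e' k w = u w / sqrt N" and e'i: "i < k \<Longrightarrow> e' i = e i" for i w
      by (auto simp: e'_def)
    have "(\<Sum>w\<in>W. e' k w * e' k w) = N / (sqrt N * sqrt N)"
      by (simp add: e'k N_def sum_divide_distrib)
    then have n1: "(\<Sum>w\<in>W. e' k w * e' k w) = 1" using N by simp
    have n2: "(\<Sum>w\<in>W. e' k w * e' j w) = 0" "(\<Sum>w\<in>W. e' j w * e' k w) = 0" if "j < k" for j
      using perp[OF that] that
      by (simp_all add: e'k e'i sum_divide_distrib[symmetric] mult.commute[of "e j _"])
    have on': "(\<Sum>w\<in>W. e' i w * e' j w) = (if i = j then 1 else 0)" if "i < Suc k" "j < Suc k" for i j
      using that n1 n2 on[of i j] by (auto simp: less_Suc_eq e'i)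
    have rep': "\<exists>b. \<forall>w\<in>W. v s w = (\<Sum>i<Suc k. b i * e' i w)" if "s \<in> insert r R" for s
    proof (cases "s = r")
      case True
      have "\<forall>w\<in>W. v s w = (\<Sum>i<Suc k. (a(k := sqrt N)) i * e' i w)"
      proof
        fix w
        have "(\<Sum>i<k. (a(k := sqrt N)) i * e' i w) = (\<Sum>i<k. a i * e i w)"
          by (intro sum.cong) (auto simp: e'i)
        then show "v s w = (\<Sum>i<Suc k. (a(k := sqrt N)) i * e' i w)"
          using N True by (simp add: e'k u_def)
      qed
      then show ?thesis by blast
    next
      case False
      then obtain b where b: "\<forall>w\<in>W. v s w = (\<Sum>i<k. b i * e i w)" using rep \<open>s \<in> insert r R\<close> by blast
      have "\<forall>w\<in>W. v s w = (\<Sum>i<Suc k. (b(k := 0)) i * e' i w)"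
        using b by (auto intro!: sum.cong simp: e'i)
      then show ?thesis by blast
    qed
    show ?thesis
      by (rule exI[of _ e'], rule exI[of _ "Suc k"]) (use k insert on' rep' in auto)
  qed
qed

text \<open>A Gram matrix \<open>G\<close> of vectors in a space of dimension \<open>k\<close> has at most \<open>k\<close> nonzero eigenvalues, so
\<open>(tr G)\<^sup>2 \<le> k tr (G\<^sup>2)\<close> by Cauchy-Schwarz. Instead of eigenvalues the proof uses the diagonal of the
\<open>k\<close> by \<open>k\<close> matrix of second moments of the coordinates in an orthonormal basis, which has the same
trace and the same Frobenius norm as \<open>G\<close>.\<close>

lemma rank_ge_trace_square_div_frobenius:
  fixes v :: "'s \<Rightarrow> 'w \<Rightarrow> real"
  assumes "finite T" "finite W" "finite R"
    and span: "\<And>s. s \<in> T \<Longrightarrow> \<exists>q. \<forall>w\<in>W. v s w = (\<Sum>r\<in>R. q r * v r w)"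
  shows "(\<Sum>s\<in>T. \<Sum>w\<in>W. v s w * v s w)\<^sup>2 \<le>
    real (card R) * (\<Sum>s\<in>T. \<Sum>t\<in>T. (\<Sum>w\<in>W. v s w * v t w)\<^sup>2)"
proof -
  obtain e k where k: "k \<le> card R"
    and on: "\<And>i j. i < k \<Longrightarrow> j < k \<Longrightarrow> (\<Sum>w\<in>W. e i w * e j w) = (if i = j then 1 else (0::real))"
    and rep: "\<And>r. r \<in> R \<Longrightarrow> \<exists>a. \<forall>w\<in>W. v r w = (\<Sum>i<k. a i * e i w)"
    using gram_schmidt_on_finite_set[OF assms(3,2), of v] by blast
  obtain a where a: "\<And>r w. r \<in> R \<Longrightarrow> w \<in> W \<Longrightarrow> v r w = (\<Sum>i<k. a r i * e i w)"
    using rep by metis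
  have "\<exists>b. \<forall>w\<in>W. v s w = (\<Sum>i<k. b i * e i w)" if s: "s \<in> T" for s
  proof -
    obtain q where q: "\<forall>w\<in>W. v s w = (\<Sum>r\<in>R. q r * v r w)" using span[OF s] by blast
    have "\<forall>w\<in>W. v s w = (\<Sum>i<k. (\<Sum>r\<in>R. q r * a r i) * e i w)"
    proof
      fix w assume w: "w \<in> W"
      have "v s w = (\<Sum>r\<in>R. \<Sum>i<k. q r * (a r i * e i w))"
        using q w by (simp add: a sum_distrib_left)
      also have "\<dots> = (\<Sum>i<k. \<Sum>r\<in>R. q r * (a r i * e i w))" by (rule sum.swap)
      finally show "v s w = (\<Sum>i<k. (\<Sum>r\<in>R. q r * a r i) * e i w)"
        by (simp add: sum_distrib_right mult.assoc)
    qed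
    then show ?thesis by (rule exI[of _ "\<lambda>i. \<Sum>r\<in>R. q r * a r i"])
  qed
  then obtain b where b: "\<And>s w. s \<in> T \<Longrightarrow> w \<in> W \<Longrightarrow> v s w = (\<Sum>i<k. b s i * e i w)"
    by metis
  have ip: "(\<Sum>w\<in>W. v s w * v t w) = (\<Sum>i<k. b s i * b t i)" if "s \<in> T" "t \<in> T" for s t
  proof -
    have "(\<Sum>w\<in>W. v s w * v t w) = (\<Sum>w\<in>W. \<Sum>i<k. \<Sum>j<k. b s i * b t j * (e i w * e j w))"
      using that by (simp add: b sum_product mult_ac)
    also have "\<dots> = (\<Sum>i<k. \<Sum>w\<in>W. \<Sum>j<k. b s i * b t j * (e i w * e j w))" by (rule sum.swap)
    also have "\<dots> = (\<Sum>i<k. \<Sum>j<k. b s i * b t j * (\<Sum>w\<in>W. e i w * e j w))"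
      by (intro sum.cong refl, subst sum.swap) (simp add: sum_distrib_left)
    also have "\<dots> = (\<Sum>i<k. \<Sum>j<k. if i = j then b s i * b t j else 0)"
      by (intro sum.cong) (auto simp: on)
    also have "\<dots> = (\<Sum>i<k. b s i * b t i)" by simp
    finally show ?thesis .
  qed
  define g where "g i j = (\<Sum>s\<in>T. b s i * b s j)" for i j
  have "(\<Sum>s\<in>T. \<Sum>w\<in>W. v s w * v s w) = (\<Sum>s\<in>T. \<Sum>i<k. b s i * b s i)"
    by (intro sum.cong refl ip)
  also have "\<dots> = (\<Sum>i<k. g i i)" unfolding g_def by (rule sum.swap)
  finally have tr: "(\<Sum>s\<in>T. \<Sum>w\<in>W. v s w * v s w) = (\<Sum>i<k. g i i)" .
  have "(\<Sum>s\<in>T. \<Sum>t\<in>T. (\<Sum>w\<in>W. v s w * v t w)\<^sup>2) =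
      (\<Sum>s\<in>T. \<Sum>t\<in>T. \<Sum>i<k. \<Sum>j<k. (b s i * b s j) * (b t i * b t j))"
    by (intro sum.cong refl) (simp add: ip power2_eq_square sum_product mult_ac)
  also have "\<dots> = (\<Sum>s\<in>T. \<Sum>i<k. \<Sum>j<k. \<Sum>t\<in>T. (b s i * b s j) * (b t i * b t j))"
    by (intro sum.cong refl, subst sum.swap, intro sum.cong refl, rule sum.swap)
  also have "\<dots> = (\<Sum>i<k. \<Sum>j<k. \<Sum>s\<in>T. \<Sum>t\<in>T. (b s i * b s j) * (b t i * b t j))"
    by (subst sum.swap, intro sum.cong refl, rule sum.swap)
  also have "\<dots> = (\<Sum>i<k. \<Sum>j<k. (g i j)\<^sup>2)"
    by (simp add: g_def power2_eq_square sum_product)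
  finally have fr: "(\<Sum>s\<in>T. \<Sum>t\<in>T. (\<Sum>w\<in>W. v s w * v t w)\<^sup>2) = (\<Sum>i<k. \<Sum>j<k. (g i j)\<^sup>2)" .
  have diag: "(\<Sum>i<k. (g i i)\<^sup>2) \<le> (\<Sum>i<k. \<Sum>j<k. (g i j)\<^sup>2)"
    by (intro sum_mono member_le_sum) auto
  have "(\<Sum>i<k. g i i)\<^sup>2 \<le> real k * (\<Sum>i<k. (g i i)\<^sup>2)"
    using Cauchy_Schwarz_ineq_sum[of "\<lambda>_. 1" "\<lambda>i. g i i" "{..<k}"] by simp
  also have "\<dots> \<le> real (card R) * (\<Sum>i<k. \<Sum>j<k. (g i j)\<^sup>2)"
    using k diag by (intro mult_mono) (auto intro: sum_nonneg)
  finally show ?thesis by (simp add: tr fr)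
qed

lemma words_with_equal_counts_permute:
  fixes w w' :: "'i \<Rightarrow> 'e"
  assumes "finite E" "finite I" "w \<in> I \<rightarrow> E" "w' \<in> I \<rightarrow> E"
    and "\<And>e. e \<in> E \<Longrightarrow> card {i\<in>I. w i = e} = card {i\<in>I. w' i = e}"
  obtains p where "p permutes I" "\<And>i. i \<in> I \<Longrightarrow> w i = w' (p i)"
proof -
  have "image_mset w (mset_set I) = image_mset w' (mset_set I)"
  proof (rule multiset_eqI)
    fix e :: 'e
    have eq: "count (image_mset u (mset_set I)) e = card {i\<in>I. u i = e}" for u :: "'i \<Rightarrow> 'e"
      using assms(2) by (auto simp: count_image_mset vimage_def Int_def intro!: arg_cong[where f = card])
    show "count (image_mset w (mset_set I)) e = count (image_mset w' (mset_set I)) e"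
    proof (cases "e \<in> E")
      case False
      then have "{i\<in>I. w i = e} = {}" "{i\<in>I. w' i = e} = {}" using assms(3,4) by auto
      then show ?thesis by (metis eq)
    qed (simp add: eq assms)
  qed
  then obtain p where "p permutes I" "\<forall>i\<in>I. w i = w' (p i)"
    by (rule image_mset_eq_implies_permutes[OF assms(2)])
  then show ?thesis using that[of p] by simp
qed

text \<open>Orbit counting for the symmetric group on words of length \<open>m\<close>: each orbit contributes exactly
\<open>(m!)\<^sup>2\<close> triples, and there are at most as many orbits as functions counting the occurrences of the
letters. Fix a representative \<open>w\<^sub>0\<close> in each orbit and write \<open>w = w\<^sub>0 \<circ> \<rho>\<close>. Then \<open>(w, s, t)\<close> is determined
by the orbit, by \<open>\<rho> s t\<^sup>-\<^sup>1\<close> and by \<open>t\<close>, because \<open>w\<^sub>0 \<circ> \<rho> s t\<^sup>-\<^sup>1 = w\<close>.\<close>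

lemma card_coinciding_permutation_pairs:
  fixes m :: nat and E :: "'e set"
  assumes E: "finite E"
  defines "P \<equiv> {p. p permutes {..<m}}"
  shows "card {(w, s, t). w \<in> PiE {..<m} (\<lambda>_. E) \<and> s \<in> P \<and> t \<in> P \<and> (\<forall>i<m. w (s i) = w (t i))}
    \<le> (Suc m) ^ card E * (fact m)\<^sup>2" (is "card ?X \<le> _")
proof -
  let ?W = "PiE {..<m} (\<lambda>_. E)"
  have finW: "finite ?W" using E by (intro finite_PiE) auto
  have finP: "finite P" unfolding P_def by (rule finite_permutations) simp
  have cP: "card P = fact m" unfolding P_def by (rule card_permutations) auto
  define \<kappa> where "\<kappa> w = restrict (\<lambda>e. card {i\<in>{..<m}. w i = e}) E" for w
  have \<kappa>: "\<kappa> w \<in> PiE E (\<lambda>_. {..m})" for w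
  proof -
    have "card {i\<in>{..<m}. w i = e} \<le> card {..<m}" for e by (rule card_mono) auto
    then show ?thesis by (auto simp: \<kappa>_def)
  qed
  define w0 where "w0 w = (SOME u. u \<in> ?W \<and> \<kappa> u = \<kappa> w)" for w
  have w0: "w0 w \<in> ?W \<and> \<kappa> (w0 w) = \<kappa> w" if "w \<in> ?W" for w
    unfolding w0_def by (rule someI[of _ w]) (use that in auto)
  have w0\<kappa>: "w0 w = w0 w'" if "\<kappa> w = \<kappa> w'" for w w' using that by (simp add: w0_def)
  have "\<exists>p. p \<in> P \<and> (\<forall>i<m. w i = w0 w (p i))" if w: "w \<in> ?W" for w
  proof -
    have "card {i\<in>{..<m}. w i = e} = card {i\<in>{..<m}. w0 w i = e}" if "e \<in> E" for e
    proof -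
      have "\<kappa> w e = \<kappa> (w0 w) e" using w0[OF w] by simp
      then show ?thesis by (simp add: \<kappa>_def that)
    qed
    moreover have "w \<in> {..<m} \<rightarrow> E" "w0 w \<in> {..<m} \<rightarrow> E" using w w0[OF w] by (auto simp: PiE_def)
    ultimately obtain p where "p permutes {..<m}" "\<And>i. i \<in> {..<m} \<Longrightarrow> w i = w0 w (p i)"
      using words_with_equal_counts_permute[OF E finite_lessThan] by blast
    then show ?thesis unfolding P_def by blast
  qed
  then have "\<forall>w\<in>?W. \<exists>p. p \<in> P \<and> (\<forall>i<m. w i = w0 w (p i))" by blast
  from bchoice[OF this] obtain \<rho>
    where \<rho>: "\<And>w. w \<in> ?W \<Longrightarrow> \<rho> w \<in> P" "\<And>w i. w \<in> ?W \<Longrightarrow> i < m \<Longrightarrow> w i = w0 w (\<rho> w i)"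
    by blast
  define F where "F = (\<lambda>(w, s, t). (\<kappa> w, \<rho> w \<circ> s \<circ> inv t, t :: nat \<Rightarrow> nat))"
  have inj: "inj_on F ?X"
  proof (rule inj_onI)
    fix x x' assume X: "x \<in> ?X" "x' \<in> ?X" and eq': "F x = F x'"
    obtain w s t where x1: "x = (w, s, t)" by (rule prod_cases3)
    obtain w' s' t' where x2: "x' = (w', s', t')" by (rule prod_cases3)
    note x = x1 x2
    have eq: "F (w, s, t) = F (w', s', t')" using eq' x by simp
    from X have w: "w \<in> ?W" "w' \<in> ?W" and s: "s \<in> P" "s' \<in> P" and t: "t \<in> P" "t' \<in> P"
      and st: "\<And>i. i < m \<Longrightarrow> w (s i) = w (t i)" "\<And>i. i < m \<Longrightarrow> w' (s' i) = w' (t' i)"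
      by (auto simp: x)
    have tt: "t = t'" and kk: "\<kappa> w = \<kappa> w'" and rr: "\<rho> w \<circ> s \<circ> inv t = \<rho> w' \<circ> s' \<circ> inv t"
      using eq by (auto simp: F_def)
    have inP: "inv t i < m" if "i < m" for i
      using t(1) that permutes_inv[of t "{..<m}"] permutes_in_image[of "inv t" "{..<m}" i] by (auto simp: P_def)
    have sm: "u i < m" if "u \<in> P" "i < m" for u i
      using that permutes_in_image[of u "{..<m}" i] by (auto simp: P_def)
    have rec: "w0 w (\<rho> w (s (inv t i))) = w i" if "i < m" "w \<in> ?W" "s \<in> P" "\<And>i. i < m \<Longrightarrow> w (s i) = w (t i)" for w s i
    proof -
      have "w0 w (\<rho> w (s (inv t i))) = w (s (inv t i))" using \<rho>(2)[OF that(2)] sm[OF that(3)] inP that(1) by simp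
      also have "\<dots> = w (t (inv t i))" using that(4) inP that(1) by simp
      also have "\<dots> = w i" using t by (simp add: P_def permutes_inverses)
      finally show ?thesis .
    qed
    have "w i = w' i" if "i < m" for i
    proof -
      have "\<rho> w (s (inv t i)) = \<rho> w' (s' (inv t i))" using fun_cong[OF rr, of i] by simp
      moreover have "w0 w (\<rho> w (s (inv t i))) = w i" by (rule rec[OF that w(1) s(1) st(1)])
      moreover have "w0 w' (\<rho> w' (s' (inv t i))) = w' i"
        by (rule rec[OF that w(2) s(2)]) (use st(2) tt in simp)
      ultimately show ?thesis using w0\<kappa>[OF kk] by simp
    qed
    then have ww: "w = w'" using w by (intro PiE_ext[of w _ _ w']) auto
    have bj: "bij (\<rho> w)" "bij t" using \<rho>(1)[OF w(1)] t by (auto simp: P_def permutes_bij)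
    have *: "s (inv t i) = s' (inv t i)" for i
    proof -
      have "\<rho> w (s (inv t i)) = \<rho> w (s' (inv t i))" using fun_cong[OF rr, of i] ww tt by simp
      then show ?thesis using bj(1) by (simp add: bij_def inj_eq)
    qed
    have "s i = s' i" for i using *[of "t i"] t(1) by (simp add: P_def permutes_inverses)
    then have "s = s'" by blast
    then show "x = x'" using ww tt x by simp
  qed
  have img: "F ` ?X \<subseteq> PiE E (\<lambda>_. {..m}) \<times> P \<times> P"
  proof (clarsimp simp: F_def \<kappa>)
    fix w s t assume "w \<in> ?W" "s \<in> P" "t \<in> P"
    then show "\<rho> w \<circ> s \<circ> inv t \<in> P" using \<rho>(1)
      by (auto simp: P_def intro!: permutes_compose permutes_inv)
  qed
  have "card ?X \<le> card (PiE E (\<lambda>_. {..m}) \<times> P \<times> P)"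
    by (rule card_inj_on_le[OF inj img]) (intro finite_cartesian_product finite_PiE E finP finite_atMost)
  also have "\<dots> = (Suc m) ^ card E * (fact m)\<^sup>2"
    using E by (simp add: card_cartesian_product cP card_PiE power2_eq_square)
  finally show ?thesis .
qed

text \<open>Linear relations with coefficients in an arbitrary field of characteristic 0 have to be compared
with relations over the reals, where the rank inequality lives. A rational linear functional on the
field, normalised at 1, transports them.\<close>

lemma rational_functional_ex:
  "\<exists>\<phi> :: 'f::field_char_0 \<Rightarrow> rat.
     (\<forall>x y. \<phi> (x + y) = \<phi> x + \<phi> y) \<and> (\<forall>q x. \<phi> (of_rat q * x) = q * \<phi> x) \<and> \<phi> 1 = 1"
proof -
  interpret V: vector_space "\<lambda>(q::rat) (x::'f). of_rat q * x"
    by unfold_locales (simp_all add: algebra_simps of_rat_add of_rat_mult)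
  interpret Q: vector_space "(*) :: rat \<Rightarrow> rat \<Rightarrow> rat"
    by unfold_locales (simp_all add: algebra_simps)
  interpret VQ: vector_space_pair "\<lambda>(q::rat) (x::'f). of_rat q * x" "(*) :: rat \<Rightarrow> rat \<Rightarrow> rat" ..
  have "V.independent {1}" by simp
  from VQ.linear_independent_extend[OF this, of "\<lambda>_. 1"]
  obtain g where g: "Vector_Spaces.linear (\<lambda>(q::rat) (x::'f). of_rat q * x) (*) g" "g 1 = 1" by auto
  interpret g: Vector_Spaces.linear "\<lambda>(q::rat) (x::'f). of_rat q * x" "(*)" g by fact
  show ?thesis by (rule exI[of _ g]) (simp add: g.add g.scale g(2))
qed

lemma rational_solution_if_solution:
  fixes c :: "'s \<Rightarrow> 'f::field_char_0" and v :: "'s \<Rightarrow> 'w \<Rightarrow> rat"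
  assumes "\<And>w. w \<in> W \<Longrightarrow> of_rat (b w) = (\<Sum>r\<in>R. c r * of_rat (v r w))"
  shows "\<exists>q. \<forall>w\<in>W. b w = (\<Sum>r\<in>R. q r * v r w)"
proof -
  obtain \<phi> :: "'f \<Rightarrow> rat" where \<phi>: "\<And>x y. \<phi> (x + y) = \<phi> x + \<phi> y" "\<And>q x. \<phi> (of_rat q * x) = q * \<phi> x" "\<phi> 1 = 1"
    using rational_functional_ex by blast
  have \<phi>0: "\<phi> 0 = 0" using \<phi>(2)[of 0] by simp
  have \<phi>s: "\<phi> (sum f R) = (\<Sum>r\<in>R. \<phi> (f r))" for f
    by (induction R rule: infinite_finite_induct) (simp_all add: \<phi>(1) \<phi>0)
  have "b w = (\<Sum>r\<in>R. \<phi> (c r) * v r w)" if "w \<in> W" for w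
  proof -
    have *: "of_rat (b w) = (\<Sum>r\<in>R. of_rat (v r w) * c r)"
      using assms[OF that] by (simp only: mult.commute)
    have "b w = \<phi> (of_rat (b w))" using \<phi>(2)[of "b w" 1] by (simp add: \<phi>(3))
    also have "\<dots> = (\<Sum>r\<in>R. \<phi> (of_rat (v r w) * c r))" unfolding * by (rule \<phi>s)
    also have "\<dots> = (\<Sum>r\<in>R. \<phi> (c r) * v r w)" by (intro sum.cong refl) (simp add: \<phi>(2))
    finally show ?thesis .
  qed
  then show ?thesis by (intro exI[of _ "\<lambda>r. \<phi> (c r)"]) blast
qed

lemma maximal_independent_subfamily_ex:
  fixes v :: "'s \<Rightarrow> 'w \<Rightarrow> 'f::field"
  assumes "finite T"
  obtains R where "R \<subseteq> T"
    "\<And>c. \<forall>w\<in>W. (\<Sum>r\<in>R. c r * v r w) = 0 \<Longrightarrow> \<forall>r\<in>R. c r = 0"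
    "\<And>s. s \<in> T \<Longrightarrow> \<exists>c. \<forall>w\<in>W. v s w = (\<Sum>r\<in>R. c r * v r w)"
proof -
  define Ind where "Ind R \<longleftrightarrow> (\<forall>c. (\<forall>w\<in>W. (\<Sum>r\<in>R. c r * v r w) = 0) \<longrightarrow> (\<forall>r\<in>R. c r = 0))" for R
  define Rs where "Rs = {R. R \<subseteq> T \<and> Ind R}"
  have "finite Rs" using assms by (simp add: Rs_def)
  moreover have "{} \<in> Rs" by (simp add: Rs_def Ind_def)
  then have "Rs \<noteq> {}" by (metis empty_iff)
  ultimately obtain R where "R \<in> Rs" and max: "\<forall>R'\<in>Rs. R \<subseteq> R' \<longrightarrow> R = R'"
    using finite_has_maximal[of Rs] by blast
  then have R: "R \<subseteq> T" "Ind R" by (simp_all add: Rs_def)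
  have fin: "finite R" using R assms finite_subset by blast
  show thesis
  proof (rule that[of R])
    show "R \<subseteq> T" by fact
    show "\<forall>r\<in>R. c r = 0" if "\<forall>w\<in>W. (\<Sum>r\<in>R. c r * v r w) = 0" for c
      using R(2) that unfolding Ind_def by blast
    fix s assume s: "s \<in> T"
    show "\<exists>c. \<forall>w\<in>W. v s w = (\<Sum>r\<in>R. c r * v r w)"
    proof (cases "s \<in> R")
      case True
      have "(\<Sum>r\<in>R. (if r = s then 1 else 0) * v r w) = v s w" for w
      proof -
        have "(\<Sum>r\<in>R. (if r = s then 1 else 0) * v r w) = (\<Sum>r\<in>R. if r = s then v r w else 0)"
          by (intro sum.cong) auto
        then show ?thesis using fin True by simp
      qed
      then show ?thesis by (intro exI[of _ "\<lambda>r. if r = s then 1 else 0"]) simp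
    next
      case False
      have "insert s R \<notin> Rs" using max False by blast
      then have "\<not> Ind (insert s R)" using R(1) s by (simp add: Rs_def)
      then obtain c where c: "\<forall>w\<in>W. (\<Sum>r\<in>insert s R. c r * v r w) = 0" "\<exists>r\<in>insert s R. c r \<noteq> 0"
        unfolding Ind_def by blast
      have eq: "c s * v s w + (\<Sum>r\<in>R. c r * v r w) = 0" if "w \<in> W" for w
        using c(1) that fin False by simp
      have cs: "c s \<noteq> 0"
      proof
        assume "c s = 0"
        then have "\<forall>w\<in>W. (\<Sum>r\<in>R. c r * v r w) = 0" using eq by simp
        then have "\<forall>r\<in>R. c r = 0" using R(2) unfolding Ind_def by blast
        then show False using c(2) \<open>c s = 0\<close> by blast
      qed
      have "v s w = (\<Sum>r\<in>R. (- c r / c s) * v r w)" if "w \<in> W" for w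
      proof -
        have "(\<Sum>r\<in>R. (- c r / c s) * v r w) = - (\<Sum>r\<in>R. c r * v r w) / c s"
          by (simp add: sum_divide_distrib sum_negf)
        also have "\<dots> = c s * v s w / c s" using eq[OF that] by (metis add_eq_0_iff2 minus_minus)
        also have "\<dots> = v s w" using cs by simp
        finally show ?thesis by simp
      qed
      then show ?thesis by (intro exI[of _ "\<lambda>r. - c r / c s"]) blast
    qed
  qed
qed

text \<open>The matrix of a permutation \<open>s\<close> in the standard basis of the \<open>m\<close>-th tensor power has rows and columns
indexed by words, with entry 1 at \<open>(u, v)\<close> if \<open>u = v \<circ> s\<close>. The inner product of the matrices of \<open>s\<close>
and \<open>t\<close> is the number of words \<open>v\<close> with \<open>v \<circ> s = v \<circ> t\<close>; its square counts such words over pairs of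
letters, whence the exponent \<open>(card D)\<^sup>2\<close>.\<close>

theorem permutation_matrices_rank:
  fixes D :: "'e set" and m :: nat
  assumes D: "finite D"
  defines "W \<equiv> PiE {..<m} (\<lambda>_. D)"
  shows "\<exists>R. R \<subseteq> {s. s permutes {..<m}} \<and>
    real (card D) ^ (2 * m) \<le> real (card R) * real (Suc m) ^ ((card D)\<^sup>2) \<and>
    (\<forall>c :: (nat \<Rightarrow> nat) \<Rightarrow> 'f::field_char_0.
      (\<forall>u\<in>W. \<forall>v\<in>W. (\<Sum>s\<in>R. if \<forall>i<m. u i = v (s i) then c s else 0) = 0) \<longrightarrow> (\<forall>s\<in>R. c s = 0))"
proof -
  define P where "P = {s. s permutes {..<m}}"
  have finP: "finite P" unfolding P_def by (rule finite_permutations) simp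
  have cP: "card P = fact m" unfolding P_def by (rule card_permutations) auto
  have finW: "finite W" using D unfolding W_def by (intro finite_PiE) auto
  define \<theta> :: "(nat \<Rightarrow> nat) \<Rightarrow> (nat \<Rightarrow> 'e) \<times> (nat \<Rightarrow> 'e) \<Rightarrow> rat"
    where "\<theta> s w = (if \<forall>i<m. fst w i = snd w (s i) then 1 else 0)" for s w
  obtain R where R: "R \<subseteq> P"
    and ind: "\<And>c :: _ \<Rightarrow> 'f. \<forall>w\<in>W\<times>W. (\<Sum>r\<in>R. c r * of_rat (\<theta> r w)) = 0 \<Longrightarrow> \<forall>r\<in>R. c r = 0"
    and span: "\<And>s. s \<in> P \<Longrightarrow> \<exists>c :: _ \<Rightarrow> 'f. \<forall>w\<in>W\<times>W. of_rat (\<theta> s w) = (\<Sum>r\<in>R. c r * of_rat (\<theta> r w))"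
    using maximal_independent_subfamily_ex[OF finP, where v = "\<lambda>s w. of_rat (\<theta> s w) :: 'f" and W = "W \<times> W"]
    by blast
  have finR: "finite R" using R finP finite_subset by blast
  define g where "g s v = restrict (\<lambda>i. v (s i)) {..<m}" for s :: "nat \<Rightarrow> nat" and v :: "nat \<Rightarrow> 'e"
  have gW: "g s v \<in> W" if "s \<in> P" "v \<in> W" for s v
    using that by (auto simp: g_def W_def P_def dest: permutes_in_image)
  have \<theta>g: "\<theta> s (u, v) = (if u = g s v then 1 else 0)" if "u \<in> W" for s u v
  proof -
    have "(\<forall>i<m. u i = v (s i)) \<longleftrightarrow> u = g s v"
    proof
      assume *: "\<forall>i<m. u i = v (s i)"
      show "u = g s v"
      proof
        fix i show "u i = g s v i" using * that by (cases "i < m") (auto simp: g_def W_def PiE_def extensional_def)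
      qed
    qed (simp add: g_def)
    then show ?thesis by (simp add: \<theta>_def)
  qed
  define C where "C s t = {v \<in> W. \<forall>i<m. v (s i) = v (t i)}" for s t :: "nat \<Rightarrow> nat"
  have gC: "g s v = g t v \<longleftrightarrow> (\<forall>i<m. v (s i) = v (t i))" for s t v
    by (auto simp: g_def fun_eq_iff restrict_def)
  have ip: "(\<Sum>w\<in>W\<times>W. real_of_rat (\<theta> s w) * real_of_rat (\<theta> t w)) = real (card (C s t))"
    if "s \<in> P" "t \<in> P" for s t
  proof -
    have "(\<Sum>w\<in>W\<times>W. real_of_rat (\<theta> s w) * real_of_rat (\<theta> t w)) =
        (\<Sum>u\<in>W. \<Sum>v\<in>W. real_of_rat (\<theta> s (u, v)) * real_of_rat (\<theta> t (u, v)))"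
      by (simp add: sum.cartesian_product)
    also have "\<dots> = (\<Sum>v\<in>W. \<Sum>u\<in>W. real_of_rat (\<theta> s (u, v)) * real_of_rat (\<theta> t (u, v)))"
      by (rule sum.swap)
    also have "\<dots> = (\<Sum>v\<in>W. \<Sum>u\<in>W. if u = g s v then (if g s v = g t v then 1 else 0) else 0)"
      by (intro sum.cong refl) (auto simp: \<theta>g)
    also have "\<dots> = (\<Sum>v\<in>W. if g s v = g t v then 1 else 0)"
      using finW that by (intro sum.cong refl) (simp add: gW)
    also have "\<dots> = real (card (C s t))"
      using finW by (simp add: sum.If_cases C_def gC Int_def)
    finally show ?thesis .
  qed
  have Css: "card (C s s) = card D ^ m" for s
    by (simp add: C_def W_def card_PiE D)
  have tr: "(\<Sum>s\<in>P. \<Sum>w\<in>W\<times>W. real_of_rat (\<theta> s w) * real_of_rat (\<theta> s w)) = fact m * real (card D) ^ m"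
    by (simp add: ip Css cP)
  \<comment> \<open>A pair of words is one word over the alphabet of pairs.\<close>
  have fr: "(\<Sum>s\<in>P. \<Sum>t\<in>P. card (C s t) * card (C s t)) \<le> (Suc m) ^ (card (D \<times> D)) * (fact m)\<^sup>2"
  proof -
    let ?Y = "SIGMA s:P. SIGMA t:P. C s t \<times> C s t"
    let ?X = "{(w, s, t). w \<in> PiE {..<m} (\<lambda>_. D \<times> D) \<and> s \<in> {s. s permutes {..<m}} \<and>
      t \<in> {s. s permutes {..<m}} \<and> (\<forall>i<m. w (s i) = w (t i))}"
    define F where "F = (\<lambda>(s :: nat \<Rightarrow> nat, t :: nat \<Rightarrow> nat, v :: nat \<Rightarrow> 'e, v' :: nat \<Rightarrow> 'e).
      (restrict (\<lambda>i. (v i, v' i)) {..<m}, s, t))"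
    have finC: "finite (C s t)" for s t using finW by (simp add: C_def)
    have "(\<Sum>s\<in>P. \<Sum>t\<in>P. card (C s t) * card (C s t)) = card ?Y"
      using finP finC by (simp add: card_SigmaI card_cartesian_product)
    also have "\<dots> \<le> card ?X"
    proof (rule card_inj_on_le[of F])
      show "inj_on F ?Y"
      proof (rule inj_onI)
        fix y y' assume y: "y \<in> ?Y" "y' \<in> ?Y" "F y = F y'"
        obtain s t v v' where y1: "y = (s, t, v, v')" by (rule prod_cases4)
        obtain s' t' u u' where y2: "y' = (s', t', u, u')" by (rule prod_cases4)
        have st: "s = s'" "t = t'"
          and e: "restrict (\<lambda>i. (v i, v' i)) {..<m} = restrict (\<lambda>i. (u i, u' i)) {..<m}"
          using y(3) by (auto simp: F_def y1 y2)
        have W: "v \<in> W" "v' \<in> W" "u \<in> W" "u' \<in> W" using y(1,2) by (auto simp: y1 y2 C_def)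
        have "v i = u i \<and> v' i = u' i" if "i < m" for i
          using fun_cong[OF e, of i] that by simp
        then have "v = u" "v' = u'" using W unfolding W_def by (auto intro: PiE_ext)
        then show "y = y'" using st y1 y2 by simp
      qed
      show "F ` ?Y \<subseteq> ?X"
      proof (rule subsetI, elim imageE)
        fix x y assume "y \<in> ?Y" "x = F y"
        obtain s t v v' where y1: "y = (s, t, v, v')" by (rule prod_cases4)
        have st: "s \<in> P" "t \<in> P" "v \<in> C s t" "v' \<in> C s t" using \<open>y \<in> ?Y\<close> by (auto simp: y1)
        have lt: "s i < m" "t i < m" if "i < m" for i
          using st(1,2) that permutes_in_image[of s "{..<m}" i] permutes_in_image[of t "{..<m}" i] by (auto simp: P_def)
        show "x \<in> ?X" using st lt unfolding \<open>x = F y\<close> y1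
          by (auto simp: F_def C_def W_def P_def)
      qed
      have "?X \<subseteq> PiE {..<m} (\<lambda>_. D \<times> D) \<times> P \<times> P" by (auto simp: P_def)
      then show "finite ?X" by (rule finite_subset) (use D finP in \<open>auto intro: finite_PiE\<close>)
    qed
    also have "\<dots> \<le> (Suc m) ^ (card (D \<times> D)) * (fact m)\<^sup>2"
      by (rule card_coinciding_permutation_pairs) (use D in simp)
    finally show ?thesis .
  qed
  have "(fact m * real (card D) ^ m)\<^sup>2 \<le>
      real (card R) * (\<Sum>s\<in>P. \<Sum>t\<in>P. (\<Sum>w\<in>W\<times>W. real_of_rat (\<theta> s w) * real_of_rat (\<theta> t w))\<^sup>2)"
    unfolding tr[symmetric]
  proof (rule rank_ge_trace_square_div_frobenius)
    fix s assume "s \<in> P"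
    then obtain c :: "_ \<Rightarrow> 'f" where c: "\<forall>w\<in>W\<times>W. of_rat (\<theta> s w) = (\<Sum>r\<in>R. c r * of_rat (\<theta> r w))"
      using span by blast
    obtain q where q: "\<forall>w\<in>W\<times>W. \<theta> s w = (\<Sum>r\<in>R. q r * \<theta> r w)"
      using rational_solution_if_solution[of "W \<times> W" "\<theta> s" c \<theta> R] c by blast
    then have "\<forall>w\<in>W\<times>W. real_of_rat (\<theta> s w) = (\<Sum>r\<in>R. of_rat (q r) * of_rat (\<theta> r w))"
      by (simp add: of_rat_sum of_rat_mult)
    then show "\<exists>q. \<forall>w\<in>W\<times>W. real_of_rat (\<theta> s w) = (\<Sum>r\<in>R. q r * of_rat (\<theta> r w))"
      by (intro exI[of _ "\<lambda>r. of_rat (q r)"])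
  qed (use finP finW finR in auto)
  also have "(\<Sum>s\<in>P. \<Sum>t\<in>P. (\<Sum>w\<in>W\<times>W. real_of_rat (\<theta> s w) * real_of_rat (\<theta> t w))\<^sup>2) =
      real (\<Sum>s\<in>P. \<Sum>t\<in>P. card (C s t) * card (C s t))"
    by (simp add: ip power2_eq_square)
  also have "real (card R) * \<dots> \<le> real (card R) * real ((Suc m) ^ (card (D \<times> D)) * (fact m)\<^sup>2)"
    using fr by (intro mult_left_mono of_nat_mono) auto
  finally have "(fact m)\<^sup>2 * (real (card D) ^ m)\<^sup>2 \<le> (fact m)\<^sup>2 * (real (card R) * real (Suc m) ^ ((card D)\<^sup>2))"
    by (simp add: power_mult_distrib power2_eq_square card_cartesian_product mult_ac)
  then have "(fact m)\<^sup>2 * real (card D) ^ (2 * m) \<le> (fact m)\<^sup>2 * (real (card R) * real (Suc m) ^ ((card D)\<^sup>2))"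
    by (simp only: power_mult[symmetric] mult.commute[of m 2])
  then have "real (card D) ^ (2 * m) \<le> real (card R) * real (Suc m) ^ ((card D)\<^sup>2)"
    by (rule mult_left_le_imp_le) simp
  moreover have "\<forall>s\<in>R. c s = 0"
    if c: "\<forall>u\<in>W. \<forall>v\<in>W. (\<Sum>s\<in>R. if \<forall>i<m. u i = v (s i) then c s else 0) = 0" for c :: "_ \<Rightarrow> 'f"
  proof (rule ind, safe)
    fix u v assume "u \<in> W" "v \<in> W"
    have "(\<Sum>s\<in>R. c s * of_rat (\<theta> s (u, v))) = (\<Sum>s\<in>R. if \<forall>i<m. u i = v (s i) then c s else 0)"
      by (intro sum.cong) (auto simp: \<theta>_def)
    then show "(\<Sum>s\<in>R. c s * of_rat (\<theta> s (u, v))) = 0" using c \<open>u \<in> W\<close> \<open>v \<in> W\<close> by simp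
  qed
  ultimately show ?thesis using R unfolding P_def by blast
qed

section \<open>Dimensions of quotient spaces\<close>

lemma (in vector_space) independent_family:
  assumes "finite I" and rel: "\<And>c. (\<Sum>i\<in>I. scale (c i) (v i)) = 0 \<Longrightarrow> \<forall>i\<in>I. c i = 0"
  shows "inj_on v I" "independent (v ` I)"
proof -
  show inj: "inj_on v I"
  proof (rule inj_onI, rule ccontr)
    fix i j assume ij: "i \<in> I" "j \<in> I" "v i = v j" "i \<noteq> j"
    let ?c = "(\<lambda>k. 0)(i := 1, j := -1)"
    have "(\<Sum>k\<in>I. scale (?c k) (v k)) = (\<Sum>k\<in>{i,j}. scale (?c k) (v k))"
      using ij \<open>finite I\<close> by (intro sum.mono_neutral_right) auto
    also have "\<dots> = 0" using ij by simp
    finally have "(\<Sum>k\<in>I. scale (?c k) (v k)) = 0" .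
    from bspec[OF rel[OF this] ij(1)] show False using ij(4) by simp
  qed
  show "independent (v ` I)"
  proof (rule independent_if_scalars_zero)
    show "finite (v ` I)" using \<open>finite I\<close> by simp
    fix c x assume c: "(\<Sum>x\<in>v ` I. scale (c x) x) = 0" and x: "x \<in> v ` I"
    have "(\<Sum>i\<in>I. scale (c (v i)) (v i)) = 0" using c inj by (simp add: sum.reindex)
    then have "\<forall>i\<in>I. c (v i) = 0" by (rule rel)
    then show "c x = 0" using x by blast
  qed
qed

text \<open>Coordinates with respect to a basis of a subspace are linear on this subspace only, so the lemmas on
linear maps of whole spaces do not apply to them.\<close>

lemma (in vector_space) additive_homogeneous_sum:
  assumes U: "subspace U" and add: "\<And>x y. x \<in> U \<Longrightarrow> y \<in> U \<Longrightarrow> f (x + y) = f x + f y"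
    and scl: "\<And>c x. x \<in> U \<Longrightarrow> f (scale c x) = s c (f x)" and v: "\<And>i. i \<in> I \<Longrightarrow> v i \<in> U"
  shows "f (\<Sum>i\<in>I. scale (c i) (v i)) = (\<Sum>i\<in>I. s (c i) (f (v i) :: 'w::ab_group_add))"
proof -
  have f0: "f 0 = 0" using add[of 0 0] subspace_0[OF U] by simp
  show ?thesis using v
  proof (induction I rule: infinite_finite_induct)
    case (insert i I)
    have "(\<Sum>i\<in>I. scale (c i) (v i)) \<in> U" "scale (c i) (v i) \<in> U"
      using insert.prems U by (auto intro!: subspace_sum subspace_scale)
    then show ?case using insert by (simp add: add scl)
  qed (simp_all add: f0)
qed

lemma quotient_basis_ex:
  assumes "vector_space s" and W: "module.subspace s W" and WV: "W \<subseteq> V"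
  shows "\<exists>B. quotient_basis s V W B"
proof -
  interpret vector_space s by fact
  obtain C where C: "C \<subseteq> W" "independent C" "W \<subseteq> span C"
    by (rule maximal_independent_subset)
  have CW: "span C = W" using C(1,3) W by (intro span_subspace)
  have "C \<subseteq> V" using C(1) WV by blast
  then obtain D where D: "C \<subseteq> D" "D \<subseteq> V" "independent D" "V \<subseteq> span D"
    by (rule maximal_independent_subset_extend[OF _ C(2)])
  have "quotient_basis s V W (D - C)"
    unfolding quotient_basis_def
  proof (intro conjI allI impI ballI)
    show "D - C \<subseteq> V" using D by blast
    have "D \<subseteq> (D - C) \<union> W" using C by blast
    then have "span D \<subseteq> span ((D - C) \<union> W)" by (rule span_mono)
    then show "V \<subseteq> span ((D - C) \<union> W)" using D(4) by (rule subset_trans[rotated])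
    fix T c v assume T: "finite T \<and> T \<subseteq> D - C \<and> (\<Sum>v\<in>T. s (c v) v) \<in> W" and v: "v \<in> T"
    show "c v = 0"
    proof (rule ccontr)
      assume cv: "c v \<noteq> 0"
      have TD: "T - {v} \<subseteq> D - {v}" "C \<subseteq> D - {v}" using T v D(1) by auto
      have "(\<Sum>v\<in>T. s (c v) v) = s (c v) v + (\<Sum>v\<in>T-{v}. s (c v) v)"
        using T v by (intro sum.remove) auto
      moreover have "(\<Sum>v\<in>T-{v}. s (c v) v) \<in> span (D - {v})"
        using TD(1) by (intro span_sum span_scale span_base) blast
      moreover have "(\<Sum>v\<in>T. s (c v) v) \<in> span (D - {v})"
        using T CW span_mono[OF TD(2)] by (metis subsetD)
      ultimately have "s (c v) v \<in> span (D - {v})" by (simp only: span_add_eq2)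
      then have "s (inverse (c v)) (s (c v) v) \<in> span (D - {v})" by (rule span_scale)
      then have "v \<in> span (D - {v})" using cv by simp
      moreover have "v \<in> D" using T v by auto
      ultimately show False using D(3) dependent_def by blast
    qed
  qed
  then show ?thesis by blast
qed

lemma quotient_dim_ge_card:
  assumes "vector_space s" and W: "module.subspace s W" and V: "module.subspace s V" and WV: "W \<subseteq> V"
    and fin: "finite F" "V \<subseteq> module.span s F" and "finite I"
    and v: "\<And>i. i \<in> I \<Longrightarrow> v i \<in> V"
    and ind: "\<And>c. (\<Sum>i\<in>I. s (c i) (v i)) \<in> W \<Longrightarrow> \<forall>i\<in>I. c i = 0"
  shows "card I \<le> quotient_dim s V W"
proof -
  interpret vector_space s by fact
  obtain C where C: "C \<subseteq> W" "independent C" "W \<subseteq> span C" "card C = dim W"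
    by (rule basis_exists)
  have CW: "span C = W" using C(1,3) W by (intro span_subspace)
  have inj: "inj_on v I"
    using ind W by (intro independent_family(1)[OF \<open>finite I\<close>]) (simp add: subspace_0)
  let ?V = "span (v ` I \<union> W)"
  have "quotient_basis s ?V W (v ` I)"
    unfolding quotient_basis_def
  proof (intro conjI allI impI)
    show "v ` I \<subseteq> ?V" by (auto intro: span_base)
    show "?V \<subseteq> ?V" ..
    fix T c assume T: "finite T \<and> T \<subseteq> v ` I \<and> (\<Sum>x\<in>T. s (c x) x) \<in> W"
    define d where "d i = (if v i \<in> T then c (v i) else 0)" for i
    have "(\<Sum>i\<in>I. s (d i) (v i)) = (\<Sum>x\<in>v ` I. s (if x \<in> T then c x else 0) x)"
      using inj by (simp add: sum.reindex d_def)
    also have "\<dots> = (\<Sum>x\<in>T. s (if x \<in> T then c x else 0) x)"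
      using T \<open>finite I\<close> by (intro sum.mono_neutral_right) auto
    also have "\<dots> = (\<Sum>x\<in>T. s (c x) x)" by (intro sum.cong) auto
    finally have d0: "\<forall>i\<in>I. d i = 0" using ind T by simp
    show "\<forall>x\<in>T. c x = 0"
    proof
      fix x assume "x \<in> T"
      then obtain i where "i \<in> I" "x = v i" using T by blast
      then show "c x = 0" using bspec[OF d0, of i] \<open>x \<in> T\<close> by (simp add: d_def)
    qed
  qed
  moreover have "W \<subseteq> ?V" by (auto intro: span_base)
  ultimately have ind': "independent (v ` I \<union> C)" and disj: "v ` I \<inter> C = {}"
    using quotient_basis_union[OF assms(1) W C(2) CW, of ?V "v ` I"] by simp_all
  have sub: "v ` I \<union> C \<subseteq> V" using v C(1) WV by blast
  obtain E where E: "E \<subseteq> V" "independent E" "V \<subseteq> span E" "card E = dim V"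
    by (rule basis_exists)
  have "finite E" using independent_span_bound[OF fin(1) E(2)] E(1) fin(2) by simp
  then have le: "finite (v ` I \<union> C) \<and> card (v ` I \<union> C) \<le> card E"
    by (rule independent_span_bound[OF _ ind' subset_trans[OF sub E(3)]])
  then have "card (v ` I \<union> C) = card I + card C"
    using disj inj by (simp add: card_Un_disjoint card_image)
  then have "card I + dim W \<le> dim V" using le C(4) E(4) by simp
  then show ?thesis using quotient_dim_eq[OF assms(1) W V WV fin] by simp
qed

text \<open>The functionals embed the quotient into a space with a basis indexed by \<open>K\<close>.\<close>

lemma quotient_dim_le_card:
  assumes "vector_space s" and W: "module.subspace s W" and V: "module.subspace s V" and WV: "W \<subseteq> V"
    and "finite K"
    and add: "\<And>k x y. k \<in> K \<Longrightarrow> x \<in> V \<Longrightarrow> y \<in> V \<Longrightarrow> L k (x + y) = L k x + L k y"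
    and scl: "\<And>k c x. k \<in> K \<Longrightarrow> x \<in> V \<Longrightarrow> L k (s c x) = c * L k x"
    and ker: "\<And>x. x \<in> V \<Longrightarrow> \<forall>k\<in>K. L k x = 0 \<Longrightarrow> x \<in> W"
  shows "quotient_dim s V W \<le> card K"
proof -
  interpret vector_space s by fact
  interpret P: vector_space "pm_scale :: 'a \<Rightarrow> ('d \<Rightarrow>\<^sub>0 'a) \<Rightarrow> _" by (rule vector_space_pm_scale)
  define Q where "Q = (SOME B. quotient_basis s V W B)"
  have "quotient_basis s V W Q"
    unfolding Q_def by (rule someI_ex) (rule quotient_basis_ex[OF assms(1) W WV])
  then have Q: "Q \<subseteq> V" "\<And>T c. finite T \<Longrightarrow> T \<subseteq> Q \<Longrightarrow> (\<Sum>v\<in>T. s (c v) v) \<in> W \<Longrightarrow> \<forall>v\<in>T. c v = 0"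
    unfolding quotient_basis_def by simp_all
  define \<Phi> where "\<Phi> x = (\<Sum>k\<in>K. Poly_Mapping.single k (L k x))" for x
  have lk: "Poly_Mapping.lookup (\<Phi> x) k = L k x" if "k \<in> K" for x k
    using that \<open>finite K\<close> by (simp add: \<Phi>_def lookup_sum lookup_single when_def)
  have Lsum: "L k (\<Sum>v\<in>T. s (c v) v) = (\<Sum>v\<in>T. c v * L k v)" if "T \<subseteq> V" "k \<in> K" for T c k
    using that by (intro additive_homogeneous_sum[OF V add scl]) auto
  have key: "\<forall>v\<in>T. c v = 0" if T: "finite T" "T \<subseteq> Q" "\<And>k. k \<in> K \<Longrightarrow> (\<Sum>v\<in>T. c v * L k v) = 0" for T c
  proof (rule Q(2)[OF T(1,2)], rule ker)
    show "(\<Sum>v\<in>T. s (c v) v) \<in> V" using T(2) Q(1) V by (auto intro!: subspace_sum subspace_scale)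
    have "T \<subseteq> V" using T(2) Q(1) by blast
    then show "\<forall>k\<in>K. L k (\<Sum>v\<in>T. s (c v) v) = 0" using T(3) Lsum by simp
  qed
  have "card T \<le> card K" if T: "T \<subseteq> Q" "finite T" for T
  proof -
    have rel: "\<forall>v\<in>T. c v = 0" if c: "(\<Sum>v\<in>T. pm_scale (c v) (\<Phi> v)) = 0" for c
    proof (rule key[OF T(2,1)])
      fix k assume "k \<in> K"
      then have "(\<Sum>v\<in>T. c v * L k v) = Poly_Mapping.lookup (\<Sum>v\<in>T. pm_scale (c v) (\<Phi> v)) k"
        by (simp add: lookup_sum lookup_pm_scale lk)
      then show "(\<Sum>v\<in>T. c v * L k v) = 0" by (simp add: c)
    qed
    have inj: "inj_on \<Phi> T" by (rule P.independent_family(1)[OF T(2)]) (rule rel)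
    have ind: "P.independent (\<Phi> ` T)" by (rule P.independent_family(2)[OF T(2)]) (rule rel)
    have "\<Phi> x \<in> P.span ((\<lambda>k. Poly_Mapping.single k 1) ` K)" for x
    proof -
      have "Poly_Mapping.single k (L k x) = pm_scale (L k x) (Poly_Mapping.single k 1)" for k
        by (rule poly_mapping_eqI) (simp add: lookup_pm_scale lookup_single when_def)
      then show ?thesis unfolding \<Phi>_def by simp (intro P.span_sum P.span_scale P.span_base imageI)
    qed
    then have "card (\<Phi> ` T) \<le> card ((\<lambda>k. Poly_Mapping.single k (1 :: 'a)) ` K)"
      using P.independent_span_bound[OF _ ind, of "(\<lambda>k. Poly_Mapping.single k 1) ` K"] \<open>finite K\<close> by blast
    also have "\<dots> \<le> card K" using \<open>finite K\<close> by (rule card_image_le)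
    finally show ?thesis using inj by (simp add: card_image)
  qed
  then have "card Q \<le> card K" using finite_if_finite_subsets_card_bdd[of Q "card K"] by blast
  then show ?thesis by (simp add: quotient_dim_def Q_def)
qed

section \<open>Evaluation of H-polynomials\<close>

lemma prod_nonempty_Cons: "xs \<noteq> [] \<Longrightarrow> prod_nonempty (x # xs) = x * prod_nonempty xs"
  by (cases xs) auto

lemma prod_nonempty_append:
  "xs \<noteq> [] \<Longrightarrow> ys \<noteq> [] \<Longrightarrow> prod_nonempty (xs @ ys) = prod_nonempty xs * prod_nonempty ys"
proof (induction xs)
  case (Cons x xs)
  then show ?case by (cases "xs = []") (simp_all add: prod_nonempty_Cons mult.assoc)
qed simp

lemma lin_ext_sum_superset:
  assumes "vector_space s" "finite K" "Poly_Mapping.keys t \<subseteq> K"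
  shows "lin_ext s g t = (\<Sum>k\<in>K. s (Poly_Mapping.lookup t k) (g k))"
proof -
  interpret vector_space s by fact
  show ?thesis unfolding lin_ext_def
    using assms(2,3) by (intro sum.mono_neutral_left) (auto simp: in_keys_iff)
qed

lemma lin_ext_add:
  assumes "vector_space s"
  shows "lin_ext s g (t + u) = lin_ext s g t + lin_ext s g u"
proof -
  interpret vector_space s by fact
  let ?K = "Poly_Mapping.keys t \<union> Poly_Mapping.keys u"
  have "lin_ext s g (t + u) = (\<Sum>k\<in>?K. s (Poly_Mapping.lookup (t + u) k) (g k))"
    using keys_add[of t u] by (intro lin_ext_sum_superset[OF assms]) auto
  also have "\<dots> = (\<Sum>k\<in>?K. s (Poly_Mapping.lookup t k) (g k)) + (\<Sum>k\<in>?K. s (Poly_Mapping.lookup u k) (g k))"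
    by (simp add: lookup_add scale_left_distrib sum.distrib)
  also have "\<dots> = lin_ext s g t + lin_ext s g u"
    by (simp add: lin_ext_sum_superset[OF assms, of ?K])
  finally show ?thesis .
qed

lemma lin_ext_pm_scale:
  assumes "vector_space s"
  shows "lin_ext s g (pm_scale c t) = s c (lin_ext s g t)"
proof -
  interpret vector_space s by fact
  have "lin_ext s g (pm_scale c t) = (\<Sum>k\<in>Poly_Mapping.keys t. s (Poly_Mapping.lookup (pm_scale c t) k) (g k))"
    by (intro lin_ext_sum_superset[OF assms]) (auto simp: in_keys_iff lookup_pm_scale)
  then show ?thesis by (simp add: lookup_pm_scale lin_ext_def scale_sum_right)
qed

lemma lin_ext_zero: "lin_ext s g 0 = 0"
  by (simp add: lin_ext_def)

lemma lin_ext_single: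
  assumes "vector_space s"
  shows "lin_ext s g (Poly_Mapping.single k c) = s c (g k)"
proof -
  interpret vector_space s by fact
  show ?thesis by (simp add: lin_ext_def)
qed

lemma lin_ext_sum:
  assumes "vector_space s"
  shows "lin_ext s g (\<Sum>i\<in>I. t i) = (\<Sum>i\<in>I. lin_ext s g (t i))"
  by (induction I rule: infinite_finite_induct) (simp_all add: lin_ext_add[OF assms] lin_ext_zero)

lemma poly_mapping_sum_singles:
  "p = (\<Sum>k\<in>Poly_Mapping.keys p. Poly_Mapping.single k (Poly_Mapping.lookup p k))"
  by (rule poly_mapping_eqI) (simp add: lookup_sum lookup_single when_def in_keys_iff)

lemma pm_scale_single: "pm_scale c (Poly_Mapping.single k d) = Poly_Mapping.single k (c * d)"
  by (rule poly_mapping_eqI) (simp add: lookup_pm_scale lookup_single when_def)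

lemma in_span_singles:
  fixes p :: "'k \<Rightarrow>\<^sub>0 'f::field"
  assumes "Poly_Mapping.keys p \<subseteq> K"
  shows "p \<in> module.span pm_scale ((\<lambda>k. Poly_Mapping.single k 1) ` K)"
proof -
  interpret P: vector_space "pm_scale :: 'f \<Rightarrow> ('k \<Rightarrow>\<^sub>0 'f) \<Rightarrow> _" by (rule vector_space_pm_scale)
  have "(\<Sum>k\<in>Poly_Mapping.keys p. pm_scale (Poly_Mapping.lookup p k) (Poly_Mapping.single k 1))
    \<in> P.span ((\<lambda>k. Poly_Mapping.single k 1) ` K)"
    using assms by (intro P.span_sum P.span_scale P.span_base imageI) blast
  then show ?thesis by (simp only: pm_scale_single mult_1_right poly_mapping_sum_singles[symmetric])
qed

lemma keys_prod_list_H_var: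
  assumes "\<And>h i. (h, i) \<in> set xs \<Longrightarrow> Poly_Mapping.keys (f h i) \<subseteq> {Word [(\<gamma>, i)] | \<gamma>. \<gamma> \<in> \<Gamma>}"
  shows "Poly_Mapping.keys (prod_list (map (\<lambda>(h, i). f h i) xs) :: ('h, 'f::field) H_poly)
    \<subseteq> {Word l | l. length l = length xs \<and> set l \<subseteq> \<Gamma> \<times> snd ` set xs}"
  using assms
proof (induction xs)
  case Nil
  then show ?case by (auto simp: zero_free_monoid_def)
next
  case (Cons x xs)
  obtain h i where x: "x = (h, i)" by fastforce
  show ?case
  proof
    fix w assume "w \<in> Poly_Mapping.keys (prod_list (map (\<lambda>(h, i). f h i) (x # xs)) :: ('h, 'f) H_poly)"
    then have "w \<in> Poly_Mapping.keys (f h i * prod_list (map (\<lambda>(h, i). f h i) xs))" by (simp add: x)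
    then obtain u v where uv: "w = u + v" "u \<in> Poly_Mapping.keys (f h i)"
      "v \<in> Poly_Mapping.keys (prod_list (map (\<lambda>(h, i). f h i) xs))"
      using keys_mult by blast
    have "Poly_Mapping.keys (f h i) \<subseteq> {Word [(\<gamma>, i)] | \<gamma>. \<gamma> \<in> \<Gamma>}" using Cons.prems x by simp
    then obtain \<gamma> where \<gamma>: "u = Word [(\<gamma>, i)]" "\<gamma> \<in> \<Gamma>" using uv(2) by blast
    have "Poly_Mapping.keys (prod_list (map (\<lambda>(h, i). f h i) xs))
        \<subseteq> {Word l | l. length l = length xs \<and> set l \<subseteq> \<Gamma> \<times> snd ` set xs}"
      by (rule Cons.IH) (use Cons.prems in auto)
    then obtain l where l: "v = Word l" "length l = length xs" "set l \<subseteq> \<Gamma> \<times> snd ` set xs" using uv(3) by blast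
    show "w \<in> {Word l | l. length l = length (x # xs) \<and> set l \<subseteq> \<Gamma> \<times> snd ` set (x # xs)}"
      using uv(1) \<gamma> l x by (auto simp: plus_free_monoid_def)
  qed
qed

context hopf_module_algebra
begin

lemmas vsA = A.vector_space_axioms

lemma H_eval_add: "H_eval scaleA act a (f + g) = H_eval scaleA act a f + H_eval scaleA act a g"
  unfolding H_eval_def by (rule lin_ext_add[OF vsA])

lemma H_eval_scale: "H_eval scaleA act a (pm_scale c f) = scaleA c (H_eval scaleA act a f)"
  unfolding H_eval_def by (rule lin_ext_pm_scale[OF vsA])

lemma H_eval_sum: "H_eval scaleA act a (\<Sum>i\<in>I. f i) = (\<Sum>i\<in>I. H_eval scaleA act a (f i))"
  unfolding H_eval_def by (rule lin_ext_sum[OF vsA])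

lemma H_eval_zero: "H_eval scaleA act a 0 = 0"
  by (simp add: H_eval_def lin_ext_zero)

lemma H_eval_single: "H_eval scaleA act a (Poly_Mapping.single w c) =
    scaleA c (prod_nonempty (map (\<lambda>(\<gamma>, i). act \<gamma> (a i)) (letters w)))"
  unfolding H_eval_def by (rule lin_ext_single[OF vsA])

lemma scaleA_mult: "scaleA c x * scaleA d y = scaleA (c * d) (x * y)"
  by (simp add: A.scale_mult_left[symmetric] A.scale_mult_right[symmetric] mult.commute)

text \<open>Multiplicativity fails for constant terms, which evaluate to 0 here.\<close>

lemma H_eval_mult:
  assumes "Word [] \<notin> Poly_Mapping.keys f" "Word [] \<notin> Poly_Mapping.keys g"
  shows "H_eval scaleA act a (f * g) = H_eval scaleA act a f * H_eval scaleA act a g"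
proof -
  let ?e = "H_eval scaleA act a"
  let ?p = "\<lambda>w. prod_nonempty (map (\<lambda>(\<gamma>, i). act \<gamma> (a i)) (letters w))"
  let ?F = "Poly_Mapping.keys f" let ?G = "Poly_Mapping.keys g"
  have "f * g = (\<Sum>u\<in>?F. Poly_Mapping.single u (Poly_Mapping.lookup f u)) *
      (\<Sum>v\<in>?G. Poly_Mapping.single v (Poly_Mapping.lookup g v))"
    by (simp only: poly_mapping_sum_singles[symmetric])
  also have "\<dots> = (\<Sum>u\<in>?F. \<Sum>v\<in>?G. Poly_Mapping.single (u + v) (Poly_Mapping.lookup f u * Poly_Mapping.lookup g v))"
    by (simp add: sum_product mult_single)
  finally have "?e (f * g) = (\<Sum>u\<in>?F. \<Sum>v\<in>?G. scaleA (Poly_Mapping.lookup f u * Poly_Mapping.lookup g v) (?p (u + v)))"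
    by (simp add: H_eval_sum H_eval_single)
  also have "\<dots> = (\<Sum>u\<in>?F. \<Sum>v\<in>?G. scaleA (Poly_Mapping.lookup f u) (?p u) * scaleA (Poly_Mapping.lookup g v) (?p v))"
  proof (intro sum.cong refl)
    fix u v assume "u \<in> ?F" "v \<in> ?G"
    then have "u \<noteq> Word []" "v \<noteq> Word []" using assms by auto
    then have "letters u \<noteq> []" "letters v \<noteq> []" by (cases u, simp, cases v, simp)
    then have "?p (u + v) = ?p u * ?p v" by (simp add: plus_free_monoid_def prod_nonempty_append)
    then show "scaleA (Poly_Mapping.lookup f u * Poly_Mapping.lookup g v) (?p (u + v)) =
        scaleA (Poly_Mapping.lookup f u) (?p u) * scaleA (Poly_Mapping.lookup g v) (?p v)"
      by (simp add: scaleA_mult)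
  qed
  also have "\<dots> = ?e f * ?e g"
    by (simp add: H_eval_def lin_ext_def sum_product)
  finally show ?thesis .
qed

lemma act_add: "act h (x + y) = act h x + act h y"
  using act_linear[of h] by (simp add: Vector_Spaces.linear_iff)

lemma act_scale: "act h (scaleA c x) = scaleA c (act h x)"
  using act_linear[of h] by (simp add: Vector_Spaces.linear_iff)

lemma act_zero: "act h 0 = 0"
  using act_scale[of h 0 0] by simp

lemma act_left_sum: "act (\<Sum>i\<in>I. scaleH (c i) (g i)) a = (\<Sum>i\<in>I. scaleA (c i) (act (g i) a))"
proof -
  have add: "act (x + y) a = act x a + act y a" and scl: "act (scaleH c x) a = scaleA c (act x a)" for x y c
    using act_linear_left[of a] by (simp_all add: Vector_Spaces.linear_iff)
  have "act 0 a = 0" using scl[of 0 0] by simp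
  then show ?thesis by (induction I rule: infinite_finite_induct) (simp_all add: add scl)
qed

end

section \<open>Multilinear functions given by H-polynomials\<close>

lemma pm_scale_times_left:
  fixes p q :: "'k::monoid_add \<Rightarrow>\<^sub>0 'f::field"
  shows "pm_scale c p * q = pm_scale c (p * q)"
proof -
  have s0: "pm_scale c r = Poly_Mapping.single 0 c * r" for r :: "'k \<Rightarrow>\<^sub>0 'f"
  proof -
    interpret P: vector_space "pm_scale :: 'f \<Rightarrow> ('k \<Rightarrow>\<^sub>0 'f) \<Rightarrow> _" by (rule vector_space_pm_scale)
    let ?S = "\<Sum>k\<in>Poly_Mapping.keys r. Poly_Mapping.single k (Poly_Mapping.lookup r k)"
    have "pm_scale c ?S = Poly_Mapping.single 0 c * ?S"
      by (simp add: P.scale_sum_right sum_distrib_left pm_scale_single mult_single)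
    then show ?thesis by (simp only: poly_mapping_sum_singles[symmetric])
  qed
  show ?thesis by (simp only: s0 mult.assoc)
qed

lemma pm_scale_times_right:
  fixes p q :: "'k::monoid_add \<Rightarrow>\<^sub>0 'f::field"
  shows "p * pm_scale c q = pm_scale c (p * q)"
proof -
  have s0: "pm_scale c r = r * Poly_Mapping.single 0 c" for r :: "'k \<Rightarrow>\<^sub>0 'f"
  proof -
    interpret P: vector_space "pm_scale :: 'f \<Rightarrow> ('k \<Rightarrow>\<^sub>0 'f) \<Rightarrow> _" by (rule vector_space_pm_scale)
    let ?S = "\<Sum>k\<in>Poly_Mapping.keys r. Poly_Mapping.single k (Poly_Mapping.lookup r k)"
    have "pm_scale c ?S = ?S * Poly_Mapping.single 0 c"
      by (simp add: P.scale_sum_right sum_distrib_right pm_scale_single mult_single mult.commute)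
    then show ?thesis by (simp only: poly_mapping_sum_singles[symmetric])
  qed
  show ?thesis by (simp only: s0 mult.assoc)
qed

lemma keys_pm_scale: "Poly_Mapping.keys (pm_scale c p) \<subseteq> Poly_Mapping.keys (p :: _ \<Rightarrow>\<^sub>0 'f::field)"
  by (auto simp: in_keys_iff lookup_pm_scale)

context hopf_module_algebra
begin

text \<open>The functions induced by multilinear H-polynomials whose set of variables is \<open>I\<close>. The variables
may be of any type, so that variables with different roles can be told apart; they are numbered
only when codimensions are computed. In contrast to the span of the monomials, this description
makes closure under the action of \<open>H\<close> and under substitution provable by induction.\<close>

inductive hfun :: "'i set \<Rightarrow> (('i \<Rightarrow> 'a) \<Rightarrow> 'a) \<Rightarrow> bool" where
  var: "hfun {i} (\<lambda>x. act h (x i))"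
| mult: "hfun I f \<Longrightarrow> hfun K g \<Longrightarrow> I \<inter> K = {} \<Longrightarrow> hfun (I \<union> K) (\<lambda>x. f x * g x)"
| add: "hfun I f \<Longrightarrow> hfun I g \<Longrightarrow> hfun I (\<lambda>x. f x + g x)"
| scale: "hfun I f \<Longrightarrow> hfun I (\<lambda>x. scaleA c (f x))"

lemma hfun_zero:
  assumes "hfun I f" shows "hfun I (\<lambda>_. 0)"
  using hfun.scale[OF assms, of 0] by simp

lemma hfun_sum:
  assumes "hfun I g" "\<And>k. k \<in> K \<Longrightarrow> hfun I (f k)"
  shows "hfun I (\<lambda>x. \<Sum>k\<in>K. f k x)"
  using assms(2)
proof (induction K rule: infinite_finite_induct)
  case (insert k K)
  have "hfun I (\<lambda>x. f k x + (\<Sum>k\<in>K. f k x))"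
    using insert by (intro hfun.add) auto
  then show ?case using insert by simp
qed (simp_all add: hfun_zero[OF assms(1)])

lemma hfun_act:
  assumes "hfun I f" shows "hfun I (\<lambda>x. act h (f x))"
  using assms
proof (induction arbitrary: h)
  case (var i g)
  show ?case using hfun.var[of i "h * g"] by (simp add: act_mult)
next
  case (mult I f K g)
  have "hfun (I \<union> K) (\<lambda>x. \<Sum>k\<in>Poly_Mapping.keys (\<Delta> h).
      scaleA (Poly_Mapping.lookup (\<Delta> h) k) (act (fst k) (f x) * act (snd k) (g x)))"
    using mult by (intro hfun_sum[OF hfun.mult[OF mult.hyps]] hfun.scale hfun.mult mult.IH) auto
  then show ?case by (simp add: act_prod lin_ext_def case_prod_unfold)
next
  case (add I f g)
  then show ?case by (simp add: act_add hfun.add)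
next
  case (scale I f c)
  then show ?case by (simp add: act_scale hfun.scale)
qed

lemma hfun_cong:
  assumes "hfun I f" "\<And>i. i \<in> I \<Longrightarrow> x i = y i"
  shows "f x = f y"
  using assms
proof induction
  case (mult I f K g)
  have "f x = f y" "g x = g y" using mult by auto
  then show ?case by simp
qed auto

lemma hfun_update_outside:
  assumes "hfun I f" "i \<notin> I" shows "f (x(i := u)) = f x"
  using assms(2) by (intro hfun_cong[OF assms(1)]) auto

lemma hfun_add_at:
  assumes "hfun I f" "i \<in> I"
  shows "f (x(i := u + v)) = f (x(i := u)) + f (x(i := v))"
  using assms
proof induction
  case (mult I f K g)
  show ?case
  proof (cases "i \<in> I")
    case True
    then have "i \<notin> K" using mult.hyps by blast
    note out = hfun_update_outside[OF mult.hyps(2) this]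
    show ?thesis by (simp only: out mult.IH(1)[OF True] distrib_right)
  next
    case False
    then have "i \<in> K" using mult.prems by blast
    note IH = mult.IH(2)[OF this] and out = hfun_update_outside[OF mult.hyps(1) False]
    show ?thesis by (simp only: out IH distrib_left)
  qed
next
  case (add I f g)
  then show ?case by (simp add: algebra_simps)
next
  case (scale I f c)
  then show ?case by (simp add: A.scale_right_distrib)
qed (simp add: act_add)

lemma hfun_scale_at:
  assumes "hfun I f" "i \<in> I"
  shows "f (x(i := scaleA c u)) = scaleA c (f (x(i := u)))"
  using assms
proof induction
  case (mult I f K g)
  show ?case
  proof (cases "i \<in> I")
    case True
    then have "i \<notin> K" using mult.hyps by blast
    note out = hfun_update_outside[OF mult.hyps(2) this]
    show ?thesis by (simp only: out mult.IH(1)[OF True] A.scale_mult_left)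
  next
    case False
    then have "i \<in> K" using mult.prems by blast
    note IH = mult.IH(2)[OF this] and out = hfun_update_outside[OF mult.hyps(1) False]
    show ?thesis by (simp only: out IH A.scale_mult_right)
  qed
next
  case (add I f g)
  then show ?case by (simp add: A.scale_right_distrib)
next
  case (scale I f d)
  then show ?case by (simp add: mult.commute)
qed (simp add: act_scale)

lemma hfun_sum_at:
  assumes "hfun I f" "i \<in> I"
  shows "f (x(i := \<Sum>k\<in>K. scaleA (c k) (u k))) = (\<Sum>k\<in>K. scaleA (c k) (f (x(i := u k))))"
proof -
  have z: "f (x(i := 0)) = 0" using hfun_scale_at[OF assms, of x 0 0] by (simp only: A.scale_zero_left)
  show ?thesis
  proof (induction K rule: infinite_finite_induct)
    case (insert k K)
    show ?case
      by (simp only: sum.insert[OF insert.hyps] hfun_add_at[OF assms] hfun_scale_at[OF assms] insert.IH)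
  next
    case (infinite K)
    show ?case by (simp only: sum.infinite[OF infinite] z)
  next
    case empty
    show ?case by (simp only: sum.empty z)
  qed
qed

text \<open>Substituting a multilinear function for a variable stays inside the class because the latter is
closed under the action of \<open>H\<close>, by which the variable is hit.\<close>

lemma hfun_subst:
  assumes "hfun I f" "i \<in> I" "hfun K g" "K \<inter> (I - {i}) = {}"
  shows "hfun (I - {i} \<union> K) (\<lambda>x. f (x(i := g x)))"
  using assms(1,2,4)
proof induction
  case (var j h)
  then show ?case using hfun_act[OF assms(3), of h] by simp
next
  case (mult I1 f1 I2 f2)
  show ?case
  proof (cases "i \<in> I1")
    case True
    then have i: "i \<notin> I2" using mult.hyps by blast
    have "hfun (I1 - {i} \<union> K) (\<lambda>x. f1 (x(i := g x)))" using mult True by blast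
    then have "hfun ((I1 - {i} \<union> K) \<union> I2) (\<lambda>x. f1 (x(i := g x)) * f2 x)"
      using mult.hyps mult.prems i by (intro hfun.mult) auto
    moreover have "(I1 - {i} \<union> K) \<union> I2 = I1 \<union> I2 - {i} \<union> K" using i by blast
    ultimately show ?thesis by (simp only: hfun_update_outside[OF mult.hyps(2) i])
  next
    case False
    then have i: "i \<in> I2" using mult.prems by blast
    have "hfun (I2 - {i} \<union> K) (\<lambda>x. f2 (x(i := g x)))" using mult i by blast
    then have "hfun (I1 \<union> (I2 - {i} \<union> K)) (\<lambda>x. f1 x * f2 (x(i := g x)))"
      using mult.hyps mult.prems False by (intro hfun.mult) auto
    moreover have "I1 \<union> (I2 - {i} \<union> K) = I1 \<union> I2 - {i} \<union> K" using False by blast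
    ultimately show ?thesis by (simp only: hfun_update_outside[OF mult.hyps(1) False])
  qed
next
  case (add I f1 f2)
  then show ?case by (simp add: hfun.add)
next
  case (scale I f c)
  then show ?case by (simp add: hfun.scale)
qed

lemma hfun_relabel:
  assumes "hfun I f" "inj_on \<pi> I"
  shows "hfun (\<pi> ` I) (\<lambda>x. f (\<lambda>i. x (\<pi> i)))"
  using assms
proof induction
  case (var i h)
  then show ?case by (simp add: hfun.var)
next
  case (mult I f K g)
  have "\<pi> ` I \<inter> \<pi> ` K = {}"
    using mult.prems mult.hyps inj_on_image_Int[of \<pi> "I \<union> K" I K] by simp
  moreover have "inj_on \<pi> I" "inj_on \<pi> K" using mult.prems by (auto intro: inj_on_subset)
  ultimately show ?case using mult.IH by (simp add: image_Un hfun.mult)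
next
  case (add I f g)
  then show ?case by (simp add: hfun.add)
next
  case (scale I f c)
  then show ?case by (simp add: hfun.scale)
qed

lemma hfun_monomial:
  assumes "xs \<noteq> []" "distinct (map snd xs)"
  shows "hfun (snd ` set xs) (\<lambda>x. prod_nonempty (map (\<lambda>(h, i). act h (x i)) xs))"
  using assms
proof (induction xs)
  case (Cons y ys)
  obtain h i where y: "y = (h, i)" by fastforce
  show ?case
  proof (cases "ys = []")
    case True
    then show ?thesis using hfun.var by (simp add: y)
  next
    case False
    have "hfun ({i} \<union> snd ` set ys) (\<lambda>x. act h (x i) * prod_nonempty (map (\<lambda>(h, i). act h (x i)) ys))"
      using Cons False by (intro hfun.mult hfun.var) (auto simp: y)
    then show ?thesis using False by (simp add: y prod_nonempty_Cons)
  qed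
qed simp

lemma hfun_finite: "hfun I f \<Longrightarrow> finite I \<and> I \<noteq> {}"
  by (induction rule: hfun.induct) auto

context
  fixes \<Gamma> :: "'h set"
  assumes \<Gamma>: "\<not> module.dependent scaleH \<Gamma>" "module.span scaleH \<Gamma> = UNIV"
begin

lemma keys_H_var: "Poly_Mapping.keys (H_var scaleH \<Gamma> h i) \<subseteq> {Word [(\<gamma>, i)] | \<gamma>. \<gamma> \<in> \<Gamma>}"
proof -
  let ?r = "H.representation \<Gamma> h"
  have "Poly_Mapping.keys (H_var scaleH \<Gamma> h i) \<subseteq>
      (\<Union>\<gamma>\<in>{\<gamma>. ?r \<gamma> \<noteq> 0}. Poly_Mapping.keys (Poly_Mapping.single (Word [(\<gamma>, i)]) (?r \<gamma>)))"
    unfolding H_var_def by (rule keys_sum)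
  also have "\<dots> \<subseteq> {Word [(\<gamma>, i)] | \<gamma>. \<gamma> \<in> \<Gamma>}"
    using H.representation_ne_zero by auto
  finally show ?thesis .
qed

lemma H_eval_H_var: "H_eval scaleA act a (H_var scaleH \<Gamma> h i) = act h (a i)"
proof -
  let ?r = "H.representation \<Gamma> h"
  have "H_eval scaleA act a (H_var scaleH \<Gamma> h i) = (\<Sum>\<gamma> | ?r \<gamma> \<noteq> 0. scaleA (?r \<gamma>) (act \<gamma> (a i)))"
    by (simp add: H_var_def H_eval_sum H_eval_single)
  also have "\<dots> = act (\<Sum>\<gamma> | ?r \<gamma> \<noteq> 0. scaleH (?r \<gamma>) \<gamma>) (a i)" by (simp add: act_left_sum)
  also have "(\<Sum>\<gamma> | ?r \<gamma> \<noteq> 0. scaleH (?r \<gamma>) \<gamma>) = h"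
    using \<Gamma> by (intro H.sum_nonzero_representation_eq) auto
  finally show ?thesis .
qed

abbreviation "Hmon xs \<equiv> prod_list (map (\<lambda>(h, i). H_var scaleH \<Gamma> h i) xs)"

lemma keys_Hmon:
  "Poly_Mapping.keys (Hmon xs) \<subseteq> {Word l | l. length l = length xs \<and> set l \<subseteq> \<Gamma> \<times> snd ` set xs}"
  by (rule keys_prod_list_H_var) (rule keys_H_var)

lemma H_eval_Hmon:
  "xs \<noteq> [] \<Longrightarrow> H_eval scaleA act a (Hmon xs) = prod_nonempty (map (\<lambda>(h, i). act h (a i)) xs)"
proof (induction xs)
  case (Cons y ys)
  obtain h i where y: "y = (h, i)" by fastforce
  show ?case
  proof (cases "ys = []")
    case True
    then show ?thesis by (simp add: y H_eval_H_var)
  next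
    case False
    have "Word [] \<notin> Poly_Mapping.keys (H_var scaleH \<Gamma> h i)" using keys_H_var by blast
    moreover have "Word [] \<notin> Poly_Mapping.keys (Hmon ys)" using keys_Hmon[of ys] False by auto
    ultimately show ?thesis using Cons.IH False by (simp add: y H_eval_mult H_eval_H_var prod_nonempty_Cons)
  qed
qed simp

text \<open>The multilinear H-polynomials in the variables \<open>I\<close>. For \<open>I = {1..n}\<close> this is \<open>P\<^sub>n\<^sup>H\<close>; general
\<open>I\<close> are needed for the factors of a product.\<close>

definition "mpoly I = module.span pm_scale {Hmon xs | xs. xs \<noteq> [] \<and> distinct (map snd xs) \<and> snd ` set xs = I}"

lemma mpoly_keys:
  assumes "p \<in> mpoly I" shows "Word [] \<notin> Poly_Mapping.keys p"
proof -
  interpret P: vector_space "pm_scale :: 'f \<Rightarrow> ('h, 'f) H_poly \<Rightarrow> _" by (rule vector_space_pm_scale)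
  show ?thesis using assms unfolding mpoly_def
  proof (induction rule: P.span_induct)
    case base
    show ?case
      using keys_add keys_pm_scale by (fastforce simp: P.subspace_def)
  next
    case (step p)
    then show ?case using keys_Hmon by fastforce
  qed
qed

lemma mpoly_mult:
  assumes "p \<in> mpoly I" "q \<in> mpoly K" "I \<inter> K = {}"
  shows "p * q \<in> mpoly (I \<union> K)"
proof -
  interpret P: vector_space "pm_scale :: 'f \<Rightarrow> ('h, 'f) H_poly \<Rightarrow> _" by (rule vector_space_pm_scale)
  have sub: "P.subspace (mpoly J)" for J by (simp add: mpoly_def)
  have gen: "Hmon xs * q \<in> mpoly (I \<union> K)"
    if xs: "xs \<noteq> []" "distinct (map snd xs)" "snd ` set xs = I" for xs
    using assms(2) unfolding mpoly_def[of K]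
  proof (induction rule: P.span_induct)
    case base
    show ?case unfolding P.subspace_def
      using sub[of "I \<union> K"] by (auto simp: distrib_left pm_scale_times_right P.subspace_0 P.subspace_add P.subspace_scale)
  next
    case (step q)
    then obtain ys where ys: "q = Hmon ys" "ys \<noteq> []" "distinct (map snd ys)" "snd ` set ys = K" by auto
    have "Hmon xs * q = Hmon (xs @ ys)" by (simp add: ys(1))
    moreover have "snd ` set (xs @ ys) = I \<union> K" "distinct (map snd (xs @ ys))"
      using xs ys assms(3) by (auto simp: image_Un)
    ultimately show ?case unfolding mpoly_def using xs(1)
      by (intro P.span_base CollectI exI[of _ "xs @ ys"]) simp
  qed
  show ?thesis
    using assms(1) unfolding mpoly_def[of I]
  proof (induction rule: P.span_induct)
    case base
    show ?case unfolding P.subspace_def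
      using sub[of "I \<union> K"] by (auto simp: distrib_right pm_scale_times_left P.subspace_0 P.subspace_add P.subspace_scale)
  next
    case (step p)
    then show ?case using gen by auto
  qed
qed

lemma hfun_realized:
  assumes "hfun I f" shows "\<exists>p\<in>mpoly I. \<forall>a. H_eval scaleA act a p = f a"
proof -
  interpret P: vector_space "pm_scale :: 'f \<Rightarrow> ('h, 'f) H_poly \<Rightarrow> _" by (rule vector_space_pm_scale)
  have sub: "P.subspace (mpoly J)" for J by (simp add: mpoly_def)
  show ?thesis using assms
  proof induction
    case (var i h)
    have "Hmon [(h, i)] \<in> mpoly {i}" unfolding mpoly_def
      by (intro P.span_base CollectI exI[of _ "[(h, i)]"]) simp
    then show ?case using H_eval_Hmon[of "[(h, i)]"] by (intro bexI[of _ "Hmon [(h, i)]"]) auto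
  next
    case (mult I f K g)
    then obtain p q where pq: "p \<in> mpoly I" "q \<in> mpoly K"
      "\<forall>a. H_eval scaleA act a p = f a" "\<forall>a. H_eval scaleA act a q = g a" by blast
    then show ?case using mpoly_mult[OF pq(1,2) mult.hyps(3)] mpoly_keys[OF pq(1)] mpoly_keys[OF pq(2)]
      by (intro bexI[of _ "p * q"]) (simp_all add: H_eval_mult)
  next
    case (add I f g)
    then obtain p q where pq: "p \<in> mpoly I" "q \<in> mpoly I"
      "\<forall>a. H_eval scaleA act a p = f a" "\<forall>a. H_eval scaleA act a q = g a" by blast
    then show ?case using sub[of I]
      by (intro bexI[of _ "p + q"]) (simp_all add: H_eval_add P.subspace_add)
  next
    case (scale I f c)
    then obtain p where p: "p \<in> mpoly I" "\<forall>a. H_eval scaleA act a p = f a" by blast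
    then show ?case using sub[of I]
      by (intro bexI[of _ "pm_scale c p"]) (simp_all add: H_eval_scale P.subspace_scale)
  qed
qed

abbreviation "PN n \<equiv> multilinear_H_polynomials scaleH \<Gamma> n"

lemma mpoly_subset_PN: "mpoly {1..n} \<subseteq> PN n"
proof -
  interpret P: vector_space "pm_scale :: 'f \<Rightarrow> ('h, 'f) H_poly \<Rightarrow> _" by (rule vector_space_pm_scale)
  have "Hmon xs \<in> {prod_list (map (\<lambda>k. H_var scaleH \<Gamma> (h k) (\<sigma> k)) [1..<Suc n]) | h \<sigma>. \<sigma> permutes {1..n}}"
    if xs: "xs \<noteq> []" "distinct (map snd xs)" "snd ` set xs = {1..n}" for xs
  proof -
    have len: "length xs = n" using distinct_card[OF xs(2)] xs(3) by simp
    define h where "h k = fst (xs ! (k - 1))" for k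
    define \<sigma> where "\<sigma> k = (if k \<in> {1..n} then snd (xs ! (k - 1)) else k)" for k
    have eq: "xs = map (\<lambda>k. (h k, \<sigma> k)) [1..<Suc n]"
      by (rule nth_equalityI) (auto simp: len h_def \<sigma>_def simp del: upt_Suc)
    have "\<sigma> permutes {1..n}"
    proof (rule bij_imp_permutes)
      have "\<sigma> ` {1..n} = set (map snd xs)" by (subst eq) (auto simp: simp del: upt_Suc)
      then have img: "\<sigma> ` {1..n} = {1..n}" using xs(3) by simp
      then show "bij_betw \<sigma> {1..n} {1..n}"
        unfolding bij_betw_def using finite_surj_inj[of "{1..n}" \<sigma>] by simp
      show "\<sigma> x = x" if "x \<notin> {1..n}" for x using that unfolding \<sigma>_def by (simp only: if_False)
    qed
    moreover have "Hmon xs = prod_list (map (\<lambda>k. H_var scaleH \<Gamma> (h k) (\<sigma> k)) [1..<Suc n])"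
      by (subst eq) (simp add: comp_def del: upt_Suc)
    ultimately show ?thesis by blast
  qed
  then show ?thesis unfolding mpoly_def multilinear_H_polynomials_def
    by (intro P.span_mono) blast
qed

lemma PN_induct [consumes 1, case_names subspace generator]:
  assumes "p \<in> PN n" "module.subspace pm_scale {p. P p}"
    "\<And>xs. length xs = n \<Longrightarrow> distinct (map snd xs) \<Longrightarrow> snd ` set xs = {1..n} \<Longrightarrow> P (Hmon xs)"
  shows "P p"
proof -
  interpret P: vector_space "pm_scale :: 'f \<Rightarrow> ('h, 'f) H_poly \<Rightarrow> _" by (rule vector_space_pm_scale)
  show ?thesis using assms(1) unfolding multilinear_H_polynomials_def
  proof (induction rule: P.span_induct)
    case base
    show ?case by (rule assms(2))
  next
    case (step p)
    then obtain h \<sigma> where p: "p = prod_list (map (\<lambda>k. H_var scaleH \<Gamma> (h k) (\<sigma> k)) [1..<Suc n])"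
      and \<sigma>: "\<sigma> permutes {1..n}" by auto
    let ?xs = "map (\<lambda>k. (h k, \<sigma> k)) [1..<Suc n]"
    have "P (Hmon ?xs)"
    proof (rule assms(3))
      show "length ?xs = n" by simp
      show "distinct (map snd ?xs)"
        using permutes_inj_on[OF \<sigma>] by (simp add: distinct_map comp_def del: upt_Suc)
      have "snd ` set ?xs = \<sigma> ` {1..n}" by (auto simp: image_image simp del: upt_Suc)
      then show "snd ` set ?xs = {1..n}" using permutes_image[OF \<sigma>] by simp
    qed
    then show ?case by (simp add: p comp_def del: upt_Suc)
  qed
qed

lemma PN_subspace: "module.subspace pm_scale (PN n)"
proof -
  interpret P: vector_space "pm_scale :: 'f \<Rightarrow> ('h, 'f) H_poly \<Rightarrow> _" by (rule vector_space_pm_scale)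
  show ?thesis unfolding multilinear_H_polynomials_def by (rule P.subspace_span)
qed

lemma PN_keys:
  assumes "p \<in> PN n"
  shows "Poly_Mapping.keys p \<subseteq> {Word l | l. length l = n \<and> set l \<subseteq> \<Gamma> \<times> {1..n}}"
  using assms
proof (induction rule: PN_induct)
  case subspace
  interpret P: vector_space "pm_scale :: 'f \<Rightarrow> ('h, 'f) H_poly \<Rightarrow> _" by (rule vector_space_pm_scale)
  let ?K = "{Word l | l. length l = n \<and> set l \<subseteq> \<Gamma> \<times> {1..n}}"
  have "Poly_Mapping.keys (p + q) \<subseteq> ?K" if "Poly_Mapping.keys p \<subseteq> ?K" "Poly_Mapping.keys q \<subseteq> ?K"
    for p q :: "('h, 'f) H_poly"
    using keys_add[of p q] that by (meson Un_least subset_trans)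
  moreover have "Poly_Mapping.keys (pm_scale c p) \<subseteq> ?K" if "Poly_Mapping.keys p \<subseteq> ?K"
    for c and p :: "('h, 'f) H_poly"
    using keys_pm_scale that by (rule subset_trans)
  ultimately show ?case unfolding P.subspace_def by (simp only: mem_Collect_eq) simp
next
  case (generator xs)
  then show ?case using keys_Hmon[of xs] by simp
qed

lemma PN_finite_span:
  assumes "finite \<Gamma>"
  shows "\<exists>F. finite F \<and> PN n \<subseteq> module.span pm_scale F"
proof -
  let ?K = "{Word l | l. length l = n \<and> set l \<subseteq> \<Gamma> \<times> {1..n}}"
  have "?K = Word ` {l. set l \<subseteq> \<Gamma> \<times> {1..n} \<and> length l = n}" by auto
  then have "finite ?K" using finite_lists_length_eq[of "\<Gamma> \<times> {1..n}" n] assms by simp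
  moreover have "PN n \<subseteq> module.span pm_scale ((\<lambda>k. Poly_Mapping.single k 1) ` ?K)"
    using in_span_singles[OF PN_keys] by blast
  ultimately show ?thesis by (intro exI[of _ "(\<lambda>k. Poly_Mapping.single k 1) ` ?K"]) simp
qed

lemma PN_Int_identities:
  assumes "n \<ge> 1"
  shows "PN n \<inter> H_identities scaleA act \<Gamma> = {p \<in> PN n. \<forall>a. H_eval scaleA act a p = 0}"
proof -
  have "p \<in> H_polynomials \<Gamma>" if p: "p \<in> PN n" for p
    unfolding H_polynomials_def
  proof (intro CollectI ballI)
    fix w assume "w \<in> Poly_Mapping.keys p"
    then obtain l where "w = Word l" "length l = n" "set l \<subseteq> \<Gamma> \<times> {1..n}" using PN_keys[OF p] by blast
    then show "w \<noteq> Word [] \<and> set (letters w) \<subseteq> \<Gamma> \<times> {1..}" using assms by auto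
  qed
  then show ?thesis by (auto simp: H_identities_def)
qed

lemma PN_identities_subspace: "module.subspace pm_scale {p \<in> PN n. \<forall>a. H_eval scaleA act a p = 0}"
proof -
  interpret P: vector_space "pm_scale :: 'f \<Rightarrow> ('h, 'f) H_poly \<Rightarrow> _" by (rule vector_space_pm_scale)
  show ?thesis using PN_subspace[of n] unfolding P.subspace_def
    by (simp add: H_eval_zero H_eval_add H_eval_scale)
qed

lemma PN_hfun:
  assumes "p \<in> PN n" "n \<ge> 1" shows "hfun {1..n} (\<lambda>a. H_eval scaleA act a p)"
  using assms(1)
proof (induction rule: PN_induct)
  case subspace
  interpret P: vector_space "pm_scale :: 'f \<Rightarrow> ('h, 'f) H_poly \<Rightarrow> _" by (rule vector_space_pm_scale)
  define xs :: "('h \<times> nat) list" where "xs = map (\<lambda>i. (1, i)) [1..<Suc n]"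
  have "xs \<noteq> []" "distinct (map snd xs)"
    using assms(2) by (simp_all add: xs_def comp_def del: upt_Suc)
  note mon = hfun_monomial[OF this]
  have "snd ` set xs = {1..n}" by (auto simp: xs_def image_image simp del: upt_Suc)
  then have "hfun {1..n} (\<lambda>_. 0)" using hfun_zero[OF mon] by (simp only:)
  then show ?case unfolding P.subspace_def
    by (simp add: H_eval_zero H_eval_add H_eval_scale hfun.add hfun.scale)
next
  case (generator xs)
  have "xs \<noteq> []" using generator assms(2) by auto
  then show ?case using hfun_monomial[of xs] generator by (simp add: H_eval_Hmon)
qed

text \<open>Codimensions enter the bounds only through this lemma and the next one: they are compared
with numbers of linearly independent functions from below, and with numbers of points that detect
the zero function from above.\<close>

lemma H_codimension_ge_card:
  assumes "finite \<Gamma>" "n \<ge> 1" "finite T" and f: "\<And>s. s \<in> T \<Longrightarrow> hfun {1..n} (f s)"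
    and ind: "\<And>c. \<forall>a. (\<Sum>s\<in>T. scaleA (c s) (f s a)) = 0 \<Longrightarrow> \<forall>s\<in>T. c s = 0"
  shows "card T \<le> H_codimension scaleH scaleA act \<Gamma> n"
proof -
  obtain F where F: "finite F" "PN n \<subseteq> module.span pm_scale F" using PN_finite_span[OF assms(1)] by blast
  have "\<exists>p. p \<in> PN n \<and> (\<forall>a. H_eval scaleA act a p = f s a)" if "s \<in> T" for s
    using hfun_realized[OF f[OF that]] mpoly_subset_PN by blast
  then obtain p where p: "\<And>s. s \<in> T \<Longrightarrow> p s \<in> PN n" "\<And>s a. s \<in> T \<Longrightarrow> H_eval scaleA act a (p s) = f s a"
    by metis
  show ?thesis
    unfolding H_codimension_def PN_Int_identities[OF assms(2)]
  proof (rule quotient_dim_ge_card[OF vector_space_pm_scale PN_identities_subspace PN_subspace _ F \<open>finite T\<close> p(1)])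
    fix c assume "(\<Sum>s\<in>T. pm_scale (c s) (p s)) \<in> {p \<in> PN n. \<forall>a. H_eval scaleA act a p = 0}"
    then have "\<forall>a. (\<Sum>s\<in>T. scaleA (c s) (f s a)) = 0" by (simp add: H_eval_sum H_eval_scale p(2))
    then show "\<forall>s\<in>T. c s = 0" by (rule ind)
  qed auto
qed

lemma H_codimension_le_card:
  assumes "finite \<Gamma>" "n \<ge> 1" "finite X" "finite \<B>" "A.independent \<B>" "A.span \<B> = UNIV"
    and X: "\<And>f. hfun {1..n} f \<Longrightarrow> \<forall>x\<in>X. f x = 0 \<Longrightarrow> \<forall>x. f x = 0"
  shows "H_codimension scaleH scaleA act \<Gamma> n \<le> card X * card \<B>"
proof -
  define L where "L k p = A.representation \<B> (H_eval scaleA act (fst k) p) (snd k)" for k p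
  have "H_codimension scaleH scaleA act \<Gamma> n \<le> card (X \<times> \<B>)"
    unfolding H_codimension_def PN_Int_identities[OF assms(2)]
  proof (rule quotient_dim_le_card[OF vector_space_pm_scale PN_identities_subspace PN_subspace, where L = L])
    show "L k (p + q) = L k p + L k q" for k p q
      by (simp add: L_def H_eval_add A.representation_add assms(5,6))
    show "L k (pm_scale c p) = c * L k p" for k p c
      by (simp add: L_def H_eval_scale A.representation_scale assms(5,6))
    fix p assume p: "p \<in> PN n" and L0: "\<forall>k\<in>X \<times> \<B>. L k p = 0"
    have "H_eval scaleA act x p = 0" if "x \<in> X" for x
    proof -
      have "(\<Sum>b\<in>\<B>. scaleA (A.representation \<B> (H_eval scaleA act x p) b) b) = H_eval scaleA act x p"
        using assms by (intro A.sum_representation_eq) auto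
      moreover have "A.representation \<B> (H_eval scaleA act x p) b = 0" if "b \<in> \<B>" for b
        using L0 \<open>x \<in> X\<close> that by (auto simp: L_def)
      ultimately show ?thesis by simp
    qed
    then have "\<forall>x. H_eval scaleA act x p = 0" by (intro X[OF PN_hfun[OF p assms(2)]]) blast
    then show "p \<in> {p \<in> PN n. \<forall>a. H_eval scaleA act a p = 0}" using p by simp
  qed (use assms in auto)
  then show ?thesis by (simp add: card_cartesian_product)
qed

end

end

section \<open>The radical and the trace form\<close>

locale fd_algebra = assoc_algebra scale + finite_dimensional_vector_space scale Basis
  for scale :: "'f::field \<Rightarrow> 'a::ring \<Rightarrow> 'a" and Basis :: "'a set"
begin

lemma span_mult_left: "span ((\<lambda>z. a * z) ` U) = (\<lambda>z. a * z) ` span U"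
proof -
  have "Vector_Spaces.linear scale scale (\<lambda>z. a * z)"
    by unfold_locales (simp_all add: distrib_left scale_mult_right)
  then interpret l: Vector_Spaces.linear scale scale "\<lambda>z. a * z" .
  show ?thesis by (rule l.span_image)
qed

text \<open>The power with exponent \<open>n + 1\<close>; the algebra need not have a unit.\<close>

definition pw :: "'a \<Rightarrow> nat \<Rightarrow> 'a" where "pw x n = ((\<lambda>z. x * z) ^^ n) x"

lemma pw_0: "pw x 0 = x" and pw_Suc: "pw x (Suc n) = x * pw x n"
  by (simp_all add: pw_def)

lemma pw_mult: "pw x m * pw x n = pw x (Suc (m + n))"
  by (induction m) (simp_all add: pw_0 pw_Suc mult.assoc)

text \<open>The spans \<open>C k\<close> of the powers of \<open>x\<close> with exponents above \<open>k\<close> decrease, so they are constant from some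
\<open>k\<close> on. Then multiplication by \<open>x\<^sup>k\<^sup>+\<^sup>1\<close> maps \<open>C k\<close> onto itself; an element \<open>c \<in> C k\<close> with
\<open>x\<^sup>k\<^sup>+\<^sup>1 c = x\<^sup>k\<^sup>+\<^sup>1\<close> acts as a right unit on \<open>C k\<close>, in particular on itself.\<close>

lemma idempotent_if_not_nilpotent:
  assumes nn: "\<And>n. pw x n \<noteq> 0"
  shows "\<exists>c\<in>span (range (pw x)). c * c = c \<and> c \<noteq> 0"
proof -
  define C where "C k = span (pw x ` {k..})" for k
  have sub: "subspace (C k)" for k by (simp add: C_def)
  have anti: "C j \<subseteq> C k" if "k \<le> j" for j k
    unfolding C_def using that by (intro span_mono image_mono) auto
  obtain k where k: "\<And>j. dim (C k) \<le> dim (C j)"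
    using ex_has_least_nat[of "\<lambda>_. True" 0 "\<lambda>k. dim (C k)"] by auto
  have "C (Suc (k + k)) = C k"
    by (rule subspace_dim_equal[OF sub sub anti k]) simp
  moreover have "pw x ` {Suc (k + k)..} = (\<lambda>z. pw x k * z) ` (pw x ` {k..})"
  proof -
    have "{Suc (k + k)..} = (\<lambda>j. Suc (k + j)) ` {k..}"
    proof
      show "{Suc (k + k)..} \<subseteq> (\<lambda>j. Suc (k + j)) ` {k..}"
      proof
        fix j assume "j \<in> {Suc (k + k)..}"
        then have "j = Suc (k + (j - Suc k))" "j - Suc k \<in> {k..}" by auto
        then show "j \<in> (\<lambda>j. Suc (k + j)) ` {k..}" by (rule image_eqI)
      qed
    qed auto
    then show ?thesis by (simp add: image_image pw_mult)
  qed
  ultimately have "C k = (\<lambda>z. pw x k * z) ` C k"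
    by (simp add: C_def span_mult_left)
  moreover have "pw x k \<in> C k" unfolding C_def by (intro span_base imageI) simp
  ultimately obtain c where c: "c \<in> C k" "pw x k = pw x k * c" by auto
  have fix_base: "pw x j * c = pw x j" if "j \<ge> k" for j
  proof (cases "j = k")
    case False
    then have j: "j = Suc ((j - Suc k) + k)" using that by simp
    then have "pw x j = pw x (j - Suc k) * pw x k" by (simp only: pw_mult)
    then show ?thesis by (simp add: mult.assoc c(2)[symmetric])
  qed (simp add: c(2)[symmetric])
  have "z * c = z" if "z \<in> C k" for z
    using that unfolding C_def
  proof (induction rule: span_induct)
    case base
    show ?case by (simp add: subspace_def distrib_right scale_mult_left[symmetric])
  next
    case (step z)
    then show ?case using fix_base by auto
  qed
  then have "c * c = c" using c(1) by blast
  moreover have "c \<noteq> 0" using c(2) nn[of k] by auto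
  moreover have "c \<in> span (range (pw x))" using c(1) span_mono[of "pw x ` {k..}" "range (pw x)"]
    unfolding C_def by blast
  ultimately show ?thesis by blast
qed

lemma maximal_modular_left_ideal_ex:
  assumes L: "left_ideal scale B L" "L \<noteq> B" and e: "e \<in> B" "\<And>x. x \<in> B \<Longrightarrow> x - x * e \<in> L"
  shows "\<exists>I. maximal_modular_left_ideal scale B I \<and> L \<subseteq> I"
proof -
  define P where "P K \<longleftrightarrow> left_ideal scale B K \<and> L \<subseteq> K \<and> K \<noteq> B" for K
  have "P L" using L by (simp add: P_def)
  moreover have "\<forall>K. P K \<longrightarrow> dim K < Suc dimension" using dim_subset_UNIV by (simp add: less_Suc_eq_le)
  ultimately obtain I where I: "P I" and max: "\<forall>K. P K \<longrightarrow> dim K \<le> dim I"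
    using ex_has_greatest_nat[of P L dim "Suc dimension"] by auto
  have "maximal_modular_left_ideal scale B I"
    unfolding maximal_modular_left_ideal_def
  proof (intro conjI allI impI)
    show "left_ideal scale B I" "I \<noteq> B" using I by (simp_all add: P_def)
    show "\<exists>e\<in>B. \<forall>x\<in>B. x - x * e \<in> I"
      using e(2) I by (intro bexI[OF _ e(1)] ballI) (auto simp: P_def)
    fix K assume K: "left_ideal scale B K \<and> I \<subseteq> K"
    show "K = I \<or> K = B"
    proof (rule disjCI)
      assume "K \<noteq> B"
      then have "P K" using K I by (auto simp: P_def)
      then have "dim K \<le> dim I" using max by blast
      then have "I = K" using I K by (intro subspace_dim_equal) (auto simp: P_def left_ideal_def)
      then show "K = I" ..
    qed
  qed
  then show ?thesis using I by (auto simp: P_def)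
qed

lemma jacobson_radical_left_ideal: "left_ideal scale UNIV (jacobson_radical scale UNIV)"
proof -
  have "subspace (\<Inter>{I. maximal_modular_left_ideal scale UNIV I})"
    by (intro subspace_Inter) (auto simp: maximal_modular_left_ideal_def left_ideal_def)
  moreover have "b * x \<in> I" if "maximal_modular_left_ideal scale UNIV I" "x \<in> I" for b x I
    using that by (auto simp: maximal_modular_left_ideal_def left_ideal_def)
  ultimately show ?thesis unfolding left_ideal_def jacobson_radical_def by auto
qed

text \<open>Otherwise the modular left ideal of all \<open>y - y x\<close> would be proper, hence contained in a maximal
one; that one contains \<open>x\<close>, and then everything.\<close>

lemma jacobson_radical_quasi_regular:
  assumes x: "x \<in> jacobson_radical scale UNIV"
  shows "\<exists>y. x = y - y * x"
proof -
  define L where "L = range (\<lambda>y. y - y * x)"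
  have "Vector_Spaces.linear scale scale (\<lambda>y. y - y * x)"
    by unfold_locales (simp_all add: algebra_simps scale_mult_left scale_right_diff_distrib)
  then interpret l: Vector_Spaces.linear scale scale "\<lambda>y. y - y * x" .
  have "subspace L" unfolding L_def by (rule l.subspace_image) simp
  moreover have "b * z \<in> L" if z: "z \<in> L" for b z
  proof -
    obtain y where "z = y - y * x" using z unfolding L_def by blast
    then have "b * z = b * y - (b * y) * x" by (simp add: right_diff_distrib mult.assoc)
    then show ?thesis unfolding L_def by blast
  qed
  ultimately have L: "left_ideal scale UNIV L" by (simp add: left_ideal_def)
  have modular: "y - y * x \<in> L" for y by (simp add: L_def)
  have "L = UNIV"
  proof (rule ccontr)
    assume "L \<noteq> UNIV"
    then obtain I where I: "maximal_modular_left_ideal scale UNIV I" "L \<subseteq> I"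
      using maximal_modular_left_ideal_ex[OF L, of x] modular by blast
    have "x \<in> I" using x I(1) by (auto simp: jacobson_radical_def)
    have li: "subspace I" "\<And>b z. z \<in> I \<Longrightarrow> b * z \<in> I" "I \<noteq> UNIV"
      using I(1) by (auto simp: maximal_modular_left_ideal_def left_ideal_def)
    have "y \<in> I" for y
    proof -
      have "(y - y * x) + y * x \<in> I"
        using modular[of y] I(2) li(2)[OF \<open>x \<in> I\<close>] by (intro subspace_add[OF li(1)]) auto
      then show ?thesis by simp
    qed
    then show False using li(3) by blast
  qed
  then have "x \<in> L" by simp
  then show ?thesis unfolding L_def by (rule rangeE) (rule exI)
qed

text \<open>If a maximal modular left ideal \<open>I\<close> does not contain \<open>K\<close>, its modular unit can be taken in \<open>K\<close>. A
nilpotent modular unit \<open>k\<close> is impossible: from \<open>x \<equiv> x k\<close> modulo \<open>I\<close> one gets \<open>x \<equiv> x k\<^sup>n = 0\<close>.\<close>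

lemma nil_left_ideal_subset_radical:
  assumes B: "subalgebra scale B" and K: "left_ideal scale B K" and nil: "\<And>x. x \<in> K \<Longrightarrow> \<exists>n. pw x n = 0"
  shows "K \<subseteq> jacobson_radical scale B"
proof -
  have Ks: "subspace K" "K \<subseteq> B" "\<And>b x. b \<in> B \<Longrightarrow> x \<in> K \<Longrightarrow> b * x \<in> K"
    using K by (auto simp: left_ideal_def)
  have Bs: "subspace B" "\<And>x y. x \<in> B \<Longrightarrow> y \<in> B \<Longrightarrow> x * y \<in> B" using B by (auto simp: subalgebra_def)
  have "K \<subseteq> I" if I: "maximal_modular_left_ideal scale B I" for I
  proof (rule ccontr)
    assume notsub: "\<not> K \<subseteq> I"
    have Is: "subspace I" "I \<subseteq> B" "\<And>b x. b \<in> B \<Longrightarrow> x \<in> I \<Longrightarrow> b * x \<in> I" "I \<noteq> B"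
      and Imax: "\<And>M. left_ideal scale B M \<Longrightarrow> I \<subseteq> M \<Longrightarrow> M = I \<or> M = B"
      using I unfolding maximal_modular_left_ideal_def left_ideal_def by auto
    obtain e where e: "e \<in> B" "\<And>x. x \<in> B \<Longrightarrow> x - x * e \<in> I"
      using I unfolding maximal_modular_left_ideal_def by blast
    let ?M = "{k + i | k i. k \<in> K \<and> i \<in> I}"
    have "left_ideal scale B ?M"
      unfolding left_ideal_def
    proof (intro conjI ballI)
      show "subspace ?M" by (rule subspace_sums[OF Ks(1) Is(1)])
      show "?M \<subseteq> B" using Ks(2) Is(2) Bs(1) by (auto intro: subspace_add)
      fix b m assume "b \<in> B" "m \<in> ?M"
      then obtain k i where "m = k + i" "k \<in> K" "i \<in> I" by blast
      then have "b * m = b * k + b * i" "b * k \<in> K" "b * i \<in> I"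
        using Ks(3) Is(3) \<open>b \<in> B\<close> by (simp_all add: distrib_left)
      then show "b * m \<in> ?M" by blast
    qed
    moreover have "I \<subseteq> ?M"
    proof
      fix i assume "i \<in> I"
      then have "0 + i \<in> ?M" using subspace_0[OF Ks(1)] by blast
      then show "i \<in> ?M" by simp
    qed
    moreover have "?M \<noteq> I"
    proof -
      obtain k where k: "k \<in> K" "k \<notin> I" using notsub by blast
      then have "k + 0 \<in> ?M" using subspace_0[OF Is(1)] by blast
      then show ?thesis using k by auto
    qed
    ultimately have "?M = B" using Imax by blast
    then obtain k i where ki: "e = k + i" "k \<in> K" "i \<in> I" using e(1) by blast
    have kB: "k \<in> B" using ki Ks(2) by blast
    have mk: "x - x * k \<in> I" if "x \<in> B" for x
    proof -
      have "x - x * k = (x - x * e) + x * i" by (simp add: ki(1) algebra_simps)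
      then show ?thesis using subspace_add[OF Is(1) e(2)[OF that] Is(3)[OF that ki(3)]] by (simp only:)
    qed
    obtain n where n: "pw k n = 0" using nil ki(2) by blast
    have "B \<subseteq> I"
    proof
      fix x assume x: "x \<in> B"
      have pB: "pw k j \<in> B" for j by (induction j) (simp_all add: pw_0 pw_Suc kB Bs(2))
      have "x - x * pw k j \<in> I" for j
      proof (induction j)
        case 0
        then show ?case using mk[OF x] by (simp add: pw_0)
      next
        case (Suc j)
        have "pw k (Suc j) = pw k j * k" using pw_mult[of k j 0] by (simp add: pw_0)
        then have "x - x * pw k (Suc j) = (x - x * pw k j) + (x * pw k j - (x * pw k j) * k)"
          by (simp add: mult.assoc)
        moreover have "x * pw k j - (x * pw k j) * k \<in> I" using x pB Bs(2) by (intro mk) blast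
        ultimately show ?case using subspace_add[OF Is(1) Suc] by (simp only:)
      qed
      from this[of n] show "x \<in> I" by (simp add: n)
    qed
    then show False using Is(2,4) by blast
  qed
  then show ?thesis using Ks(2) by (auto simp: jacobson_radical_def)
qed

text \<open>Nakayama's lemma, one generator at a time: from \<open>n = j n + s\<close> and the quasi-inverse \<open>y\<close> of \<open>j\<close> one
gets \<open>j n = y s\<close>, so \<open>n\<close> is a combination of the other generators.\<close>

lemma nakayama:
  assumes J: "left_ideal scale UNIV J" and qr: "\<And>x. x \<in> J \<Longrightarrow> \<exists>y. x = y - y * x"
    and "finite G" "G \<subseteq> span {j * g | j g. j \<in> J \<and> g \<in> G}"
  shows "G \<subseteq> {0}"
  using assms(3,4)
proof (induction G rule: finite_induct)
  case (insert n G)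
  let ?M = "\<lambda>G. span {j * g | j g. j \<in> J \<and> g \<in> G}"
  have Js: "subspace J" "\<And>b x. x \<in> J \<Longrightarrow> b * x \<in> J" using J by (auto simp: left_ideal_def)
  have Mmult: "b * z \<in> ?M G" if "z \<in> ?M G" for b z
    using that
  proof (induction rule: span_induct)
    case base
    show ?case
      by (simp add: subspace_def distrib_left span_zero span_add span_scale scale_mult_right[symmetric])
  next
    case (step z)
    then obtain j g where "z = j * g" "j \<in> J" "g \<in> G" by blast
    then have "b * z = (b * j) * g" "b * j \<in> J" using Js(2) by (simp_all add: mult.assoc)
    then show ?case using \<open>g \<in> G\<close> by (intro span_base) blast
  qed
  have dec: "\<exists>j\<in>J. z - j * n \<in> ?M G" if "z \<in> ?M (insert n G)" for z
    using that
  proof (induction rule: span_induct)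
    case base
    show ?case unfolding subspace_def
    proof (intro conjI ballI allI CollectI)
      show "\<exists>j\<in>J. 0 - j * n \<in> ?M G" using subspace_0[OF Js(1)] by (intro bexI[of _ 0]) (simp_all add: span_zero)
    next
      fix x y assume "x \<in> {z. \<exists>j\<in>J. z - j * n \<in> ?M G}" "y \<in> {z. \<exists>j\<in>J. z - j * n \<in> ?M G}"
      then obtain i j where ij: "i \<in> J" "j \<in> J" "x - i * n \<in> ?M G" "y - j * n \<in> ?M G" by blast
      have "(x - i * n) + (y - j * n) \<in> ?M G" using ij(3,4) by (rule span_add)
      then have "x + y - (i + j) * n \<in> ?M G" by (simp add: algebra_simps)
      moreover have "i + j \<in> J" using ij Js(1) by (simp add: subspace_add)
      ultimately show "\<exists>j\<in>J. x + y - j * n \<in> ?M G" by blast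
    next
      fix c x assume "x \<in> {z. \<exists>j\<in>J. z - j * n \<in> ?M G}"
      then obtain j where j: "j \<in> J" "x - j * n \<in> ?M G" by blast
      have "scale c (x - j * n) \<in> ?M G" using j(2) by (rule span_scale)
      then have "scale c x - scale c j * n \<in> ?M G" by (simp add: scale_right_diff_distrib scale_mult_left)
      moreover have "scale c j \<in> J" using j Js(1) by (simp add: subspace_scale)
      ultimately show "\<exists>j\<in>J. scale c x - j * n \<in> ?M G" by blast
    qed
  next
    case (step z)
    then obtain j g where jg: "z = j * g" "j \<in> J" "g \<in> insert n G" by blast
    show ?case
    proof (cases "g = n")
      case True
      then have "z - j * n \<in> ?M G" using jg by (simp add: span_zero)
      then show ?thesis using jg(2) by (rule bexI)
    next
      case False
      then have "z \<in> ?M G" using jg by (intro span_base) blast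
      then have "z - 0 * n \<in> ?M G" by simp
      then show ?thesis using subspace_0[OF Js(1)] by (rule bexI)
    qed
  qed
  have "n \<in> ?M (insert n G)" using insert.prems by blast
  then obtain j where j: "j \<in> J" and s: "n - j * n \<in> ?M G" using dec by blast
  obtain y where y: "j = y - y * j" using qr[OF j] by blast
  have "y * (n - j * n) = (y - y * j) * n" by (simp add: algebra_simps)
  then have "j * n = y * (n - j * n)" using y by simp
  then have "j * n \<in> ?M G" using Mmult[OF s, of y] by simp
  then have "(n - j * n) + j * n \<in> ?M G" using s by (intro span_add)
  then have nM: "n \<in> ?M G" by simp
  have "z \<in> ?M G" if z: "z \<in> ?M (insert n G)" for z
  proof -
    obtain i where "i \<in> J" "z - i * n \<in> ?M G" using dec[OF z] by blast
    moreover have "i * n \<in> ?M G" by (rule Mmult[OF nM])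
    ultimately have "(z - i * n) + i * n \<in> ?M G" by (intro span_add)
    then show ?thesis by simp
  qed
  then have "G \<subseteq> ?M G" using insert.prems by blast
  then have G0: "G \<subseteq> {0}" by (rule insert.IH)
  have "{j * g | j g. j \<in> J \<and> g \<in> G} \<subseteq> {0}" using G0 by auto
  then have "?M G \<subseteq> span {0}" by (rule span_mono)
  then have "n = 0" using nM by auto
  then show ?case using G0 by simp
qed simp

text \<open>Products with factors from \<open>J\<close> are accumulated on the left because \<open>J\<close> is only known to be a left
ideal. The last factor is arbitrary, which costs one letter from \<open>J\<close> in the lemma on words below.\<close>

primrec radical_power :: "'a set \<Rightarrow> nat \<Rightarrow> 'a set" where
  "radical_power J 0 = UNIV"
| "radical_power J (Suc k) = span {j * z | j z. j \<in> J \<and> z \<in> radical_power J k}"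

lemma radical_power_antimono: "k \<le> l \<Longrightarrow> radical_power J l \<subseteq> radical_power J k"
proof (induction rule: dec_induct)
  case (step m)
  have "radical_power J (Suc l) \<subseteq> radical_power J l" for l
  proof (induction l)
    case (Suc l)
    then show ?case by (simp del: radical_power.simps add: radical_power.simps(2)[of J "Suc l"]) 
      (subst radical_power.simps(2)[of J l], intro span_mono, blast)
  qed simp
  then show ?case using step.IH by blast
qed simp

lemma subspace_radical_power: "subspace (radical_power J k)"
  by (cases k) simp_all

lemma radical_power_eventually_0:
  assumes J: "left_ideal scale UNIV J" and qr: "\<And>x. x \<in> J \<Longrightarrow> \<exists>y. x = y - y * x"
  shows "\<exists>k. radical_power J k = {0}"
proof -
  obtain k where k: "\<And>l. dim (radical_power J k) \<le> dim (radical_power J l)"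
    using ex_has_least_nat[of "\<lambda>_. True" 0 "\<lambda>k. dim (radical_power J k)"] by auto
  have eq: "radical_power J (Suc k) = radical_power J k"
    by (rule subspace_dim_equal[OF subspace_radical_power subspace_radical_power radical_power_antimono k]) simp
  obtain G where G: "G \<subseteq> radical_power J k" "independent G" "radical_power J k \<subseteq> span G"
    by (rule maximal_independent_subset)
  have "finite G" by (rule finiteI_independent[OF G(2)])
  let ?M = "span {j * g | j g. j \<in> J \<and> g \<in> G}"
  have "j * z \<in> ?M" if "j \<in> J" "z \<in> span G" for j z
    using that(2)
  proof (induction rule: span_induct)
    case base
    show ?case
      by (simp add: subspace_def distrib_left span_zero span_add span_scale scale_mult_right[symmetric])
  next
    case (step g)
    then show ?case using that(1) by (intro span_base) blast
  qed
  then have "{j * z | j z. j \<in> J \<and> z \<in> radical_power J k} \<subseteq> ?M" using G(3) by auto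
  then have "radical_power J (Suc k) \<subseteq> ?M" by (simp add: span_minimal)
  then have "G \<subseteq> ?M" using eq G(1) by blast
  then have "G \<subseteq> {0}" using nakayama[OF J _ \<open>finite G\<close>] qr by blast
  then have "span G \<subseteq> {0}" using span_mono[of G "{0}"] by simp
  then have "radical_power J k = {0}" using G(3) subspace_0[OF subspace_radical_power] by blast
  then show ?thesis by blast
qed

lemma word_in_radical_power:
  assumes J: "left_ideal scale UNIV J"
  shows "xs \<noteq> [] \<Longrightarrow> prod_nonempty xs \<in> radical_power J (length (filter (\<lambda>x. x \<in> J) xs) - 1)"
proof (induction xs)
  case (Cons x xs)
  let ?c = "length (filter (\<lambda>x. x \<in> J) xs)"
  show ?case
  proof (cases "xs = []")
    case False
    then have IH: "prod_nonempty xs \<in> radical_power J (?c - 1)" by (rule Cons.IH)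
    have p: "prod_nonempty (x # xs) = x * prod_nonempty xs" using False by (rule prod_nonempty_Cons)
    show ?thesis
    proof (cases "x \<in> J")
      case True
      show ?thesis
      proof (cases ?c)
        case (Suc m)
        have "x * prod_nonempty xs \<in> radical_power J (Suc m)"
          using IH True Suc by (simp, intro span_base) auto
        then show ?thesis using True Suc p by simp
      qed (use True in simp)
    next
      case False
      have "x * z \<in> radical_power J m" if "z \<in> radical_power J m" for z m
      proof (cases m)
        case (Suc l)
        from that show ?thesis unfolding Suc radical_power.simps
        proof (induction rule: span_induct)
          case base
          show ?case
            by (simp add: subspace_def distrib_left span_zero span_add span_scale scale_mult_right[symmetric])
        next
          case (step z)
          then obtain j w where "z = j * w" "j \<in> J" "w \<in> radical_power J l" by blast
          then have "x * z = (x * j) * w" "x * j \<in> J" using J by (auto simp: mult.assoc left_ideal_def)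
          then show ?case using \<open>w \<in> radical_power J l\<close> by (intro span_base) blast
        qed
      qed simp
      from this[OF IH] show ?thesis using False p by simp
    qed
  qed simp
qed simp

text \<open>Letters outside of the radical may stand anywhere between the letters from the radical.\<close>

theorem words_with_many_radical_letters_vanish:
  "\<exists>p\<ge>1. \<forall>xs. p \<le> length (filter (\<lambda>x. x \<in> jacobson_radical scale UNIV) xs) \<longrightarrow> prod_nonempty xs = 0"
proof -
  let ?J = "jacobson_radical scale UNIV"
  obtain k where k: "radical_power ?J k = {0}"
    using radical_power_eventually_0[OF jacobson_radical_left_ideal jacobson_radical_quasi_regular] by blast
  have "prod_nonempty xs = 0" if le: "Suc k \<le> length (filter (\<lambda>x. x \<in> ?J) xs)" for xs
  proof (cases "xs = []")
    case False
    have "prod_nonempty xs \<in> radical_power ?J (length (filter (\<lambda>x. x \<in> ?J) xs) - 1)"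
      by (rule word_in_radical_power[OF jacobson_radical_left_ideal False])
    also have "\<dots> \<subseteq> radical_power ?J k" by (rule radical_power_antimono) (use le in simp)
    finally show ?thesis using k by simp
  qed simp
  then show ?thesis by (intro exI[of _ "Suc k"]) simp
qed

context
  fixes D \<D> :: "'a set"
  assumes D: "subalgebra scale D" and \<D>: "independent \<D>" "span \<D> = D"
begin

text \<open>The trace of left multiplication by \<open>z\<close>, read off in the basis \<open>\<D>\<close>.\<close>

definition regular_trace :: "'a \<Rightarrow> 'f" where
  "regular_trace z = (\<Sum>v\<in>\<D>. representation \<D> (z * v) v)"

lemma finite_basis: "finite \<D>" by (rule finiteI_independent[OF \<D>(1)])

lemma basis_in: "v \<in> \<D> \<Longrightarrow> v \<in> D"
  using span_base[of v \<D>] \<D>(2) by simp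

lemma Dclosed: "x \<in> D \<Longrightarrow> y \<in> D \<Longrightarrow> x * y \<in> D" "subspace D"
  using D by (auto simp: subalgebra_def)

lemma rep_add: "x \<in> D \<Longrightarrow> y \<in> D \<Longrightarrow> representation \<D> (x + y) v = representation \<D> x v + representation \<D> y v"
  using representation_add[OF \<D>(1)] \<D>(2) by simp

lemma rep_scale: "x \<in> D \<Longrightarrow> representation \<D> (scale c x) v = c * representation \<D> x v"
  using representation_scale[OF \<D>(1)] \<D>(2) by simp

lemma rep_sum: "x \<in> D \<Longrightarrow> (\<Sum>v\<in>\<D>. scale (representation \<D> x v) v) = x"
  using sum_representation_eq[OF \<D>(1) _ finite_basis, of x] \<D>(2) by simp

lemma regular_trace_add: "x \<in> D \<Longrightarrow> y \<in> D \<Longrightarrow> regular_trace (x + y) = regular_trace x + regular_trace y"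
  by (simp add: regular_trace_def distrib_right rep_add Dclosed basis_in sum.distrib)

lemma regular_trace_scale: "x \<in> D \<Longrightarrow> regular_trace (scale c x) = c * regular_trace x"
  by (simp add: regular_trace_def scale_mult_left[symmetric] rep_scale Dclosed basis_in sum_distrib_left)

lemma regular_trace_sum:
  "(\<And>k. k \<in> K \<Longrightarrow> f k \<in> D) \<Longrightarrow> regular_trace (\<Sum>k\<in>K. scale (c k) (f k)) = (\<Sum>k\<in>K. c k * regular_trace (f k))"
  by (rule additive_homogeneous_sum[OF Dclosed(2) regular_trace_add regular_trace_scale])

text \<open>The trace of an idempotent map is its rank: the image \<open>e D\<close> has a basis \<open>E\<close> fixed by \<open>e\<close>, and
expanding \<open>e z\<close> in terms of \<open>E\<close> writes the map as a sum of \<open>card E\<close> maps of rank one and trace 1.\<close>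

lemma regular_trace_idempotent:
  assumes e: "e \<in> D" "e * e = e"
  shows "\<exists>r. regular_trace e = of_nat r \<and> (r = 0 \<longrightarrow> e = 0)"
proof -
  let ?V = "(\<lambda>z. e * z) ` D"
  obtain E where E: "E \<subseteq> ?V" "independent E" "?V \<subseteq> span E"
    by (rule maximal_independent_subset)
  have finE: "finite E" by (rule finiteI_independent[OF E(2)])
  have ED: "E \<subseteq> D" using E(1) e(1) Dclosed(1) by blast
  have ew: "e * w = w" if w: "w \<in> E" for w
  proof -
    obtain z where "w = e * z" using E(1) w by blast
    then show ?thesis using e(2) by (simp add: mult.assoc[symmetric])
  qed
  have inE: "e * z \<in> span E" if "z \<in> D" for z using E(3) that by blast
  have expand: "representation \<D> (e * v) v = (\<Sum>w\<in>E. representation E (e * v) w * representation \<D> w v)"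
    if v: "v \<in> \<D>" for v
  proof -
    have "e * v = (\<Sum>w\<in>E. scale (representation E (e * v) w) w)"
      using sum_representation_eq[OF E(2) inE finE] basis_in[OF v] by simp
    then have "representation \<D> (e * v) v = representation \<D> (\<Sum>w\<in>E. scale (representation E (e * v) w) w) v"
      by simp
    also have "\<dots> = (\<Sum>w\<in>E. representation \<D> (scale (representation E (e * v) w) w) v)"
      using ED \<D>(2) Dclosed(2) by (subst representation_sum[OF \<D>(1)]) (auto intro: subspace_scale)
    also have "\<dots> = (\<Sum>w\<in>E. representation E (e * v) w * representation \<D> w v)"
      using ED by (intro sum.cong refl rep_scale) auto
    finally show ?thesis .
  qed
  have one: "(\<Sum>v\<in>\<D>. representation E (e * v) w * representation \<D> w v) = 1" if w: "w \<in> E" for w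
  proof -
    have wD: "w \<in> D" using ED w by blast
    have "w = e * (\<Sum>v\<in>\<D>. scale (representation \<D> w v) v)" using rep_sum[OF wD] ew[OF w] by simp
    also have "\<dots> = (\<Sum>v\<in>\<D>. scale (representation \<D> w v) (e * v))"
      by (simp add: sum_distrib_left scale_mult_right)
    finally have "representation E w w = representation E (\<Sum>v\<in>\<D>. scale (representation \<D> w v) (e * v)) w"
      by simp
    also have "\<dots> = (\<Sum>v\<in>\<D>. representation E (scale (representation \<D> w v) (e * v)) w)"
      using inE basis_in by (subst representation_sum[OF E(2)]) (auto intro: span_scale)
    also have "\<dots> = (\<Sum>v\<in>\<D>. representation E (e * v) w * representation \<D> w v)"
      using inE basis_in by (intro sum.cong refl) (simp add: representation_scale[OF E(2)] mult.commute)
    finally show ?thesis using representation_basis[OF E(2) w] by simp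
  qed
  have "regular_trace e = (\<Sum>v\<in>\<D>. \<Sum>w\<in>E. representation E (e * v) w * representation \<D> w v)"
    unfolding regular_trace_def by (intro sum.cong refl expand)
  also have "\<dots> = (\<Sum>w\<in>E. \<Sum>v\<in>\<D>. representation E (e * v) w * representation \<D> w v)" by (rule sum.swap)
  also have "\<dots> = of_nat (card E)" by (simp add: one)
  finally have "regular_trace e = of_nat (card E)" .
  moreover have "e = 0" if "card E = 0"
  proof -
    have "E = {}" using that finE by simp
    then have "e * e \<in> {0}" using inE[OF e(1)] by simp
    then show ?thesis using e(2) by simp
  qed
  ultimately show ?thesis by (intro exI[of _ "card E"] conjI impI)
qed

end

end

locale fd_algebra_char_0 = fd_algebra scale Basis
  for scale :: "'f::field_char_0 \<Rightarrow> 'a::ring \<Rightarrow> 'a" and Basis :: "'a set"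
begin

context
  fixes D \<D> :: "'a set"
  assumes D: "subalgebra scale D" and \<D>: "independent \<D>" "span \<D> = D"
    and nonil: "\<And>K. left_ideal scale D K \<Longrightarrow> \<forall>x\<in>K. \<exists>n. pw x n = 0 \<Longrightarrow> K \<subseteq> {0}"
begin

abbreviation "tr \<equiv> regular_trace \<D>"

lemmas Dc = Dclosed[OF D \<D>]
lemmas tr_add = regular_trace_add[OF D \<D>] and tr_scale = regular_trace_scale[OF D \<D>]
  and tr_sum = regular_trace_sum[OF D \<D>]

text \<open>The kernel of the trace form is a left ideal without nonzero idempotents, because an idempotent \<open>c\<close>
in it satisfies \<open>tr c = tr (c c) = 0\<close>. So the kernel is nil.\<close>

lemma trace_form_nondegenerate:
  assumes y: "y \<in> D" "\<And>z. z \<in> D \<Longrightarrow> tr (z * y) = 0"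
  shows "y = 0"
proof -
  define K where "K = {y \<in> D. \<forall>z\<in>D. tr (z * y) = 0}"
  have t0: "tr 0 = 0" using tr_scale[of 0 0] subspace_0[OF Dc(2)] by simp
  have Ks: "subspace K" unfolding K_def subspace_def
    using subspace_0[OF Dc(2)] subspace_add[OF Dc(2)] subspace_scale[OF Dc(2)]
    by (simp add: t0 distrib_left tr_add Dc(1) scale_mult_right[symmetric] tr_scale)
  have Km: "b * x \<in> K" if "b \<in> D" "x \<in> K" for b x
    using that by (simp add: K_def Dc(1) mult.assoc[symmetric])
  have K: "left_ideal scale D K"
    unfolding left_ideal_def using Ks Km by (auto simp: K_def)
  have "\<exists>n. pw x n = 0" if x: "x \<in> K" for x
  proof (rule ccontr)
    assume "\<nexists>n. pw x n = 0"
    then obtain c where c: "c \<in> span (range (pw x))" "c * c = c" "c \<noteq> 0"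
      using idempotent_if_not_nilpotent[of x] by blast
    have "pw x n \<in> K" for n
    proof (induction n)
      case (Suc n)
      have "x \<in> D" using x by (simp add: K_def)
      then show ?case using Km Suc by (simp add: pw_Suc)
    qed (simp add: pw_0 x)
    then have "range (pw x) \<subseteq> K" by blast
    then have cK: "c \<in> K" using c(1) span_minimal[OF _ Ks] by blast
    then have cD: "c \<in> D" by (simp add: K_def)
    then have "tr (c * c) = 0" using cK by (simp add: K_def)
    then have "tr c = 0" by (simp only: c(2))
    then show False using regular_trace_idempotent[OF D \<D> cD c(2)] c(3) by auto
  qed
  then have "K \<subseteq> {0}" using nonil[OF K] by blast
  moreover have "y \<in> K" using y by (simp add: K_def)
  ultimately show ?thesis by blast
qed

text \<open>The map \<open>\<Phi>\<close> with coordinates \<open>tr (u y)\<close> is injective on \<open>D\<close> by nondegeneracy, hence onto for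
reasons of dimension; preimages of the basis vectors form the dual basis.\<close>

lemma trace_form_dual_basis:
  "\<exists>\<epsilon>. \<forall>v\<in>\<D>. \<epsilon> v \<in> D \<and> (\<forall>u\<in>\<D>. tr (u * \<epsilon> v) = (if u = v then 1 else 0))"
proof -
  have fin: "finite \<D>" by (rule finiteI_independent[OF \<D>(1)])
  have bD: "v \<in> D" if "v \<in> \<D>" for v using span_base[OF that] \<D>(2) by simp
  define \<Phi> where "\<Phi> y = (\<Sum>u\<in>\<D>. scale (tr (u * y)) u)" for y
  have \<Phi>add: "\<Phi> (x + y) = \<Phi> x + \<Phi> y" if "x \<in> D" "y \<in> D" for x y
    using that bD by (simp add: \<Phi>_def distrib_left tr_add Dc(1) scale_left_distrib sum.distrib)
  have \<Phi>scale: "\<Phi> (scale c x) = scale c (\<Phi> x)" if "x \<in> D" for c x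
    using that bD by (simp add: \<Phi>_def scale_mult_right[symmetric] tr_scale Dc(1) scale_sum_right)
  have \<Phi>0: "y = 0" if y: "y \<in> D" "\<Phi> y = 0" for y
  proof (rule trace_form_nondegenerate[OF y(1)])
    have tu: "tr (u * y) = 0" if "u \<in> \<D>" for u
      using independentD[OF \<D>(1) fin subset_refl _ that, of "\<lambda>u. tr (u * y)"] y(2)
      by (simp add: \<Phi>_def)
    fix z assume z: "z \<in> D"
    have "z * y = (\<Sum>u\<in>\<D>. scale (representation \<D> z u) u) * y"
      using rep_sum[OF D \<D> z] by simp
    also have "\<dots> = (\<Sum>u\<in>\<D>. scale (representation \<D> z u) (u * y))"
      by (simp add: sum_distrib_right scale_mult_left)
    finally show "tr (z * y) = 0" using y(1) bD by (simp add: tr_sum Dc(1) tu)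
  qed
  have \<Phi>sum: "\<Phi> (\<Sum>v\<in>\<D>. scale (c v) v) = (\<Sum>v\<in>\<D>. scale (c v) (\<Phi> v))" for c
    by (rule additive_homogeneous_sum[OF Dc(2) \<Phi>add \<Phi>scale bD])
  have zero: "\<forall>v\<in>\<D>. c v = 0" if "(\<Sum>v\<in>\<D>. scale (c v) (\<Phi> v)) = 0" for c
  proof -
    have "(\<Sum>v\<in>\<D>. scale (c v) v) \<in> D" using bD Dc(2) by (auto intro!: subspace_sum subspace_scale)
    moreover have "\<Phi> (\<Sum>v\<in>\<D>. scale (c v) v) = 0" using that \<Phi>sum by simp
    ultimately have "(\<Sum>v\<in>\<D>. scale (c v) v) = 0" by (rule \<Phi>0)
    then show ?thesis using independentD[OF \<D>(1) fin subset_refl, of c] by blast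
  qed
  have inj: "inj_on \<Phi> \<D>" by (rule independent_family(1)[OF fin]) (rule zero)
  have indep: "independent (\<Phi> ` \<D>)" by (rule independent_family(2)[OF fin]) (rule zero)
  have \<Phi>D: "\<Phi> y \<in> D" for y unfolding \<Phi>_def using bD Dc(2) by (auto intro!: subspace_sum subspace_scale)
  then have sub: "\<Phi> ` \<D> \<subseteq> D" by blast
  have "dim D = card \<D>" using \<D> dim_span_eq_card_independent by blast
  also have "\<dots> = card (\<Phi> ` \<D>)" using inj by (simp add: card_image)
  finally have "dim D \<le> card (\<Phi> ` \<D>)" by (rule eq_imp_le)
  then have full: "D \<subseteq> span (\<Phi> ` \<D>)" by (rule card_ge_dim_independent[OF sub indep])
  have surj: "\<exists>y\<in>D. \<Phi> y = x" if "x \<in> D" for x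
  proof -
    have "x \<in> span (\<Phi> ` \<D>)" using full that by blast
    then obtain c where "x = (\<Sum>v\<in>\<Phi> ` \<D>. scale (c v) v)"
      using span_finite[of "\<Phi> ` \<D>"] fin by auto
    then have "x = \<Phi> (\<Sum>v\<in>\<D>. scale (c (\<Phi> v)) v)"
      using inj by (simp add: sum.reindex \<Phi>sum)
    moreover have "(\<Sum>v\<in>\<D>. scale (c (\<Phi> v)) v) \<in> D" using bD Dc(2) by (auto intro!: subspace_sum subspace_scale)
    ultimately show ?thesis by blast
  qed
  have "\<exists>y\<in>D. \<forall>u\<in>\<D>. tr (u * y) = (if u = v then 1 else 0)" if v: "v \<in> \<D>" for v
  proof -
    obtain y where y: "y \<in> D" "\<Phi> y = v" using surj bD[OF v] by blast
    have "(\<Sum>u\<in>\<D>. scale (tr (u * y) - (if u = v then 1 else 0)) u)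
        = \<Phi> y - (\<Sum>u\<in>\<D>. if u = v then u else 0)"
      unfolding \<Phi>_def sum_subtractf[symmetric]
      by (intro sum.cong refl) (simp add: scale_left_diff_distrib)
    also have "\<dots> = 0" using y v fin by simp
    finally have "\<forall>u\<in>\<D>. tr (u * y) - (if u = v then 1 else 0) = 0"
      using independentD[OF \<D>(1) fin subset_refl, of "\<lambda>u. tr (u * y) - (if u = v then 1 else 0)"] by blast
    then show ?thesis using y(1) by (intro bexI[of _ y]) simp_all
  qed
  then have "\<forall>v\<in>\<D>. \<exists>y. y \<in> D \<and> (\<forall>u\<in>\<D>. tr (u * y) = (if u = v then 1 else 0))" by blast
  from bchoice[OF this] show ?thesis .
qed

text \<open>By nondegeneracy the trace is represented by an element \<open>e\<close>, that is, \<open>tr x = tr (x e)\<close>. Then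
\<open>y e - y\<close> lies in the kernel of the form, and so does \<open>e y - y\<close>.\<close>

lemma unit_ex: "\<exists>e\<in>D. \<forall>x\<in>D. e * x = x \<and> x * e = x"
proof -
  have fin: "finite \<D>" by (rule finiteI_independent[OF \<D>(1)])
  have bD: "v \<in> D" if "v \<in> \<D>" for v using span_base[OF that] \<D>(2) by simp
  obtain \<epsilon> where \<epsilon>: "\<And>v. v \<in> \<D> \<Longrightarrow> \<epsilon> v \<in> D"
    "\<And>u v. u \<in> \<D> \<Longrightarrow> v \<in> \<D> \<Longrightarrow> tr (u * \<epsilon> v) = (if u = v then 1 else 0)"
    using trace_form_dual_basis by blast
  define e where "e = (\<Sum>v\<in>\<D>. scale (tr v) (\<epsilon> v))"
  have eD: "e \<in> D" unfolding e_def using \<epsilon>(1) Dc(2) by (auto intro!: subspace_sum subspace_scale)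
  have tue: "tr (u * e) = tr u" if "u \<in> \<D>" for u
  proof -
    have "tr (u * e) = tr (\<Sum>v\<in>\<D>. scale (tr v) (u * \<epsilon> v))"
      by (simp add: e_def sum_distrib_left scale_mult_right)
    also have "\<dots> = (\<Sum>v\<in>\<D>. tr v * tr (u * \<epsilon> v))"
      using \<epsilon>(1) bD that by (intro tr_sum Dc(1)) auto
    also have "\<dots> = (\<Sum>v\<in>\<D>. if v = u then tr v else 0)"
      using that by (intro sum.cong refl) (auto simp: \<epsilon>(2))
    also have "\<dots> = tr u" using that fin by simp
    finally show ?thesis .
  qed
  have te: "tr (x * e) = tr x" if "x \<in> D" for x
  proof -
    have "x * e = (\<Sum>u\<in>\<D>. scale (representation \<D> x u) u) * e" using rep_sum[OF D \<D> that] by simp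
    also have "\<dots> = (\<Sum>u\<in>\<D>. scale (representation \<D> x u) (u * e))"
      by (simp add: sum_distrib_right scale_mult_left)
    finally have "tr (x * e) = (\<Sum>u\<in>\<D>. representation \<D> x u * tr u)"
      using bD eD by (simp add: tr_sum Dc(1) tue)
    also have "\<dots> = tr (\<Sum>u\<in>\<D>. scale (representation \<D> x u) u)" using bD by (simp add: tr_sum)
    finally show ?thesis using rep_sum[OF D \<D> that] by simp
  qed
  have tdiff: "tr (a - b) = tr a - tr b" if "a \<in> D" "b \<in> D" for a b
  proof -
    have "tr ((a - b) + b) = tr (a - b) + tr b"
      using that Dc(2) by (intro tr_add) (auto intro: subspace_diff)
    then show ?thesis by simp
  qed
  have right: "y * e = y" if y: "y \<in> D" for y
  proof -
    have "y * e - y = 0"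
    proof (rule trace_form_nondegenerate)
      show "y * e - y \<in> D" using y eD Dc by (auto intro: subspace_diff)
      fix z assume z: "z \<in> D"
      have "z * (y * e - y) = (z * y) * e - z * y" by (simp add: right_diff_distrib mult.assoc)
      then show "tr (z * (y * e - y)) = 0" using z y eD by (simp add: tdiff Dc(1) te)
    qed
    then show ?thesis by simp
  qed
  have left: "e * y = y" if y: "y \<in> D" for y
  proof -
    have "e * y - y = 0"
    proof (rule trace_form_nondegenerate)
      show "e * y - y \<in> D" using y eD Dc by (auto intro: subspace_diff)
      fix z assume z: "z \<in> D"
      have "z * (e * y - y) = (z * e) * y - z * y" by (simp add: right_diff_distrib mult.assoc)
      also have "\<dots> = 0" using right[OF z] by simp
      finally have "z * (e * y - y) = 0" .
      then show "tr (z * (e * y - y)) = 0" using tdiff[of 0 0] subspace_0[OF Dc(2)] by simp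
    qed
    then show ?thesis by simp
  qed
  show ?thesis using eD left right by blast
qed

end

end

section \<open>Burnside's theorem\<close>

locale alg_closed_fd = finite_dimensional_vector_space scale Basis
  for scale :: "'f::alg_closed_field \<Rightarrow> 'v::ab_group_add \<Rightarrow> 'v" and Basis
begin

definition poly_apply :: "'f poly \<Rightarrow> ('v \<Rightarrow> 'v) \<Rightarrow> 'v \<Rightarrow> 'v" where
  "poly_apply p f x = (\<Sum>i\<le>degree p. scale (coeff p i) ((f ^^ i) x))"

lemma poly_apply_bound:
  assumes "degree p \<le> M" shows "poly_apply p f x = (\<Sum>i\<le>M. scale (coeff p i) ((f ^^ i) x))"
  unfolding poly_apply_def using assms by (intro sum.mono_neutral_left) (auto simp: coeff_eq_0)

text \<open>Split off linear factors of \<open>p\<close> one by one until the remaining factor does not annihilate \<open>x\<close>.\<close>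

lemma eigenvector_if_annihilated:
  assumes U: "subspace U"
    and f: "\<And>x y. x \<in> U \<Longrightarrow> y \<in> U \<Longrightarrow> f (x + y) = f x + f y"
      "\<And>c x. x \<in> U \<Longrightarrow> f (scale c x) = scale c (f x)" "\<And>x. x \<in> U \<Longrightarrow> f x \<in> U"
    and x: "x \<in> U" "x \<noteq> 0"
  shows "p \<noteq> 0 \<Longrightarrow> poly_apply p f x = 0 \<Longrightarrow> \<exists>a w. w \<in> U \<and> w \<noteq> 0 \<and> f w = scale a w"
proof (induction "degree p" arbitrary: p)
  case 0
  then obtain a where "p = [:a:]" by (metis degree_eq_zeroE)
  then show ?case using 0 x by (simp add: poly_apply_def)
next
  case (Suc d)
  then obtain a where a: "poly p a = 0" using alg_closed_imp_poly_has_root[of p] by auto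
  then obtain q where q: "p = [:-a, 1:] * q" by (auto simp: poly_eq_0_iff_dvd elim: dvdE)
  then have "q \<noteq> 0" using Suc.prems(1) by auto
  then have "degree p = degree [:-a, 1:] + degree q" unfolding q by (intro degree_mult_eq) auto
  then have dq: "degree q = d" using Suc.hyps(2) by simp
  have fi: "(f ^^ i) x \<in> U" for i by (induction i) (simp_all add: f(3) x(1))
  have fsum: "f (\<Sum>i\<in>I. scale (c i) ((f ^^ i) x)) = (\<Sum>i\<in>I. scale (c i) (f ((f ^^ i) x)))" for c I
    by (rule additive_homogeneous_sum[OF U f(1,2) fi])
  define y where "y = poly_apply q f x"
  have yU: "y \<in> U" unfolding y_def poly_apply_def using fi U by (auto intro!: subspace_sum subspace_scale)
  have cp: "coeff p i = (if i = 0 then 0 else coeff q (i - 1)) - a * coeff q i" for i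
  proof -
    have "p = pCons 0 q + smult (-a) q" unfolding q by simp
    then show ?thesis by (simp add: coeff_pCons split: nat.split)
  qed
  have "poly_apply p f x = (\<Sum>i\<le>Suc d. scale (coeff p i) ((f ^^ i) x))"
    using Suc.hyps(2) by (intro poly_apply_bound) simp
  also have "\<dots> = (\<Sum>i\<le>Suc d. scale (if i = 0 then 0 else coeff q (i - 1)) ((f ^^ i) x))
      - scale a (\<Sum>i\<le>Suc d. scale (coeff q i) ((f ^^ i) x))"
    by (simp only: cp scale_left_diff_distrib sum_subtractf scale_sum_right scale_scale)
  also have "(\<Sum>i\<le>Suc d. scale (coeff q i) ((f ^^ i) x)) = y"
    unfolding y_def using dq by (intro poly_apply_bound[symmetric]) simp
  also have "(\<Sum>i\<le>Suc d. scale (if i = 0 then 0 else coeff q (i - 1)) ((f ^^ i) x)) =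
      (\<Sum>i\<le>d. scale (coeff q i) ((f ^^ Suc i) x))"
    by (subst sum.atMost_Suc_shift) simp
  also have "\<dots> = f y" unfolding y_def poly_apply_def dq by (simp add: fsum)
  finally have *: "f y - scale a y = 0" using Suc.prems(2) by simp
  show ?case
  proof (cases "y = 0")
    case True
    then show ?thesis using Suc.hyps(1)[of q] dq \<open>q \<noteq> 0\<close> by (simp add: y_def)
  next
    case False
    then show ?thesis using * yU by (intro exI[of _ a] exI[of _ y]) simp
  qed
qed

lemma eigenvector_ex:
  assumes U: "subspace U"
    and f: "\<And>x y. x \<in> U \<Longrightarrow> y \<in> U \<Longrightarrow> f (x + y) = f x + f y"
      "\<And>c x. x \<in> U \<Longrightarrow> f (scale c x) = scale c (f x)" "\<And>x. x \<in> U \<Longrightarrow> f x \<in> U"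
    and x: "x \<in> U" "x \<noteq> 0"
  shows "\<exists>a w. w \<in> U \<and> w \<noteq> 0 \<and> f w = scale a w"
proof -
  define g where "g i = (f ^^ i) x" for i
  have "\<exists>p. p \<noteq> 0 \<and> poly_apply p f x = 0"
  proof (cases "inj_on g {..dimension}")
    case True
    have "card (g ` {..dimension}) = Suc dimension" using True by (simp add: card_image)
    then have dep: "dependent (g ` {..dimension})"
      using dim_subset_UNIV[of "g ` {..dimension}"] dim_eq_card_independent[of "g ` {..dimension}"] by auto
    then obtain c where c: "\<exists>v\<in>g ` {..dimension}. c v \<noteq> 0" "(\<Sum>v\<in>g ` {..dimension}. scale (c v) v) = 0"
      using dep dependent_finite[of "g ` {..dimension}"] by auto
    define p where "p = (\<Sum>i\<le>dimension. monom (c (g i)) i)"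
    have cf: "coeff p i = (if i \<le> dimension then c (g i) else 0)" for i
      by (simp add: p_def coeff_sum)
    have "degree p \<le> dimension" by (rule degree_le) (simp add: cf)
    then have "poly_apply p f x = (\<Sum>i\<le>dimension. scale (c (g i)) (g i))"
      by (simp add: poly_apply_bound cf g_def)
    also have "\<dots> = 0" using c(2) True by (simp add: sum.reindex)
    finally have "poly_apply p f x = 0" .
    moreover obtain i where "i \<le> dimension" "c (g i) \<noteq> 0" using c(1) by auto
    then have "p \<noteq> 0" using cf[of i] by auto
    ultimately show ?thesis by blast
  next
    case False
    then obtain i j where ij: "i < j" "g i = g j" unfolding inj_on_def by (metis linorder_neqE_nat)
    define p where "p = monom 1 j - monom (1::'f) i"
    have "degree p \<le> j" unfolding p_def using ij(1)
      by (intro degree_diff_le) (auto intro: order.trans[OF degree_monom_le])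
    then have "poly_apply p f x = (\<Sum>k\<le>j. scale (coeff p k) (g k))" by (simp add: poly_apply_bound g_def)
    also have "\<dots> = (\<Sum>k\<in>{i,j}. scale (coeff p k) (g k))"
      using ij by (intro sum.mono_neutral_right) (auto simp: p_def)
    also have "\<dots> = 0" using ij by (simp add: p_def)
    finally have "poly_apply p f x = 0" .
    moreover have "coeff p j = 1" using ij(1) by (simp add: p_def)
    then have "p \<noteq> 0" by auto
    ultimately show ?thesis by blast
  qed
  then show ?thesis using eigenvector_if_annihilated[OF U f x] by blast
qed

lemma dim_image_less:
  assumes U: "subspace U"
    and f: "\<And>x y. x \<in> U \<Longrightarrow> y \<in> U \<Longrightarrow> f (x + y) = f x + f y"
      "\<And>c x. x \<in> U \<Longrightarrow> f (scale c x) = scale c (f x)"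
    and u: "u \<in> U" "u \<noteq> 0" "f u = 0"
  shows "dim (f ` U) < dim U"
proof -
  have "independent {u}" "{u} \<subseteq> U" using u by auto
  then obtain b where b: "{u} \<subseteq> b" "b \<subseteq> U" "independent b" "U \<subseteq> span b"
    using maximal_independent_subset_extend[of "{u}" U] by blast
  have fin: "finite b" by (rule finiteI_independent[OF b(3)])
  have "dim U = card b" using b by (intro dim_unique[of b]) auto
  have fsum: "f (\<Sum>v\<in>b. scale (c v) v) = (\<Sum>v\<in>b. scale (c v) (f v))" for c
    using b(2) by (intro additive_homogeneous_sum[OF U f]) auto
  have "f ` U \<subseteq> span (f ` (b - {u}))"
  proof safe
    fix x assume "x \<in> U"
    then have "x \<in> span b" using b(4) by blast
    then obtain c where c: "x = (\<Sum>v\<in>b. scale (c v) v)" using span_finite[OF fin] by auto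
    have "f x = (\<Sum>v\<in>b. scale (c v) (f v))" unfolding c by (rule fsum)
    also have "\<dots> = (\<Sum>v\<in>b - {u}. scale (c v) (f v))"
      using fin b(1) u(3) by (simp add: sum.remove)
    finally show "f x \<in> span (f ` (b - {u}))"
      by simp (intro span_sum span_scale span_base imageI, simp)
  qed
  then have "dim (f ` U) \<le> card (f ` (b - {u}))" by (rule dim_le_card) (use fin in simp)
  also have "\<dots> \<le> card (b - {u})" by (rule card_image_le) (use fin in simp)
  also have "\<dots> < card b" using fin b(1) by (intro psubset_card_mono) auto
  finally show ?thesis using \<open>dim U = card b\<close> by simp
qed

text \<open>Take \<open>T \<noteq> 0\<close> of minimal rank in \<open>E\<close>. If its rank were at least 2, there would be \<open>A \<in> E\<close> such that
\<open>T A T\<close> is not a multiple of \<open>T\<close>; with an eigenvalue \<open>a\<close> of \<open>T A\<close> on the image of \<open>T\<close>, the map \<open>T A T - a T\<close>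
would be nonzero of smaller rank. So \<open>T x = l\<^sub>0 x v\<^sub>0\<close>. The functionals \<open>l\<^sub>0 \<circ> Q\<close> with \<open>Q \<in> E\<close> have no
common zero by irreducibility, hence they exhaust the dual space, and composition of \<open>T\<close> with
elements of \<open>E\<close> on both sides gives all maps of rank one.\<close>

theorem burnside_rank_one:
  assumes V: "subspace V"
    and lin_add: "\<And>\<phi> x y. \<phi> \<in> E \<Longrightarrow> x \<in> V \<Longrightarrow> y \<in> V \<Longrightarrow> \<phi> (x + y) = \<phi> x + \<phi> y"
    and lin_scale: "\<And>\<phi> c x. \<phi> \<in> E \<Longrightarrow> x \<in> V \<Longrightarrow> \<phi> (scale c x) = scale c (\<phi> x)"
    and maps: "\<And>\<phi> x. \<phi> \<in> E \<Longrightarrow> x \<in> V \<Longrightarrow> \<phi> x \<in> V"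
    and Eadd: "\<And>\<phi> \<psi>. \<phi> \<in> E \<Longrightarrow> \<psi> \<in> E \<Longrightarrow> (\<lambda>x. \<phi> x + \<psi> x) \<in> E"
    and Escale: "\<And>c \<phi>. \<phi> \<in> E \<Longrightarrow> (\<lambda>x. scale c (\<phi> x)) \<in> E"
    and Ecomp: "\<And>\<phi> \<psi>. \<phi> \<in> E \<Longrightarrow> \<psi> \<in> E \<Longrightarrow> (\<lambda>x. \<phi> (\<psi> x)) \<in> E"
    and one: "\<iota> \<in> E" "\<And>x. x \<in> V \<Longrightarrow> \<iota> x = x"
    and irr: "\<And>U. subspace U \<Longrightarrow> U \<subseteq> V \<Longrightarrow> (\<And>\<phi> x. \<phi> \<in> E \<Longrightarrow> x \<in> U \<Longrightarrow> \<phi> x \<in> U) \<Longrightarrow> U = {0} \<or> U = V"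
    and w: "w \<in> V"
    and l: "\<And>x y. x \<in> V \<Longrightarrow> y \<in> V \<Longrightarrow> L (x + y) = L x + L y" "\<And>c x. x \<in> V \<Longrightarrow> L (scale c x) = c * L x"
  shows "\<exists>\<phi>\<in>E. \<forall>x\<in>V. \<phi> x = scale (L x) w"
proof (cases "V = {0}")
  case True
  have "\<iota> x = scale (L x) w" if "x \<in> V" for x using that w one(2) True by simp
  then show ?thesis using one(1) by blast
next
  case False
  then obtain v1 where v1: "v1 \<in> V" "v1 \<noteq> 0" using subspace_0[OF V] by blast
  have trans: "\<exists>\<phi>\<in>E. \<phi> y = z" if y: "y \<in> V" "y \<noteq> 0" and z: "z \<in> V" for y z
  proof -
    let ?U = "{\<phi> y | \<phi>. \<phi> \<in> E}"
    have "subspace ?U" unfolding subspace_def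
    proof (intro conjI ballI allI)
      have "(\<lambda>x. scale 0 (\<iota> x)) \<in> E" by (rule Escale[OF one(1)])
      then show "0 \<in> ?U" by force
      fix a b assume "a \<in> ?U" "b \<in> ?U"
      then obtain \<phi> \<psi> where "a = \<phi> y" "\<phi> \<in> E" "b = \<psi> y" "\<psi> \<in> E" by blast
      then show "a + b \<in> ?U" using Eadd[of \<phi> \<psi>] by force
    next
      fix c a assume "a \<in> ?U"
      then obtain \<phi> where "a = \<phi> y" "\<phi> \<in> E" by blast
      then show "scale c a \<in> ?U" using Escale[of \<phi> c] by force
    qed
    moreover have "?U \<subseteq> V" using maps y(1) by blast
    moreover have "\<phi> a \<in> ?U" if \<phi>: "\<phi> \<in> E" and a: "a \<in> ?U" for \<phi> a
    proof -
      obtain \<psi> where "a = \<psi> y" "\<psi> \<in> E" using a by blast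
      then show ?thesis using Ecomp[OF \<phi>, of \<psi>] by force
    qed
    ultimately have "?U = {0} \<or> ?U = V" by (rule irr)
    moreover have "\<iota> y \<in> ?U" using one(1) by blast
    then have "y \<in> ?U" by (simp only: one(2)[OF y(1)])
    ultimately have "?U = V" using y(2) by blast
    then show ?thesis using z by blast
  qed
  define nz where "nz \<phi> \<longleftrightarrow> \<phi> \<in> E \<and> (\<exists>x\<in>V. \<phi> x \<noteq> 0)" for \<phi>
  have "nz \<iota>" using one v1 by (auto simp: nz_def)
  then obtain T where "nz T" and minT: "\<And>\<phi>. nz \<phi> \<Longrightarrow> dim (T ` V) \<le> dim (\<phi> ` V)"
    using ex_has_least_nat[of nz \<iota> "\<lambda>\<phi>. dim (\<phi> ` V)"] by blast
  then obtain x1 where T: "T \<in> E" and x1: "x1 \<in> V" "T x1 \<noteq> 0" by (auto simp: nz_def)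
  have imT: "subspace (T ` V)"
    unfolding subspace_def
  proof (intro conjI ballI allI)
    show "0 \<in> T ` V" using lin_scale[OF T x1(1), of 0] subspace_0[OF V] by force
    fix a b assume "a \<in> T ` V" "b \<in> T ` V"
    then obtain x y where "a = T x" "x \<in> V" "b = T y" "y \<in> V" by blast
    then show "a + b \<in> T ` V" using lin_add[OF T, of x y] subspace_add[OF V, of x y] by force
  next
    fix c a assume "a \<in> T ` V"
    then obtain x where "a = T x" "x \<in> V" by blast
    then show "scale c a \<in> T ` V" using lin_scale[OF T, of x c] subspace_scale[OF V, of x c] by force
  qed
  have TV: "T ` V \<subseteq> V" using maps[OF T] by blast
  define v0 where "v0 = T x1"
  have v0: "v0 \<in> V" "v0 \<noteq> 0" "v0 \<in> T ` V" using x1 maps[OF T] by (auto simp: v0_def)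
  have rank1: "T x \<in> span {v0}" if x: "x \<in> V" for x
  proof (rule ccontr)
    assume nin: "T x \<notin> span {v0}"
    obtain A where A: "A \<in> E" "A v0 = x" using trans[OF v0(1,2) x] by blast
    let ?f = "\<lambda>y. T (A y)"
    have fE: "?f \<in> E" by (rule Ecomp[OF T A(1)])
    have fadd: "?f (a + b) = ?f a + ?f b" if "a \<in> T ` V" "b \<in> T ` V" for a b
      using that TV lin_add[OF fE, of a b] by blast
    have fscale: "?f (scale c a) = scale c (?f a)" if "a \<in> T ` V" for a c
      using that TV lin_scale[OF fE, of a c] by blast
    have fin: "?f a \<in> T ` V" if "a \<in> T ` V" for a
      using that TV maps[OF A(1)] by blast
    obtain a u where u: "u \<in> T ` V" "u \<noteq> 0" "?f u = scale a u"
      using eigenvector_ex[OF imT fadd fscale fin v0(3,2)] by blast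
    define g where "g y = ?f y + scale (-a) (\<iota> y)" for y
    have gE: "g \<in> E" unfolding g_def by (intro Eadd[OF fE] Escale one(1))
    have gy: "g y = ?f y - scale a y" if "y \<in> V" for y using that by (simp add: g_def one(2))
    have SE: "(\<lambda>y. g (T y)) \<in> E" by (rule Ecomp[OF gE T])
    have "g (T x1) \<noteq> 0"
    proof
      assume "g (T x1) = 0"
      then have "T x = scale a v0" using gy[OF v0(1)] A(2) by (simp add: v0_def)
      then show False using nin by (simp add: span_base span_scale)
    qed
    then have "nz (\<lambda>y. g (T y))" using SE x1(1) by (auto simp: nz_def)
    then have "dim (T ` V) \<le> dim ((\<lambda>y. g (T y)) ` V)" by (rule minT)
    also have "(\<lambda>y. g (T y)) ` V = g ` (T ` V)" by (simp add: image_image)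
    also have "dim (g ` (T ` V)) < dim (T ` V)"
    proof (rule dim_image_less[OF imT _ _ u(1,2)])
      show "g u = 0" using u TV gy[of u] by auto
      show "g (a + b) = g a + g b" if "a \<in> T ` V" "b \<in> T ` V" for a b
        using that TV lin_add[OF gE, of a b] by blast
      show "g (scale c a) = scale c (g a)" if "a \<in> T ` V" for a c
        using that TV lin_scale[OF gE, of a c] by blast
    qed
    finally show False by simp
  qed
  have "\<exists>k. T x = scale k v0" if "x \<in> V" for x
    using rank1[OF that] by (auto simp: span_singleton)
  then obtain l0 where l0: "\<And>x. x \<in> V \<Longrightarrow> T x = scale (l0 x) v0" by metis
  have l0_add: "l0 (x + y) = l0 x + l0 y" if "x \<in> V" "y \<in> V" for x y
  proof -
    have "scale (l0 (x + y)) v0 = scale (l0 x + l0 y) v0"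
      using lin_add[OF T that] l0 that subspace_add[OF V that] by (simp add: scale_left_distrib)
    then show ?thesis using v0(2) by simp
  qed
  have l0_scale: "l0 (scale c x) = c * l0 x" if "x \<in> V" for c x
  proof -
    have "scale (l0 (scale c x)) v0 = scale (c * l0 x) v0"
      using lin_scale[OF T that, of c] l0 that subspace_scale[OF V that, of c] by simp
    then show ?thesis using v0(2) by simp
  qed
  have l0x1: "l0 x1 = 1" using l0[OF x1(1)] v0(2) by (simp add: v0_def) (metis scale_cancel_right scale_one)
  obtain b where b: "b \<subseteq> V" "independent b" "V \<subseteq> span b" by (rule maximal_independent_subset)
  have finb: "finite b" by (rule finiteI_independent[OF b(2)])
  have lin_sum: "k (\<Sum>v\<in>b. scale (c v) v) = (\<Sum>v\<in>b. c v * k v)"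
    if k: "\<And>x y. x \<in> V \<Longrightarrow> y \<in> V \<Longrightarrow> k (x + y) = k x + k y" "\<And>c x. x \<in> V \<Longrightarrow> k (scale c x) = c * (k x :: 'f)"
    for k c
    using b(1) by (intro additive_homogeneous_sum[OF V k]) auto
  \<comment> \<open>The functional \<open>l\<^sub>0 \<circ> Q\<close>, encoded as the vector of its values at the basis \<open>b\<close>.\<close>
  define \<Psi> where "\<Psi> Q = (\<Sum>v\<in>b. scale (l0 (Q v)) v)" for Q
  let ?R = "\<Psi> ` E"
  have bV: "v \<in> V" if "v \<in> b" for v using b(1) that by blast
  have R: "subspace ?R" unfolding subspace_def
  proof (intro conjI ballI allI)
    have "(\<lambda>x. scale 0 (\<iota> x)) \<in> E" by (rule Escale[OF one(1)])
    moreover have "\<Psi> (\<lambda>x. scale 0 (\<iota> x)) = 0"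
      using l0_scale[OF subspace_0[OF V], of 0] by (simp add: \<Psi>_def)
    ultimately show "0 \<in> ?R" by (metis imageI)
    fix x y assume "x \<in> ?R" "y \<in> ?R"
    then obtain P Q where PQ: "x = \<Psi> P" "y = \<Psi> Q" "P \<in> E" "Q \<in> E" by blast
    have "\<Psi> (\<lambda>z. P z + Q z) = \<Psi> P + \<Psi> Q"
      using bV maps PQ by (simp add: \<Psi>_def l0_add scale_left_distrib sum.distrib)
    then show "x + y \<in> ?R" using imageI[OF Eadd[OF PQ(3,4)], of \<Psi>] PQ(1,2) by simp
  next
    fix c x assume "x \<in> ?R"
    then obtain P where P: "x = \<Psi> P" "P \<in> E" by blast
    have "\<Psi> (\<lambda>z. scale c (P z)) = scale c (\<Psi> P)"
      using bV maps P by (simp add: \<Psi>_def l0_scale scale_sum_right)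
    then show "scale c x \<in> ?R" using imageI[OF Escale[OF P(2), of c], of \<Psi>] P(1) by simp
  qed
  have RV: "?R \<subseteq> V" unfolding \<Psi>_def using bV V by (auto intro!: subspace_sum subspace_scale)
  have "?R = V"
  proof (rule ccontr)
    assume "?R \<noteq> V"
    then obtain z where z: "z \<in> V" "z \<notin> ?R" using RV by blast
    obtain C where C: "C \<subseteq> ?R" "independent C" "?R \<subseteq> span C" by (rule maximal_independent_subset)
    have spC: "span C = ?R" using C(1,3) R by (intro span_subspace)
    have ind: "independent (insert z C)" using z spC C(2) by (intro independent_insertI) auto
    interpret F: vector_space "(*) :: 'f \<Rightarrow> 'f \<Rightarrow> 'f"
      by unfold_locales (simp_all add: algebra_simps)
    interpret VF: vector_space_pair scale "(*) :: 'f \<Rightarrow> 'f \<Rightarrow> 'f" ..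
    from VF.linear_independent_extend[OF ind, of "\<lambda>v. if v = z then 1 else 0"]
    obtain k where k: "Vector_Spaces.linear scale (*) k" "\<forall>v\<in>insert z C. k v = (if v = z then 1 else 0)" by blast
    interpret k: Vector_Spaces.linear scale "(*)" k by fact
    have "z \<notin> C" using z spC span_base by blast
    then have kC: "\<And>v. v \<in> C \<Longrightarrow> k v = 0" and kz: "k z = 1" using k(2) by auto
    have kR: "k x = 0" if "x \<in> ?R" for x
      using k.eq_0_on_span[of C x] kC that spC by blast
    define x0 where "x0 = (\<Sum>v\<in>b. scale (k v) v)"
    have x0V: "x0 \<in> V" unfolding x0_def using bV V by (auto intro!: subspace_sum subspace_scale)
    have l0Q: "l0 (Q x0) = 0" if Q: "Q \<in> E" for Q
    proof -
      have "l0 (Q x0) = (\<Sum>v\<in>b. k v * l0 (Q v))"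
        unfolding x0_def
      proof (rule lin_sum[of "\<lambda>x. l0 (Q x)"])
        show "l0 (Q (x + y)) = l0 (Q x) + l0 (Q y)" if "x \<in> V" "y \<in> V" for x y
          using that by (simp add: lin_add[OF Q] l0_add maps[OF Q])
        show "l0 (Q (scale c x)) = c * l0 (Q x)" if "x \<in> V" for c x
          using that by (simp add: lin_scale[OF Q] l0_scale maps[OF Q])
      qed
      also have "\<dots> = k (\<Psi> Q)" by (simp add: \<Psi>_def k.sum k.scale mult.commute)
      also have "\<dots> = 0" using Q by (intro kR) blast
      finally show ?thesis .
    qed
    have "x0 \<noteq> 0"
    proof
      assume "x0 = 0"
      then have "\<forall>v\<in>b. k v = 0" using independentD[OF b(2) finb subset_refl, of k] by (auto simp: x0_def)
      then have "k z = 0" using k.eq_0_on_span[of b z] b(3) z(1) by blast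
      then show False using kz by simp
    qed
    then obtain Q where Q: "Q \<in> E" "Q x0 = x1" using trans[OF x0V _ x1(1)] by blast
    then show False using l0Q[OF Q(1)] l0x1 by simp
  qed
  moreover have "(\<Sum>v\<in>b. scale (L v) v) \<in> V" using bV V by (auto intro!: subspace_sum subspace_scale)
  ultimately obtain Q where Q: "Q \<in> E" "\<Psi> Q = (\<Sum>v\<in>b. scale (L v) v)" by (metis imageE)
  have "(\<Sum>v\<in>b. scale (l0 (Q v) - L v) v) = 0"
    using Q(2) by (simp add: \<Psi>_def scale_left_diff_distrib sum_subtractf)
  then have eqb: "l0 (Q v) = L v" if "v \<in> b" for v
    using independentD[OF b(2) finb subset_refl, of "\<lambda>v. l0 (Q v) - L v"] that by auto
  have eq: "l0 (Q x) = L x" if x: "x \<in> V" for x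
  proof -
    have "x \<in> span b" using b(3) x by blast
    then obtain c where c: "x = (\<Sum>v\<in>b. scale (c v) v)" using span_finite[OF finb] by auto
    have "l0 (Q x) = (\<Sum>v\<in>b. c v * l0 (Q v))"
      unfolding c
    proof (rule lin_sum[of "\<lambda>x. l0 (Q x)"])
      show "l0 (Q (x + y)) = l0 (Q x) + l0 (Q y)" if "x \<in> V" "y \<in> V" for x y
        using that by (simp add: lin_add[OF Q(1)] l0_add maps[OF Q(1)])
      show "l0 (Q (scale c x)) = c * l0 (Q x)" if "x \<in> V" for c x
        using that by (simp add: lin_scale[OF Q(1)] l0_scale maps[OF Q(1)])
    qed
    also have "\<dots> = (\<Sum>v\<in>b. c v * L v)" by (intro sum.cong refl) (simp add: eqb)
    also have "\<dots> = L x" unfolding c by (rule lin_sum[symmetric, OF l])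
    finally show ?thesis .
  qed
  obtain A where A: "A \<in> E" "A v0 = w" using trans[OF v0(1,2) w] by blast
  have "(\<lambda>x. A (T (Q x))) \<in> E" by (intro Ecomp[OF A(1)] Ecomp[OF T] Q(1))
  moreover have "A (T (Q x)) = scale (L x) w" if "x \<in> V" for x
    using that by (simp add: l0 maps[OF Q(1)] eq lin_scale[OF A(1) v0(1)] A(2))
  ultimately show ?thesis by (intro bexI[of _ "\<lambda>x. A (T (Q x))"]) auto
qed

end

section \<open>Sums of H-simple algebras\<close>

locale fd_hopf_module_algebra =
  hopf_module_algebra scaleH \<Delta> \<epsilon> S scaleA act + AF: fd_algebra_char_0 scaleA Basis
  for scaleH :: "'f::{alg_closed_field, field_char_0} \<Rightarrow> 'h::ring_1 \<Rightarrow> 'h"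
    and \<Delta> :: "'h \<Rightarrow> ('h \<times> 'h \<Rightarrow>\<^sub>0 'f)" and \<epsilon> :: "'h \<Rightarrow> 'f" and S :: "'h \<Rightarrow> 'h"
    and scaleA :: "'f \<Rightarrow> 'a::ring \<Rightarrow> 'a" and act :: "'h \<Rightarrow> 'a \<Rightarrow> 'a" and Basis :: "'a set"
begin

sublocale AC: alg_closed_fd scaleA Basis ..

text \<open>For an H-invariant subalgebra \<open>V\<close> with unit, these maps of \<open>V\<close> are the algebra generated by the left
and right multiplications and by the action of \<open>H\<close>.\<close>

inductive multiplier :: "'a set \<Rightarrow> ('a \<Rightarrow> 'a) \<Rightarrow> bool" for V where
  base: "b \<in> V \<Longrightarrow> c \<in> V \<Longrightarrow> multiplier V (\<lambda>x. b * (act h x * c))"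
| add: "multiplier V \<phi> \<Longrightarrow> multiplier V \<psi> \<Longrightarrow> multiplier V (\<lambda>x. \<phi> x + \<psi> x)"
| scale: "multiplier V \<phi> \<Longrightarrow> multiplier V (\<lambda>x. scaleA k (\<phi> x))"

lemma multiplier_sum:
  assumes "multiplier V \<psi>" "\<And>k. k \<in> K \<Longrightarrow> multiplier V (f k)"
  shows "multiplier V (\<lambda>x. \<Sum>k\<in>K. f k x)"
  using assms(2)
proof (induction K rule: infinite_finite_induct)
  case (insert k K)
  have "multiplier V (\<lambda>x. f k x + (\<Sum>k\<in>K. f k x))"
    using insert by (intro multiplier.add) auto
  then show ?case using insert by simp
qed (use multiplier.scale[OF assms(1), of 0] in simp_all)

lemma multiplier_linear:
  assumes "multiplier V \<phi>"
  shows "\<phi> (x + y) = \<phi> x + \<phi> y" "\<phi> (scaleA k x) = scaleA k (\<phi> x)"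
  using assms
proof (induction)
  case (base b c h)
  { case 1 show ?case by (simp add: act_add distrib_left distrib_right)
  next case 2 show ?case by (simp add: act_scale A.scale_mult_left[symmetric] A.scale_mult_right[symmetric]) }
next
  case (add \<phi> \<psi>)
  { case 1 show ?case by (simp add: add.IH)
  next case 2 show ?case by (simp add: add.IH A.scale_right_distrib) }
next
  case (scale \<phi> k')
  { case 1 show ?case by (simp add: scale.IH A.scale_right_distrib)
  next case 2 show ?case by (simp add: scale.IH mult.commute) }
qed

text \<open>The factor \<open>h\<close> is moved past \<open>b'\<close> and \<open>c'\<close> with the help of the comultiplication, applied twice.\<close>

lemma multiplier_comp_base:
  assumes V: "\<And>x y. x \<in> V \<Longrightarrow> y \<in> V \<Longrightarrow> x * y \<in> V" "\<And>h x. x \<in> V \<Longrightarrow> act h x \<in> V"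
    and bc: "b \<in> V" "c \<in> V" and "multiplier V \<psi>"
  shows "multiplier V (\<lambda>x. b * (act h (\<psi> x) * c))"
  using assms(5)
proof induction
  case (base b' c' h')
  have eq: "b * (act h (b' * (act h' x * c')) * c) =
      (\<Sum>k\<in>Poly_Mapping.keys (\<Delta> h). \<Sum>l\<in>Poly_Mapping.keys (\<Delta> (snd k)).
        scaleA (Poly_Mapping.lookup (\<Delta> h) k * Poly_Mapping.lookup (\<Delta> (snd k)) l)
          ((b * act (fst k) b') * (act (fst l * h') x * (act (snd l) c' * c))))" for x
    by (simp add: act_prod lin_ext_def case_prod_unfold sum_distrib_left sum_distrib_right
        A.scale_mult_left[symmetric] A.scale_mult_right[symmetric] A.scale_sum_right mult.assoc act_mult)
  show ?case unfolding eq using V bc base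
    by (intro multiplier_sum[OF multiplier.base[OF bc]] multiplier.scale multiplier.base) blast+
next
  case (add \<phi> \<psi>)
  then show ?case using multiplier.add[OF add.IH] by (simp add: act_add distrib_left distrib_right)
next
  case (scale \<phi> k)
  then show ?case using multiplier.scale[OF scale.IH, of k]
    by (simp add: act_scale A.scale_mult_left[symmetric] A.scale_mult_right[symmetric])
qed

lemma multiplier_comp:
  assumes V: "\<And>x y. x \<in> V \<Longrightarrow> y \<in> V \<Longrightarrow> x * y \<in> V" "\<And>h x. x \<in> V \<Longrightarrow> act h x \<in> V"
    and "multiplier V \<phi>" "multiplier V \<psi>"
  shows "multiplier V (\<lambda>x. \<phi> (\<psi> x))"
  using assms(3)
proof induction
  case (base b c h)
  show ?case by (rule multiplier_comp_base[OF V base assms(4)])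
qed (simp_all add: multiplier.add multiplier.scale)

text \<open>A subspace of \<open>V\<close> stable under all multipliers is an H-invariant two-sided ideal.\<close>

lemma multiplier_rank_one:
  assumes V: "A.subspace V" "\<And>x y. x \<in> V \<Longrightarrow> y \<in> V \<Longrightarrow> x * y \<in> V" "\<And>h x. x \<in> V \<Longrightarrow> act h x \<in> V"
    and e: "e \<in> V" "\<And>x. x \<in> V \<Longrightarrow> e * x = x \<and> x * e = x"
    and simple: "\<And>U. two_sided_ideal scaleA V U \<Longrightarrow> invariant act U \<Longrightarrow> U = {0} \<or> U = V"
    and w: "w \<in> V"
    and l: "\<And>x y. x \<in> V \<Longrightarrow> y \<in> V \<Longrightarrow> L (x + y) = L x + L y" "\<And>c x. x \<in> V \<Longrightarrow> L (scaleA c x) = c * L x"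
  shows "\<exists>\<phi>. multiplier V \<phi> \<and> (\<forall>x\<in>V. \<phi> x = scaleA (L x) w)"
proof -
  let ?E = "{\<phi>. multiplier V \<phi>}"
  have maps: "\<phi> x \<in> V" if "multiplier V \<phi>" "x \<in> V" for \<phi> x
    using that by induction (auto intro: V A.subspace_add A.subspace_scale)
  have one: "multiplier V (\<lambda>x. e * (act 1 x * e))" by (rule multiplier.base[OF e(1) e(1)])
  have oneV: "e * (act 1 x * e) = x" if "x \<in> V" for x using that e(2) by (simp add: act_one)
  have irr: "U = {0} \<or> U = V" if U: "A.subspace U" "U \<subseteq> V" "\<And>\<phi> x. \<phi> \<in> ?E \<Longrightarrow> x \<in> U \<Longrightarrow> \<phi> x \<in> U" for U
  proof (rule simple)
    have m: "b * (act h x * c) \<in> U" if "b \<in> V" "c \<in> V" "x \<in> U" for b c h x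
      using U(3)[of "\<lambda>x. b * (act h x * c)" x] multiplier.base[OF that(1,2)] that(3) by simp
    show "two_sided_ideal scaleA V U"
      unfolding two_sided_ideal_def
    proof (intro conjI ballI)
      fix b x assume bx: "b \<in> V" "x \<in> U"
      then have xV: "x \<in> V" using U(2) by blast
      show "b * x \<in> U" using m[OF bx(1) e(1) bx(2), of 1] e(2)[OF xV] by (simp add: act_one)
      show "x * b \<in> U" using m[OF e(1) bx(1) bx(2), of 1] e(2)[OF V(2)[OF xV bx(1)]] by (simp add: act_one)
    qed (use U in auto)
    show "invariant act U"
      unfolding invariant_def
    proof (intro allI ballI)
      fix h x assume x: "x \<in> U"
      then have "act h x \<in> V" using U(2) V(3) by blast
      then show "act h x \<in> U" using m[OF e(1) e(1) x, of h] e(2) by simp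
    qed
  qed
  have "\<exists>\<phi>\<in>?E. \<forall>x\<in>V. \<phi> x = scaleA (L x) w"
  proof (rule AC.burnside_rank_one[OF V(1), where E = ?E and \<iota> = "\<lambda>x. e * (act 1 x * e)"])
    show "\<phi> (x + y) = \<phi> x + \<phi> y" if "\<phi> \<in> ?E" for \<phi> x y using that multiplier_linear by simp
    show "\<phi> (scaleA c x) = scaleA c (\<phi> x)" if "\<phi> \<in> ?E" for \<phi> c x using that multiplier_linear by simp
    show "\<phi> x \<in> V" if "\<phi> \<in> ?E" "x \<in> V" for \<phi> x using that maps by simp
    show "(\<lambda>x. \<phi> x + \<psi> x) \<in> ?E" if "\<phi> \<in> ?E" "\<psi> \<in> ?E" for \<phi> \<psi> using that multiplier.add by simp
    show "(\<lambda>x. scaleA c (\<phi> x)) \<in> ?E" if "\<phi> \<in> ?E" for \<phi> c using that multiplier.scale by simp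
    show "(\<lambda>x. \<phi> (\<psi> x)) \<in> ?E" if "\<phi> \<in> ?E" "\<psi> \<in> ?E" for \<phi> \<psi> using that multiplier_comp[OF V(2,3)] by simp
    show "(\<lambda>x. e * (act 1 x * e)) \<in> ?E" using one by simp
    show "e * (act 1 x * e) = x" if "x \<in> V" for x by (rule oneV[OF that])
    show "U = {0} \<or> U = V" if "A.subspace U" "U \<subseteq> V" "\<And>\<phi> x. \<phi> \<in> ?E \<Longrightarrow> x \<in> U \<Longrightarrow> \<phi> x \<in> U" for U
      by (rule irr[OF that(1,2)]) (rule that(3))
  qed (fact w l)+
  then show ?thesis by blast
qed

end

lemma unique_sum_Int_trivial:
  fixes x :: "'a::ab_group_add"
  assumes "finite I" "\<And>k. k \<in> I \<Longrightarrow> 0 \<in> M k"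
    and "\<And>f i. (\<And>k. k \<in> I \<Longrightarrow> f k \<in> M k) \<Longrightarrow> (\<Sum>k\<in>I. f k) = 0 \<Longrightarrow> i \<in> I \<Longrightarrow> f i = 0"
    and ij: "i \<in> I" "j \<in> I" "i \<noteq> j" and x: "x \<in> M i" "- x \<in> M j"
  shows "x = 0"
proof -
  let ?f = "(\<lambda>k. 0)(i := x, j := - x)"
  have "(\<Sum>k\<in>I. ?f k) = (\<Sum>k\<in>{i,j}. ?f k)"
    using ij \<open>finite I\<close> by (intro sum.mono_neutral_right) auto
  also have "\<dots> = 0" using ij(3) by simp
  finally have s: "(\<Sum>k\<in>I. ?f k) = 0" .
  have "?f k \<in> M k" if "k \<in> I" for k using x assms(2)[OF that] by simp
  from assms(3)[OF this s ij(1)] show ?thesis using ij(3) by simp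
qed

text \<open>The components \<open>Bs i\<close> with \<open>i \<in> Ix\<close> and bases \<open>\<beta> i\<close> of them. The index set is kept variable because
the lower bound is obtained for the components of a linked set.\<close>

locale H_simple_sum = fd_hopf_module_algebra scaleH \<Delta> \<epsilon> S scaleA act Basis
  for scaleH :: "'f::{alg_closed_field, field_char_0} \<Rightarrow> 'h::ring_1 \<Rightarrow> 'h"
    and \<Delta> :: "'h \<Rightarrow> ('h \<times> 'h \<Rightarrow>\<^sub>0 'f)" and \<epsilon> :: "'h \<Rightarrow> 'f" and S :: "'h \<Rightarrow> 'h"
    and scaleA :: "'f \<Rightarrow> 'a::ring \<Rightarrow> 'a" and act :: "'h \<Rightarrow> 'a \<Rightarrow> 'a" and Basis :: "'a set" +
  fixes Ix :: "'i set" and Bs :: "'i \<Rightarrow> 'a set" and \<beta> :: "'i \<Rightarrow> 'a set"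
  assumes finite_Ix: "finite Ix"
    and Bs_subspace: "i \<in> Ix \<Longrightarrow> A.subspace (Bs i)"
    and Bs_mult: "i \<in> Ix \<Longrightarrow> x \<in> Bs i \<Longrightarrow> y \<in> Bs i \<Longrightarrow> x * y \<in> Bs i"
    and Bs_orth: "i \<in> Ix \<Longrightarrow> j \<in> Ix \<Longrightarrow> i \<noteq> j \<Longrightarrow> x \<in> Bs i \<Longrightarrow> y \<in> Bs j \<Longrightarrow> x * y = 0"
    and Bs_act: "i \<in> Ix \<Longrightarrow> x \<in> Bs i \<Longrightarrow> act h x \<in> Bs i"
    and Bs_direct: "(\<And>i. i \<in> Ix \<Longrightarrow> f i \<in> Bs i) \<Longrightarrow> (\<Sum>i\<in>Ix. f i) = 0 \<Longrightarrow> i \<in> Ix \<Longrightarrow> f i = 0"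
    and Bs_semisimple: "i \<in> Ix \<Longrightarrow> semisimple_algebra scaleA (Bs i)"
    and Bs_simple: "i \<in> Ix \<Longrightarrow> two_sided_ideal scaleA (Bs i) U \<Longrightarrow> invariant act U \<Longrightarrow> U = {0} \<or> U = Bs i"
    and \<beta>: "i \<in> Ix \<Longrightarrow> A.independent (\<beta> i)" "i \<in> Ix \<Longrightarrow> A.span (\<beta> i) = Bs i"
begin

definition "\<D> = (\<Union>i\<in>Ix. \<beta> i)"
definition "D = A.span \<D>"

lemma \<beta>_in: "i \<in> Ix \<Longrightarrow> v \<in> \<beta> i \<Longrightarrow> v \<in> Bs i"
  using A.span_base[of v "\<beta> i"] \<beta>(2)[of i] by simp

lemma finite_\<beta>: "i \<in> Ix \<Longrightarrow> finite (\<beta> i)"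
  using AF.finiteI_independent[OF \<beta>(1)] .

lemma finite_\<D>: "finite \<D>"
  unfolding \<D>_def using finite_Ix finite_\<beta> by blast

lemma Bs_Int: "i \<in> Ix \<Longrightarrow> j \<in> Ix \<Longrightarrow> i \<noteq> j \<Longrightarrow> x \<in> Bs i \<Longrightarrow> x \<in> Bs j \<Longrightarrow> x = 0"
proof (rule unique_sum_Int_trivial[OF finite_Ix, of Bs])
  show "f k = 0" if "\<And>l. l \<in> Ix \<Longrightarrow> f l \<in> Bs l" "(\<Sum>l\<in>Ix. f l) = 0" "k \<in> Ix" for f k
    using that by (rule Bs_direct)
qed (auto intro: A.subspace_0 A.subspace_neg Bs_subspace)

lemma \<beta>_disjoint: "i \<in> Ix \<Longrightarrow> j \<in> Ix \<Longrightarrow> i \<noteq> j \<Longrightarrow> \<beta> i \<inter> \<beta> j = {}"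
proof (rule ccontr)
  assume ij: "i \<in> Ix" "j \<in> Ix" "i \<noteq> j" "\<beta> i \<inter> \<beta> j \<noteq> {}"
  then obtain v where v: "v \<in> \<beta> i" "v \<in> \<beta> j" by blast
  then have "v = 0" using Bs_Int[OF ij(1-3)] \<beta>_in ij by blast
  then show False using A.dependent_zero[of "\<beta> i"] \<beta>(1)[OF ij(1)] v(1) by simp
qed

lemma independent_\<D>: "A.independent \<D>"
proof (rule A.independent_if_scalars_zero[OF finite_\<D>])
  fix c v assume c: "(\<Sum>x\<in>\<D>. scaleA (c x) x) = 0" and v: "v \<in> \<D>"
  then obtain i where i: "i \<in> Ix" "v \<in> \<beta> i" by (auto simp: \<D>_def)
  define f where "f j = (\<Sum>x\<in>\<beta> j. scaleA (c x) x)" for j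
  have "(\<Sum>j\<in>Ix. f j) = (\<Sum>x\<in>\<D>. scaleA (c x) x)"
    unfolding f_def \<D>_def using finite_Ix finite_\<beta> \<beta>_disjoint
    by (intro sum.UNION_disjoint[symmetric]) auto
  then have s: "(\<Sum>j\<in>Ix. f j) = 0" using c by simp
  have "f j \<in> Bs j" if "j \<in> Ix" for j
    unfolding f_def using \<beta>_in[OF that] Bs_subspace[OF that] by (auto intro!: A.subspace_sum A.subspace_scale)
  from Bs_direct[OF this s i(1)] have "f i = 0" by simp
  then show "c v = 0"
    using A.independentD[OF \<beta>(1)[OF i(1)] finite_\<beta>[OF i(1)] subset_refl _ i(2), of c] by (simp add: f_def)
qed

lemma card_\<D>: "card \<D> = (\<Sum>i\<in>Ix. A.dim (Bs i))"
proof -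
  have "card \<D> = (\<Sum>i\<in>Ix. card (\<beta> i))"
    unfolding \<D>_def using finite_Ix finite_\<beta> \<beta>_disjoint by (intro card_UN_disjoint) auto
  also have "\<dots> = (\<Sum>i\<in>Ix. A.dim (Bs i))"
    by (intro sum.cong refl) (metis \<beta> A.dim_span_eq_card_independent)
  finally show ?thesis .
qed

lemma Bs_subset_D: "i \<in> Ix \<Longrightarrow> Bs i \<subseteq> D"
  unfolding D_def \<D>_def \<beta>(2)[symmetric] by (intro A.span_mono) blast

lemma subspace_D: "A.subspace D" by (simp add: D_def)

lemma D_decomp: "x \<in> D \<Longrightarrow> \<exists>f. (\<forall>i\<in>Ix. f i \<in> Bs i) \<and> x = (\<Sum>i\<in>Ix. f i)"
proof -
  assume "x \<in> D"
  then obtain c where c: "x = (\<Sum>v\<in>\<D>. scaleA (c v) v)"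
    unfolding D_def using A.span_finite[OF finite_\<D>] by auto
  also have "\<dots> = (\<Sum>i\<in>Ix. \<Sum>v\<in>\<beta> i. scaleA (c v) v)"
    unfolding \<D>_def using finite_Ix finite_\<beta> \<beta>_disjoint by (intro sum.UNION_disjoint) auto
  finally have "x = (\<Sum>i\<in>Ix. \<Sum>v\<in>\<beta> i. scaleA (c v) v)" .
  moreover have "(\<Sum>v\<in>\<beta> i. scaleA (c v) v) \<in> Bs i" if "i \<in> Ix" for i
    using \<beta>_in[OF that] Bs_subspace[OF that] by (auto intro!: A.subspace_sum A.subspace_scale)
  ultimately show ?thesis by (intro exI[of _ "\<lambda>i. \<Sum>v\<in>\<beta> i. scaleA (c v) v"]) blast
qed

lemma mult_component_left:
  assumes "i \<in> Ix" "b \<in> Bs i" "\<forall>i\<in>Ix. f i \<in> Bs i"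
  shows "b * (\<Sum>j\<in>Ix. f j) = b * f i"
proof -
  have "b * (\<Sum>j\<in>Ix. f j) = (\<Sum>j\<in>Ix. b * f j)" by (rule sum_distrib_left)
  also have "\<dots> = (\<Sum>j\<in>Ix. if j = i then b * f i else 0)"
    using Bs_orth[OF assms(1) _ _ assms(2)] assms(3) by (intro sum.cong refl) auto
  finally show ?thesis using finite_Ix assms(1) by simp
qed

lemma mult_component_right:
  assumes "i \<in> Ix" "b \<in> Bs i" "\<forall>i\<in>Ix. f i \<in> Bs i"
  shows "(\<Sum>j\<in>Ix. f j) * b = f i * b"
proof -
  have "(\<Sum>j\<in>Ix. f j) * b = (\<Sum>j\<in>Ix. f j * b)" by (rule sum_distrib_right)
  also have "\<dots> = (\<Sum>j\<in>Ix. if j = i then f i * b else 0)"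
    using Bs_orth[OF _ assms(1) _ _ assms(2)] assms(3) by (intro sum.cong refl) auto
  finally show ?thesis using finite_Ix assms(1) by simp
qed

lemma subalgebra_D: "subalgebra scaleA D"
  unfolding subalgebra_def
proof (intro conjI ballI)
  show "A.subspace D" by (rule subspace_D)
  fix x y assume "x \<in> D" "y \<in> D"
  obtain f where f: "\<forall>i\<in>Ix. f i \<in> Bs i" "x = (\<Sum>i\<in>Ix. f i)" using D_decomp[OF \<open>x \<in> D\<close>] by blast
  obtain g where g: "\<forall>i\<in>Ix. g i \<in> Bs i" "y = (\<Sum>i\<in>Ix. g i)" using D_decomp[OF \<open>y \<in> D\<close>] by blast
  have "x * y = (\<Sum>i\<in>Ix. f i * y)" unfolding f(2) by (rule sum_distrib_right)
  also have "\<dots> = (\<Sum>i\<in>Ix. f i * g i)"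
    unfolding g(2) using f(1) by (intro sum.cong refl mult_component_left g(1)) auto
  also have "\<dots> \<in> D" using f(1) g(1) Bs_mult Bs_subset_D by (intro A.subspace_sum[OF subspace_D]) blast
  finally show "x * y \<in> D" .
qed

text \<open>For \<open>y\<close> in a nil left ideal \<open>K\<close> with components \<open>f i\<close>, the left ideal \<open>(Bs i) y = (Bs i) (f i)\<close> of \<open>Bs i\<close> is
contained in \<open>K\<close>, so it vanishes; then the line through \<open>f i\<close> is a left ideal with zero product.\<close>

lemma no_nil_left_ideal:
  assumes K: "left_ideal scaleA D K" and nil: "\<forall>x\<in>K. \<exists>n. AF.pw x n = 0"
  shows "K \<subseteq> {0}"
proof
  have Ks: "A.subspace K" "K \<subseteq> D" "\<And>b x. b \<in> D \<Longrightarrow> x \<in> K \<Longrightarrow> b * x \<in> K"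
    using K by (auto simp: left_ideal_def)
  have sub: "subalgebra scaleA (Bs i)" if "i \<in> Ix" for i
    using Bs_subspace[OF that] Bs_mult[OF that] by (simp add: subalgebra_def)
  have rad: "jacobson_radical scaleA (Bs i) = {0}" if "i \<in> Ix" for i
    using Bs_semisimple[OF that] by (simp add: semisimple_algebra_def)
  fix y assume y: "y \<in> K"
  obtain f where f: "\<forall>i\<in>Ix. f i \<in> Bs i" "y = (\<Sum>i\<in>Ix. f i)" using D_decomp Ks(2) y by blast
  have "f i = 0" if i: "i \<in> Ix" for i
  proof -
    have fi: "f i \<in> Bs i" using f(1) i by blast
    have by_eq: "b * f i = b * y" if "b \<in> Bs i" for b
      using mult_component_left[OF i that f(1)] f(2) by simp
    let ?K1 = "(\<lambda>b. b * f i) ` Bs i"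
    have "Vector_Spaces.linear scaleA scaleA (\<lambda>b. b * f i)"
      by unfold_locales (simp_all add: distrib_right A.scale_mult_left)
    then interpret l: Vector_Spaces.linear scaleA scaleA "\<lambda>b. b * f i" .
    have "left_ideal scaleA (Bs i) ?K1"
      unfolding left_ideal_def
    proof (intro conjI ballI)
      show "A.subspace ?K1" by (rule l.subspace_image[OF Bs_subspace[OF i]])
      show "?K1 \<subseteq> Bs i" using Bs_mult[OF i] fi by blast
      fix b x assume "b \<in> Bs i" "x \<in> ?K1"
      then obtain c where "c \<in> Bs i" "x = c * f i" by blast
      then have "b * x = (b * c) * f i" "b * c \<in> Bs i" using Bs_mult[OF i] \<open>b \<in> Bs i\<close> by (simp_all add: mult.assoc)
      then show "b * x \<in> ?K1" by blast
    qed
    moreover have "\<exists>n. AF.pw x n = 0" if x: "x \<in> ?K1" for x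
    proof -
      obtain b where b: "b \<in> Bs i" "x = b * f i" using x by blast
      then have "x \<in> K" using by_eq[OF b(1)] Ks(3)[OF _ y] Bs_subset_D[OF i] by auto
      then show ?thesis using nil by blast
    qed
    ultimately have "?K1 \<subseteq> {0}"
      using AF.nil_left_ideal_subset_radical[OF sub[OF i]] rad[OF i] by blast
    then have zero: "b * f i = 0" if "b \<in> Bs i" for b using that by blast
    let ?K2 = "A.span {f i}"
    have K2: "x * f i = 0" "b * x = 0" if "x \<in> ?K2" "b \<in> Bs i" for x b
      using that zero fi by (auto simp: A.span_singleton A.scale_mult_left[symmetric] A.scale_mult_right[symmetric])
    have "left_ideal scaleA (Bs i) ?K2"
      unfolding left_ideal_def
    proof (intro conjI ballI)
      show "?K2 \<subseteq> Bs i" using fi Bs_subspace[OF i] by (intro A.span_minimal) auto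
      show "b * x \<in> ?K2" if "b \<in> Bs i" "x \<in> ?K2" for b x using K2(2)[OF that(2,1)] by (simp add: A.span_zero)
    qed simp
    moreover have "\<exists>n. AF.pw x n = 0" if "x \<in> ?K2" for x
    proof -
      have "x \<in> Bs i" using that fi Bs_subspace[OF i] A.span_minimal[of "{f i}" "Bs i"] by auto
      then have "AF.pw x 1 = 0" using K2(2)[OF that] by (simp add: AF.pw_Suc AF.pw_0)
      then show ?thesis by blast
    qed
    ultimately have "?K2 \<subseteq> {0}"
      using AF.nil_left_ideal_subset_radical[OF sub[OF i]] rad[OF i] by blast
    then show ?thesis using A.span_base[of "f i" "{f i}"] by blast
  qed
  then show "y \<in> {0}" using f(2) by simp
qed

abbreviation "trD \<equiv> AF.regular_trace \<D>"

lemma dual_basis_ex: "\<exists>\<delta>. \<forall>v\<in>\<D>. \<delta> v \<in> D \<and> (\<forall>u\<in>\<D>. trD (u * \<delta> v) = (if u = v then 1 else 0))"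
  by (rule AF.trace_form_dual_basis[OF subalgebra_D independent_\<D> D_def[symmetric] no_nil_left_ideal])

lemma component_units_ex: "\<exists>e. \<forall>i\<in>Ix. e i \<in> Bs i \<and> (\<forall>x\<in>Bs i. e i * x = x \<and> x * e i = x)"
proof -
  obtain u where u: "u \<in> D" "\<forall>x\<in>D. u * x = x \<and> x * u = x"
    using AF.unit_ex[OF subalgebra_D independent_\<D> D_def[symmetric] no_nil_left_ideal] by blast
  obtain e where e: "\<forall>i\<in>Ix. e i \<in> Bs i" "u = (\<Sum>i\<in>Ix. e i)" using D_decomp[OF u(1)] by blast
  have "e i * x = x \<and> x * e i = x" if "i \<in> Ix" "x \<in> Bs i" for i x
    using mult_component_left[OF that e(1)] mult_component_right[OF that e(1)] u(2) Bs_subset_D[OF that(1)] that(2) e(2) by auto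
  then show ?thesis using e(1) by blast
qed

definition "unit_of = (SOME e. \<forall>i\<in>Ix. e i \<in> Bs i \<and> (\<forall>x\<in>Bs i. e i * x = x \<and> x * e i = x))"

lemma unit_of: "i \<in> Ix \<Longrightarrow> unit_of i \<in> Bs i" "i \<in> Ix \<Longrightarrow> x \<in> Bs i \<Longrightarrow> unit_of i * x = x \<and> x * unit_of i = x"
  using someI_ex[OF component_units_ex] unfolding unit_of_def by blast+

definition "comp_of v = (SOME i. i \<in> Ix \<and> v \<in> \<beta> i)"

lemma comp_of: "v \<in> \<D> \<Longrightarrow> comp_of v \<in> Ix \<and> v \<in> \<beta> (comp_of v)"
  unfolding comp_of_def by (rule someI_ex) (auto simp: \<D>_def)

text \<open>The map is \<open>x \<mapsto> (v-th coordinate of x) e\<close> with \<open>e\<close> the unit of the component of \<open>v\<close>. On the other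
components it vanishes since its coefficients come from the component of \<open>v\<close>.\<close>

lemma coordinate_multiplier_ex:
  assumes v: "v \<in> \<D>"
  shows "\<exists>\<phi>. multiplier (Bs (comp_of v)) \<phi> \<and> (\<forall>w\<in>\<D>. \<phi> w = (if w = v then unit_of (comp_of v) else 0))"
proof -
  let ?i = "comp_of v"
  have i: "?i \<in> Ix" "v \<in> \<beta> ?i" using comp_of[OF v] by auto
  have spD: "x \<in> A.span \<D>" if "x \<in> Bs ?i" for x using Bs_subset_D[OF i(1)] that by (auto simp: D_def)
  have "\<exists>\<phi>. multiplier (Bs ?i) \<phi> \<and> (\<forall>x\<in>Bs ?i. \<phi> x = scaleA (A.representation \<D> x v) (unit_of ?i))"
  proof (rule multiplier_rank_one[OF Bs_subspace[OF i(1)] Bs_mult[OF i(1)] Bs_act[OF i(1)]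
        unit_of(1)[OF i(1)] unit_of(2)[OF i(1)] Bs_simple[OF i(1)] unit_of(1)[OF i(1)]])
    show "A.representation \<D> (x + y) v = A.representation \<D> x v + A.representation \<D> y v"
      if "x \<in> Bs ?i" "y \<in> Bs ?i" for x y
      using A.representation_add[OF independent_\<D> spD spD] that by simp
    show "A.representation \<D> (scaleA c x) v = c * A.representation \<D> x v" if "x \<in> Bs ?i" for c x
      using A.representation_scale[OF independent_\<D> spD] that by simp
  qed
  then obtain \<phi> where \<phi>: "multiplier (Bs ?i) \<phi>"
    "\<forall>x\<in>Bs ?i. \<phi> x = scaleA (A.representation \<D> x v) (unit_of ?i)" by blast
  have other: "\<phi> x = 0" if j: "j \<in> Ix" "j \<noteq> ?i" "x \<in> Bs j" for x j
    using \<phi>(1)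
  proof induction
    case (base b c h)
    have "act h x * c = 0" using Bs_orth[OF j(1) i(1) j(2) Bs_act[OF j(1,3)] base(2)] .
    then show ?case by simp
  qed simp_all
  have "\<phi> w = (if w = v then unit_of ?i else 0)" if w: "w \<in> \<D>" for w
  proof (cases "comp_of w = ?i")
    case True
    then have "w \<in> Bs ?i" using comp_of[OF w] \<beta>_in by auto
    then have "\<phi> w = scaleA (A.representation \<D> w v) (unit_of ?i)" using \<phi>(2) by blast
    then show ?thesis by (simp add: A.representation_basis[OF independent_\<D> w])
  next
    case False
    have "w \<noteq> v" using False by auto
    moreover have "w \<in> Bs (comp_of w)" using comp_of[OF w] \<beta>_in by blast
    ultimately show ?thesis using other[OF _ False] comp_of[OF w] by simp
  qed
  then show ?thesis using \<phi>(1) by blast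
qed

end

section \<open>Alternating functions and traces\<close>

text \<open>The variables of the functions constructed below: \<open>Letter k\<close> is the \<open>k\<close>-th factor of a given nonzero
product; for each basis vector \<open>v\<close> of \<open>D\<close> there is a variable \<open>Arg v\<close>, in which the functions alternate,
with coefficients \<open>LCoef v\<close> and \<open>RCoef v\<close> beside it; and \<open>Pair1 j\<close>, \<open>Pair2 j\<close> are the variables that
enter through traces.\<close>

datatype 'v slot = Letter nat | LCoef 'v | Arg 'v | RCoef 'v | Pair1 nat | Pair2 nat

definition permute_args :: "('v \<Rightarrow> 'v) \<Rightarrow> 'v slot \<Rightarrow> 'v slot" where
  "permute_args \<pi> j = (case j of Arg v \<Rightarrow> Arg (\<pi> v) | _ \<Rightarrow> j)"

lemma permute_args_comp: "permute_args \<sigma> (permute_args \<pi> j) = permute_args (\<sigma> \<circ> \<pi>) j"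
  by (cases j) (simp_all add: permute_args_def)

lemma permute_args_simps [simp]:
  "permute_args \<pi> (Arg v) = Arg (\<pi> v)" "permute_args \<pi> (Letter k) = Letter k"
  "permute_args \<pi> (LCoef v) = LCoef v" "permute_args \<pi> (RCoef v) = RCoef v"
  "permute_args \<pi> (Pair1 k) = Pair1 k" "permute_args \<pi> (Pair2 k) = Pair2 k"
  by (simp_all add: permute_args_def)

lemma prod_nonempty_absorb:
  assumes "\<And>v. v \<in> set vs \<Longrightarrow> u * \<xi> v = u"
  shows "prod_nonempty (u # map \<xi> vs) = u"
  using assms
proof (induction vs)
  case (Cons v vs)
  have uv: "u * \<xi> v = u" using Cons.prems by simp
  have IH: "prod_nonempty (u # map \<xi> vs) = u" using Cons by simp
  show ?case
  proof (cases "vs = []")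
    case True
    then show ?thesis using uv by simp
  next
    case False
    have "prod_nonempty (u # map \<xi> (v # vs)) = u * (\<xi> v * prod_nonempty (map \<xi> vs))"
      using False by (simp add: prod_nonempty_Cons)
    also have "\<dots> = u * prod_nonempty (map \<xi> vs)" by (simp add: mult.assoc[symmetric] uv)
    also have "\<dots> = u" using IH False by (simp add: prod_nonempty_Cons)
    finally show ?thesis .
  qed
qed simp

lemma prod_nonempty_absorb_concat:
  assumes "\<And>k v. k \<in> set ks \<Longrightarrow> v \<in> set (vs k) \<Longrightarrow> u k * \<xi> v = u k"
  shows "prod_nonempty (concat (map (\<lambda>k. u k # map \<xi> (vs k)) ks)) = prod_nonempty (map u ks)"
  using assms
proof (induction ks)
  case (Cons k ks)
  have k: "prod_nonempty (u k # map \<xi> (vs k)) = u k"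
    using Cons.prems by (intro prod_nonempty_absorb) simp
  have IH: "prod_nonempty (concat (map (\<lambda>k. u k # map \<xi> (vs k)) ks)) = prod_nonempty (map u ks)"
    using Cons by simp
  show ?case
  proof (cases "ks = []")
    case True
    then show ?thesis using k by simp
  next
    case False
    then have ne: "concat (map (\<lambda>k. u k # map \<xi> (vs k)) ks) \<noteq> []" by (cases ks) simp_all
    have "prod_nonempty (concat (map (\<lambda>k. u k # map \<xi> (vs k)) (k # ks))) =
        prod_nonempty ((u k # map \<xi> (vs k)) @ concat (map (\<lambda>k. u k # map \<xi> (vs k)) ks))" by simp
    also have "\<dots> = u k * prod_nonempty (map u ks)"
      using ne by (subst prod_nonempty_append) (simp_all only: k IH, simp_all)
    finally show ?thesis using False by (simp add: prod_nonempty_Cons)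
  qed
qed simp

context hopf_module_algebra
begin

lemma hfun_proj: "hfun {i} (\<lambda>x. x i)"
  using hfun.var[of i 1] by (simp add: act_one)

lemma hfun_zero_at:
  assumes "hfun I f" "i \<in> I" "x i = 0" shows "f x = 0"
proof -
  have "x = x(i := scaleA 0 0)" using assms(3) by (auto simp: fun_eq_iff)
  then have "f x = scaleA 0 (f (x(i := 0)))" using hfun_scale_at[OF assms(1,2), of x 0 0] by (simp only:)
  then show ?thesis by (simp only: A.scale_zero_left)
qed

end

context H_simple_sum
begin

definition alternating :: "(('a slot \<Rightarrow> 'a) \<Rightarrow> 'a) \<Rightarrow> bool" where
  "alternating F \<longleftrightarrow> (\<forall>x. \<forall>a\<in>\<D>. \<forall>b\<in>\<D>. a \<noteq> b \<longrightarrow>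
     F (\<lambda>j. x (permute_args (Transposition.transpose a b) j)) = - F x)"

definition alternate :: "(('a slot \<Rightarrow> 'a) \<Rightarrow> 'a) \<Rightarrow> ('a slot \<Rightarrow> 'a) \<Rightarrow> 'a" where
  "alternate F x = (\<Sum>\<pi> | \<pi> permutes \<D>. scaleA (of_int (sign \<pi>)) (F (\<lambda>j. x (permute_args \<pi> j))))"

lemma alternating_alternate: "alternating (alternate F)"
  unfolding alternating_def
proof (intro allI ballI impI)
  fix x :: "'a slot \<Rightarrow> 'a" and a b assume ab: "a \<in> \<D>" "b \<in> \<D>" "a \<noteq> b"
  let ?\<tau> = "Transposition.transpose a b"
  have \<tau>: "?\<tau> permutes \<D>" using ab by (intro permutes_swap_id)
  have inv: "?\<tau> \<circ> (?\<tau> \<circ> \<pi>) = \<pi>" for \<pi> by (simp add: fun_eq_iff)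
  have perm: "permutation \<pi>" if "\<pi> permutes \<D>" for \<pi>
    using that finite_\<D> unfolding permutation_permutes by blast
  have sgn: "sign (?\<tau> \<circ> \<pi>) = - sign \<pi>" if "\<pi> permutes \<D>" for \<pi>
    using sign_compose[OF perm[OF \<tau>] perm[OF that]] ab(3) by (simp add: sign_swap_id)
  have "alternate F (\<lambda>j. x (permute_args ?\<tau> j)) =
      (\<Sum>\<pi> | \<pi> permutes \<D>. scaleA (of_int (sign \<pi>)) (F (\<lambda>j. x (permute_args (?\<tau> \<circ> \<pi>) j))))"
    by (simp only: alternate_def permute_args_comp)
  also have "\<dots> = (\<Sum>\<pi> | \<pi> permutes \<D>. scaleA (of_int (sign (?\<tau> \<circ> \<pi>))) (F (\<lambda>j. x (permute_args \<pi> j))))"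
    by (rule sum.reindex_bij_witness[where i = "\<lambda>\<pi>. ?\<tau> \<circ> \<pi>" and j = "\<lambda>\<pi>. ?\<tau> \<circ> \<pi>"])
      (simp_all only: inv mem_Collect_eq permutes_compose[OF _ \<tau>])
  also have "\<dots> = (\<Sum>\<pi> | \<pi> permutes \<D>. - scaleA (of_int (sign \<pi>)) (F (\<lambda>j. x (permute_args \<pi> j))))"
    by (intro sum.cong refl) (simp add: sgn)
  also have "\<dots> = - alternate F x" by (simp only: alternate_def sum_negf)
  finally show "alternate F (\<lambda>j. x (permute_args ?\<tau> j)) = - alternate F x" .
qed

lemma hfun_alternate:
  assumes F: "hfun I F" and I: "\<And>v. Arg v \<in> I \<longleftrightarrow> v \<in> \<D>"
  shows "hfun I (alternate F)"
proof -
  have "hfun I (\<lambda>x. F (\<lambda>j. x (permute_args \<pi> j)))" if \<pi>: "\<pi> permutes \<D>" for \<pi>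
  proof -
    have inj: "inj_on (permute_args \<pi>) I"
    proof (rule inj_onI)
      fix j k assume "permute_args \<pi> j = permute_args \<pi> k"
      then show "j = k" by (cases j; cases k) (use permutes_inj[OF \<pi>] in \<open>auto dest: injD\<close>)
    qed
    have "permute_args \<pi> ` I = I"
    proof
      show "permute_args \<pi> ` I \<subseteq> I"
      proof safe
        fix j assume "j \<in> I"
        then show "permute_args \<pi> j \<in> I"
          by (cases j) (use I permutes_in_image[OF \<pi>] in auto)
      qed
      show "I \<subseteq> permute_args \<pi> ` I"
      proof
        fix j assume j: "j \<in> I"
        show "j \<in> permute_args \<pi> ` I"
        proof (cases j)
          case (Arg v)
          then have "v \<in> \<pi> ` \<D>" using I j permutes_image[OF \<pi>] by simp
          then obtain w where "w \<in> \<D>" "v = \<pi> w" by blast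
          then have "Arg w \<in> I" "j = permute_args \<pi> (Arg w)" using I Arg by simp_all
          then show ?thesis by blast
        qed (use j in \<open>auto intro!: image_eqI[of _ _ j]\<close>)
      qed
    qed
    then show ?thesis using hfun_relabel[OF F inj] by simp
  qed
  then show ?thesis
    unfolding alternate_def[abs_def] by (intro hfun_sum[OF F] hfun.scale) simp
qed

text \<open>Equal arguments give \<open>F x = - F x\<close>, which means \<open>F x = 0\<close> in characteristic 0.\<close>

lemma alternating_repeated:
  assumes "alternating F" "a \<in> \<D>" "b \<in> \<D>" "a \<noteq> b" "x (Arg a) = x (Arg b)"
  shows "F x = 0"
proof -
  have "x (permute_args (Transposition.transpose a b) j) = x j" for j
  proof (cases j)
    case (Arg v)
    then show ?thesis using assms(5) by (cases "v = a"; cases "v = b") simp_all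
  qed simp_all
  then have eq: "F x = - F x"
    using assms(1-4) unfolding alternating_def by (metis (no_types, lifting) ext)
  have "scaleA 2 (F x) = scaleA 1 (F x) + scaleA 1 (F x)" by (subst A.scale_left_distrib[symmetric]) simp
  also have "\<dots> = F x + F x" by simp
  also have "\<dots> = 0" using eq by (metis add.right_inverse)
  finally show ?thesis by simp
qed

text \<open>Left multiplication by the product of the variables \<open>i\<close> and \<open>k\<close>, applied to one argument at a time.\<close>

definition trace_step :: "'a slot \<Rightarrow> 'a slot \<Rightarrow> (('a slot \<Rightarrow> 'a) \<Rightarrow> 'a) \<Rightarrow> ('a slot \<Rightarrow> 'a) \<Rightarrow> 'a" where
  "trace_step i k F x = (\<Sum>v\<in>\<D>. F (x(Arg v := x i * (x k * x (Arg v)))))"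

lemma hfun_trace_step:
  assumes F: "hfun I F" and I: "Arg ` \<D> \<subseteq> I" "i \<notin> I" "k \<notin> I" "i \<noteq> k" and "\<D> \<noteq> {}"
  shows "hfun (I \<union> {i, k}) (trace_step i k F)"
proof -
  have one: "hfun (I \<union> {i, k}) (\<lambda>x. F (x(Arg v := x i * (x k * x (Arg v)))))" if v: "v \<in> \<D>" for v
  proof -
    have vI: "Arg v \<in> I" using I(1) v by blast
    have "hfun ({i} \<union> ({k} \<union> {Arg v})) (\<lambda>x. x i * (x k * x (Arg v)))"
      using I vI by (intro hfun.mult hfun_proj) auto
    then have "hfun (I - {Arg v} \<union> ({i} \<union> ({k} \<union> {Arg v}))) (\<lambda>x. F (x(Arg v := x i * (x k * x (Arg v)))))"
      using I by (intro hfun_subst[OF F vI]) auto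
    moreover have "I - {Arg v} \<union> ({i} \<union> ({k} \<union> {Arg v})) = I \<union> {i, k}" using vI by blast
    ultimately show ?thesis by (simp only:)
  qed
  obtain v where "v \<in> \<D>" using \<open>\<D> \<noteq> {}\<close> by blast
  show ?thesis unfolding trace_step_def[abs_def] by (rule hfun_sum[OF one[OF \<open>v \<in> \<D>\<close>] one])
qed

text \<open>Transposing two arguments permutes the summands of \<open>trace_step\<close>.\<close>

lemma alternating_trace_step:
  assumes F: "alternating F" and ik: "\<And>\<pi>. permute_args \<pi> i = i" "\<And>\<pi>. permute_args \<pi> k = k"
  shows "alternating (trace_step i k F)"
  unfolding alternating_def
proof (intro allI ballI impI)
  fix x :: "'a slot \<Rightarrow> 'a" and a b assume ab: "a \<in> \<D>" "b \<in> \<D>" "a \<noteq> b"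
  let ?\<tau> = "Transposition.transpose a b"
  have \<tau>: "?\<tau> permutes \<D>" using ab by (intro permutes_swap_id)
  let ?x = "\<lambda>j. x (permute_args ?\<tau> j)"
  have upd: "?x(Arg v := c) = (\<lambda>j. (x(Arg (?\<tau> v) := c)) (permute_args ?\<tau> j))" for v c
  proof
    fix j
    have "permute_args ?\<tau> j = Arg (?\<tau> v) \<longleftrightarrow> j = Arg v"
      by (cases j) (simp_all add: inj_eq[OF permutes_inj[OF \<tau>]])
    then show "(?x(Arg v := c)) j = (x(Arg (?\<tau> v) := c)) (permute_args ?\<tau> j)"
      by (cases "j = Arg v") (simp_all only: fun_upd_apply if_True if_False)
  qed
  have neg: "F (\<lambda>j. y (permute_args ?\<tau> j)) = - F y" for y
    using F ab unfolding alternating_def by blast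
  have "trace_step i k F ?x = (\<Sum>v\<in>\<D>. F (?x(Arg v := x i * (x k * x (Arg (?\<tau> v))))))"
    by (simp only: trace_step_def ik permute_args_simps)
  also have "\<dots> = (\<Sum>v\<in>\<D>. - F (x(Arg (?\<tau> v) := x i * (x k * x (Arg (?\<tau> v))))))"
    by (simp only: upd neg)
  also have "\<dots> = (\<Sum>v\<in>\<D>. - F (x(Arg v := x i * (x k * x (Arg v)))))"
    by (rule sum.reindex_bij_betw[OF permutes_imp_bij[OF \<tau>], where g = "\<lambda>v. - F (x(Arg v := x i * (x k * x (Arg v))))"])
  also have "\<dots> = - trace_step i k F x" by (simp only: trace_step_def sum_negf)
  finally show "trace_step i k F ?x = - trace_step i k F x" .
qed

text \<open>At the basis itself, the summand for \<open>v\<close> is \<open>F\<close> with \<open>v\<close> replaced by a linear combination of basis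
vectors. All terms with a repeated basis vector vanish, and the coefficient of \<open>v\<close> remains: the
diagonal entry of the matrix of the multiplication.\<close>

lemma trace_step_value:
  assumes F: "alternating F" "hfun I F" and I: "Arg ` \<D> \<subseteq> I"
    and x: "\<And>v. v \<in> \<D> \<Longrightarrow> x (Arg v) = v" "x i \<in> D" "x k \<in> D"
  shows "trace_step i k F x = scaleA (trD (x i * x k)) (F x)"
proof -
  let ?z = "x i * x k"
  let ?r = "\<lambda>v. A.representation \<D> (?z * v)"
  have Dm: "a * b \<in> D" if "a \<in> D" "b \<in> D" for a b
    using subalgebra_D that by (simp add: subalgebra_def)
  have inD: "v \<in> D" if "v \<in> \<D>" for v unfolding D_def using that by (rule A.span_base)
  have summand: "F (x(Arg v := x i * (x k * x (Arg v)))) = scaleA (?r v v) (F x)" if v: "v \<in> \<D>" for v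
  proof -
    have vI: "Arg v \<in> I" using I v by blast
    have "?z * v \<in> A.span \<D>" using Dm[OF Dm[OF x(2,3)] inD[OF v]] by (simp only: D_def)
    then have "?z * v = (\<Sum>w\<in>\<D>. scaleA (?r v w) w)"
      using A.sum_representation_eq[OF independent_\<D> _ finite_\<D> subset_refl] by simp
    then have "F (x(Arg v := x i * (x k * x (Arg v)))) = F (x(Arg v := \<Sum>w\<in>\<D>. scaleA (?r v w) w))"
      by (simp only: x(1)[OF v] mult.assoc)
    also have "\<dots> = (\<Sum>w\<in>\<D>. scaleA (?r v w) (F (x(Arg v := w))))" by (rule hfun_sum_at[OF F(2) vI])
    also have "\<dots> = (\<Sum>w\<in>\<D>. if w = v then scaleA (?r v v) (F x) else 0)"
    proof (intro sum.cong refl)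
      fix w assume w: "w \<in> \<D>"
      show "scaleA (?r v w) (F (x(Arg v := w))) = (if w = v then scaleA (?r v v) (F x) else 0)"
      proof (cases "w = v")
        case True
        have "x(Arg v := v) = x" using x(1)[OF v] by (auto simp: fun_eq_iff)
        then show ?thesis unfolding True by (simp only: simp_thms if_True)
      next
        case False
        have "F (x(Arg v := w)) = 0"
          by (rule alternating_repeated[OF F(1) v w]) (use False x(1)[OF w] in auto)
        then show ?thesis using False by (simp only: if_False A.scale_zero_right)
      qed
    qed
    also have "\<dots> = scaleA (?r v v) (F x)" using v finite_\<D> by simp
    finally show ?thesis .
  qed
  have "trace_step i k F x = (\<Sum>v\<in>\<D>. scaleA (?r v v) (F x))"
    unfolding trace_step_def by (intro sum.cong refl summand)
  also have "\<dots> = scaleA (trD ?z) (F x)"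
    by (simp only: AF.regular_trace_def[OF subalgebra_D independent_\<D> D_def[symmetric]] A.scale_sum_left)
  finally show ?thesis .
qed

primrec trace_steps :: "(nat \<Rightarrow> nat) \<Rightarrow> (('a slot \<Rightarrow> 'a) \<Rightarrow> 'a) \<Rightarrow> nat \<Rightarrow> ('a slot \<Rightarrow> 'a) \<Rightarrow> 'a" where
  "trace_steps \<sigma> F 0 = F"
| "trace_steps \<sigma> F (Suc j) = trace_step (Pair1 j) (Pair2 (\<sigma> j)) (trace_steps \<sigma> F j)"

lemma trace_steps_properties:
  assumes F: "hfun I F" "alternating F" and I: "Arg ` \<D> \<subseteq> I" "\<And>j. Pair1 j \<notin> I" "\<And>j. Pair2 j \<notin> I"
    and "\<D> \<noteq> {}" and \<sigma>: "inj \<sigma>"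
  shows "hfun (I \<union> Pair1 ` {..<m} \<union> Pair2 ` \<sigma> ` {..<m}) (trace_steps \<sigma> F m) \<and> alternating (trace_steps \<sigma> F m)"
proof (induction m)
  case 0
  then show ?case using F by simp
next
  case (Suc m)
  let ?I = "I \<union> Pair1 ` {..<m} \<union> Pair2 ` \<sigma> ` {..<m}"
  have "hfun (?I \<union> {Pair1 m, Pair2 (\<sigma> m)}) (trace_step (Pair1 m) (Pair2 (\<sigma> m)) (trace_steps \<sigma> F m))"
    using Suc I \<sigma> \<open>\<D> \<noteq> {}\<close> by (intro hfun_trace_step) (auto dest: injD)
  moreover have "?I \<union> {Pair1 m, Pair2 (\<sigma> m)} = I \<union> Pair1 ` {..<Suc m} \<union> Pair2 ` \<sigma> ` {..<Suc m}"
    by (auto simp: lessThan_Suc)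
  ultimately show ?case using Suc alternating_trace_step[of "trace_steps \<sigma> F m" "Pair1 m" "Pair2 (\<sigma> m)"] by simp
qed

lemma trace_steps_value:
  assumes F: "hfun I F" "alternating F" and I: "Arg ` \<D> \<subseteq> I" "\<And>j. Pair1 j \<notin> I" "\<And>j. Pair2 j \<notin> I"
    and "\<D> \<noteq> {}" and \<sigma>: "inj \<sigma>"
    and x: "\<And>v. v \<in> \<D> \<Longrightarrow> x (Arg v) = v" "\<And>j. j < m \<Longrightarrow> x (Pair1 j) \<in> D" "\<And>j. j < m \<Longrightarrow> x (Pair2 (\<sigma> j)) \<in> D"
  shows "trace_steps \<sigma> F m x = scaleA (\<Prod>j<m. trD (x (Pair1 j) * x (Pair2 (\<sigma> j)))) (F x)"
  using x(2,3)
proof (induction m)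
  case (Suc m)
  note p = trace_steps_properties[OF F I \<open>\<D> \<noteq> {}\<close> \<sigma>, of m]
  have "trace_steps \<sigma> F (Suc m) x = scaleA (trD (x (Pair1 m) * x (Pair2 (\<sigma> m)))) (trace_steps \<sigma> F m x)"
    unfolding trace_steps.simps
    by (rule trace_step_value[OF conjunct2[OF p] conjunct1[OF p]]) (use I(1) x(1) Suc.prems in auto)
  then show ?case using Suc by (simp add: mult.commute)
qed simp

text \<open>The given product, with the arguments in \<open>vs k\<close> inserted right after its \<open>k\<close>-th factor.\<close>

definition word_slots :: "nat \<Rightarrow> (nat \<Rightarrow> 'a list) \<Rightarrow> 'a slot list" where
  "word_slots N vs = concat (map (\<lambda>k. Letter k # map Arg (vs k)) [0..<N])"

lemma hfun_word:
  assumes "N > 0" and vs: "\<And>k. k < N \<Longrightarrow> distinct (vs k)" "\<And>k l. k < N \<Longrightarrow> l < N \<Longrightarrow> k \<noteq> l \<Longrightarrow> set (vs k) \<inter> set (vs l) = {}"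
    and "\<D> = (\<Union>k<N. set (vs k))"
  shows "hfun (Letter ` {..<N} \<union> Arg ` \<D>) (\<lambda>x. prod_nonempty (map x (word_slots N vs)))"
proof -
  let ?w = "word_slots N vs"
  have dist: "distinct (concat (map (\<lambda>k. Letter k # map Arg (vs k)) [0..<M]))" if "M \<le> N" for M
    using that
  proof (induction M)
    case (Suc M)
    have "distinct (map Arg (vs M))" using vs(1)[of M] Suc.prems by (simp add: distinct_map inj_on_def)
    moreover have "v \<notin> set (vs M)" if "k < M" "v \<in> set (vs k)" for k v
      using vs(2)[of k M] that Suc.prems by auto
    ultimately show ?case using Suc by auto
  qed simp
  have st: "set ?w = Letter ` {..<N} \<union> Arg ` \<D>" unfolding assms(4) word_slots_def by force
  then have "?w \<noteq> []" using \<open>N > 0\<close> by auto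
  then have "hfun (snd ` set (map (\<lambda>j. (1 :: 'h, j)) ?w))
      (\<lambda>x. prod_nonempty (map (\<lambda>(h, i). act h (x i)) (map (\<lambda>j. (1, j)) ?w)))"
    using dist[of N] by (intro hfun_monomial) (simp_all add: comp_def word_slots_def)
  moreover have "snd ` set (map (\<lambda>j. (1 :: 'h, j)) ?w) = set ?w" by (simp add: image_image)
  moreover have "map (\<lambda>(h, i). act h (x i)) (map (\<lambda>j. (1, j)) ?w) = map x ?w" for x by (simp add: act_one)
  ultimately show ?thesis by (simp only: st)
qed

definition fill :: "'a list \<Rightarrow> ('a \<Rightarrow> 'a) \<Rightarrow> 'a slot \<Rightarrow> 'a" where
  "fill us \<xi> j = (case j of Letter k \<Rightarrow> us ! k | Arg v \<Rightarrow> \<xi> v | _ \<Rightarrow> 0)"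

lemma fill_simps [simp]: "fill us \<xi> (Letter k) = us ! k" "fill us \<xi> (Arg v) = \<xi> v"
  by (simp_all add: fill_def)

lemma fill_update: "fill us (\<xi>(v := c)) = (fill us \<xi>)(Arg v := c)"
proof
  fix j show "fill us (\<xi>(v := c)) j = ((fill us \<xi>)(Arg v := c)) j"
    by (cases j) (simp_all add: fill_def)
qed

text \<open>The alternation of \<open>W\<close> at the basis of \<open>D\<close> after the maps \<open>\<psi> v\<close> have been applied to the arguments,
with the factors \<open>us\<close> substituted for the letters. It is linear in each of the maps.\<close>

definition alternated_sum :: "(('a slot \<Rightarrow> 'a) \<Rightarrow> 'a) \<Rightarrow> 'a list \<Rightarrow> ('a \<Rightarrow> 'a \<Rightarrow> 'a) \<Rightarrow> 'a" where
  "alternated_sum W us \<psi> =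
     (\<Sum>\<pi> | \<pi> permutes \<D>. scaleA (of_int (sign \<pi>)) (W (fill us (\<lambda>v. \<psi> v (\<pi> v)))))"

lemma fill_fun_update: "fill us (\<lambda>w. (\<psi>(v := \<chi>)) w (\<pi> w)) = (fill us (\<lambda>w. \<psi> w (\<pi> w)))(Arg v := \<chi> (\<pi> v))"
proof -
  have "(\<lambda>w. (\<psi>(v := \<chi>)) w (\<pi> w)) = (\<lambda>w. \<psi> w (\<pi> w))(v := \<chi> (\<pi> v))" by (simp add: fun_eq_iff)
  then show ?thesis by (simp only: fill_update)
qed

lemma alternated_sum_add:
  assumes "hfun I W" "Arg v \<in> I"
  shows "alternated_sum W us (\<psi>(v := \<lambda>x. \<chi> x + \<chi>' x)) =
    alternated_sum W us (\<psi>(v := \<chi>)) + alternated_sum W us (\<psi>(v := \<chi>'))"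
  by (simp only: alternated_sum_def fill_fun_update hfun_add_at[OF assms] A.scale_right_distrib sum.distrib)

lemma alternated_sum_scale:
  assumes "hfun I W" "Arg v \<in> I"
  shows "alternated_sum W us (\<psi>(v := \<lambda>x. scaleA c (\<chi> x))) = scaleA c (alternated_sum W us (\<psi>(v := \<chi>)))"
  by (simp only: alternated_sum_def fill_fun_update hfun_scale_at[OF assms] A.scale_sum_right A.scale_scale mult.commute)

text \<open>A multiplier is a sum of maps \<open>x \<mapsto> b (h x) c\<close>, and the alternated sum is linear in each of its
multipliers; so one such summand can be chosen for each argument without losing nonvanishing. This
choice is needed since the coefficients \<open>b\<close> and \<open>c\<close> are going to be variables of one polynomial.\<close>

lemma alternated_sum_monomial_multipliers:
  assumes W: "hfun I W" "\<And>v. Arg v \<in> I \<longleftrightarrow> v \<in> \<D>"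
    and \<phi>: "\<And>v. v \<in> \<D> \<Longrightarrow> multiplier (V v) (\<phi> v)" "alternated_sum W us \<phi> \<noteq> 0"
  shows "\<exists>b h c. alternated_sum W us (\<lambda>v x. b v * (act (h v) x * c v)) \<noteq> 0"
proof -
  have "\<exists>\<psi>. (\<forall>v\<in>K. \<exists>b h c. \<psi> v = (\<lambda>x. b * (act h x * c))) \<and> (\<forall>v. v \<notin> K \<longrightarrow> \<psi> v = \<phi> v) \<and>
      alternated_sum W us \<psi> \<noteq> 0" if "finite K" "K \<subseteq> \<D>" for K
    using that
  proof (induction K rule: finite_induct)
    case empty
    then show ?case using \<phi>(2) by (intro exI[of _ \<phi>]) simp
  next
    case (insert v K)
    then obtain \<psi> where \<psi>: "\<forall>v\<in>K. \<exists>b h c. \<psi> v = (\<lambda>x. b * (act h x * c))" "\<forall>v. v \<notin> K \<longrightarrow> \<psi> v = \<phi> v"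
      "alternated_sum W us \<psi> \<noteq> 0" by blast
    have v: "v \<in> \<D>" "Arg v \<in> I" using insert.prems W(2) by auto
    have "\<exists>b h c. alternated_sum W us (\<psi>(v := \<lambda>x. b * (act h x * c))) \<noteq> 0"
    proof (rule ccontr)
      assume "\<not> ?thesis"
      then have zero: "alternated_sum W us (\<psi>(v := \<lambda>x. b * (act h x * c))) = 0" for b h c by blast
      have "alternated_sum W us (\<psi>(v := \<chi>)) = 0" if "multiplier (V v) \<chi>" for \<chi>
        using that
      proof induction
        case (base b c h)
        show ?case by (rule zero)
      next
        case (add \<chi> \<chi>')
        then show ?case by (simp only: alternated_sum_add[OF W(1) v(2)] add_0_left)
      next
        case (scale \<chi> c)
        then show ?case by (simp only: alternated_sum_scale[OF W(1) v(2)] A.scale_zero_right)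
      qed
      from this[OF \<phi>(1)[OF v(1)]] have "alternated_sum W us (\<psi>(v := \<phi> v)) = 0" .
      moreover have "\<psi>(v := \<phi> v) = \<psi>" using \<psi>(2) insert.hyps(2) by (auto simp: fun_eq_iff)
      ultimately show False using \<psi>(3) by (simp only:)
    qed
    then obtain b h c where bhc: "alternated_sum W us (\<psi>(v := \<lambda>x. b * (act h x * c))) \<noteq> 0" by blast
    let ?\<psi> = "\<psi>(v := \<lambda>x. b * (act h x * c))"
    have "\<exists>b h c. ?\<psi> w = (\<lambda>x. b * (act h x * c))" if "w \<in> insert v K" for w
    proof (cases "w = v")
      case True
      then show ?thesis by (intro exI[of _ b] exI[of _ h] exI[of _ c]) simp
    next
      case False
      then have "w \<in> K" using that by blast
      then show ?thesis using \<psi>(1) False by simp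
    qed
    moreover have "\<forall>w. w \<notin> insert v K \<longrightarrow> ?\<psi> w = \<phi> w" using \<psi>(2) by simp
    ultimately show ?case using bhc by blast
  qed
  from this[OF finite_\<D> subset_refl] obtain \<psi>
    where \<psi>: "\<forall>v\<in>\<D>. \<exists>b h c. \<psi> v = (\<lambda>x. b * (act h x * c))" "alternated_sum W us \<psi> \<noteq> 0" by blast
  from bchoice[OF \<psi>(1)] obtain b where "\<forall>v\<in>\<D>. \<exists>h c. \<psi> v = (\<lambda>x. b v * (act h x * c))" by blast
  from bchoice[OF this] obtain h where "\<forall>v\<in>\<D>. \<exists>c. \<psi> v = (\<lambda>x. b v * (act (h v) x * c))" by blast
  from bchoice[OF this] obtain c where c: "\<forall>v\<in>\<D>. \<psi> v = (\<lambda>x. b v * (act (h v) x * c v))" by blast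
  have "W (fill us (\<lambda>v. \<psi> v (\<pi> v))) = W (fill us (\<lambda>v. b v * (act (h v) (\<pi> v) * c v)))" for \<pi>
  proof (rule hfun_cong[OF W(1)])
    fix j assume "j \<in> I"
    then show "fill us (\<lambda>v. \<psi> v (\<pi> v)) j = fill us (\<lambda>v. b v * (act (h v) (\<pi> v) * c v)) j"
      using W(2) c by (cases j) (auto simp: fill_def)
  qed
  then have "alternated_sum W us \<psi> = alternated_sum W us (\<lambda>v x. b v * (act (h v) x * c v))"
    by (simp only: alternated_sum_def)
  then show ?thesis using \<psi>(2) by (intro exI[of _ b] exI[of _ h] exI[of _ c]) simp
qed

lemma hfun_sandwich:
  assumes W: "hfun I W" "\<And>v. Arg v \<in> I \<longleftrightarrow> v \<in> \<D>" "\<And>v. LCoef v \<notin> I" "\<And>v. RCoef v \<notin> I"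
    and "finite K" "K \<subseteq> \<D>"
  shows "hfun (I \<union> LCoef ` K \<union> RCoef ` K)
    (\<lambda>x. W (\<lambda>j. case j of Arg v \<Rightarrow> if v \<in> K then x (LCoef v) * (act (h v) (x (Arg v)) * x (RCoef v)) else x j
      | _ \<Rightarrow> x j))" (is "hfun (?I K) (?f K)")
  using assms(5,6)
proof (induction K rule: finite_induct)
  case empty
  have "(\<lambda>j. case j of Arg v \<Rightarrow> if v \<in> {} then x (LCoef v) * (act (h v) (x (Arg v)) * x (RCoef v)) else x j
      | _ \<Rightarrow> x j) = x" for x :: "'a slot \<Rightarrow> 'a"
    by (simp add: fun_eq_iff split: slot.split)
  then show ?case using W(1) by simp
next
  case (insert v K)
  let ?g = "\<lambda>x. x (LCoef v) * (act (h v) (x (Arg v)) * x (RCoef v))"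
  have vI: "Arg v \<in> ?I K" using insert.prems W(2) by simp
  have "hfun ({LCoef v} \<union> ({Arg v} \<union> {RCoef v})) ?g"
    by (intro hfun.mult hfun_proj hfun.var) auto
  then have "hfun (?I K - {Arg v} \<union> ({LCoef v} \<union> ({Arg v} \<union> {RCoef v}))) (\<lambda>x. ?f K (x(Arg v := ?g x)))"
    using insert W(3,4) by (intro hfun_subst[OF insert.IH vI]) auto
  moreover have "?I K - {Arg v} \<union> ({LCoef v} \<union> ({Arg v} \<union> {RCoef v})) = ?I (insert v K)"
    using insert.prems W(2) by auto
  moreover have "?f K (x(Arg v := ?g x)) = ?f (insert v K) x" for x
  proof (rule arg_cong[where f = W], rule ext)
    fix j show "(case j of Arg w \<Rightarrow> if w \<in> K then (x(Arg v := ?g x)) (LCoef w) *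
          (act (h w) ((x(Arg v := ?g x)) (Arg w)) * (x(Arg v := ?g x)) (RCoef w)) else (x(Arg v := ?g x)) j
        | _ \<Rightarrow> (x(Arg v := ?g x)) j) =
      (case j of Arg w \<Rightarrow> if w \<in> insert v K then x (LCoef w) * (act (h w) (x (Arg w)) * x (RCoef w)) else x j
        | _ \<Rightarrow> x j)"
      using insert.hyps(2) by (cases j) auto
  qed
  ultimately show ?case by (simp only:)
qed

text \<open>The variables of a function obtained from a product of \<open>N\<close> factors, before traces are introduced.\<close>

definition base_slots :: "nat \<Rightarrow> 'a slot set" where
  "base_slots N = Letter ` {..<N} \<union> Arg ` \<D> \<union> LCoef ` \<D> \<union> RCoef ` \<D>"

text \<open>Insert, behind a factor from the component of \<open>v\<close>, the map that sends \<open>v\<close> to the unit of this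
component and the other basis vectors to 0. In the alternated sum over the permutations of the basis
only the identity survives, and its summand is the given product.\<close>

lemma alternating_hfun_ex:
  assumes us: "us \<noteq> []" "prod_nonempty us \<noteq> 0" "\<And>i. i \<in> Ix \<Longrightarrow> \<exists>u\<in>set us. u \<in> Bs i"
  shows "\<exists>F z. hfun (base_slots (length us)) F \<and> alternating F \<and> (\<forall>v\<in>\<D>. z (Arg v) = v) \<and> F z \<noteq> 0"
proof -
  let ?N = "length us"
  have "\<forall>i\<in>Ix. \<exists>k. k < ?N \<and> us ! k \<in> Bs i" using us(3) by (metis in_set_conv_nth)
  from bchoice[OF this] obtain pos where pos: "\<And>i. i \<in> Ix \<Longrightarrow> pos i < ?N" "\<And>i. i \<in> Ix \<Longrightarrow> us ! pos i \<in> Bs i"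
    by blast
  have "\<exists>l. set l = {v \<in> \<D>. pos (comp_of v) = k} \<and> distinct l" for k
    using finite_\<D> by (intro finite_distinct_list) simp
  then obtain vs where vs: "\<And>k. set (vs k) = {v \<in> \<D>. pos (comp_of v) = k}" "\<And>k. distinct (vs k)"
    by metis
  define W where "W x = prod_nonempty (map x (word_slots ?N vs))" for x :: "'a slot \<Rightarrow> 'a"
  let ?I = "Letter ` {..<?N} \<union> Arg ` \<D>"
  have W: "hfun ?I W"
    unfolding W_def[abs_def]
  proof (rule hfun_word)
    show "\<D> = (\<Union>k<?N. set (vs k))" using vs(1) pos(1) comp_of by auto
  qed (use us(1) vs in auto)
  have WI: "Arg v \<in> ?I \<longleftrightarrow> v \<in> \<D>" for v by auto
  have "\<forall>v\<in>\<D>. \<exists>\<phi>. multiplier (Bs (comp_of v)) \<phi> \<and> (\<forall>w\<in>\<D>. \<phi> w = (if w = v then unit_of (comp_of v) else 0))"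
    using coordinate_multiplier_ex by blast
  from bchoice[OF this] obtain \<phi> where \<phi>: "\<And>v. v \<in> \<D> \<Longrightarrow> multiplier (Bs (comp_of v)) (\<phi> v)"
    "\<And>v w. v \<in> \<D> \<Longrightarrow> w \<in> \<D> \<Longrightarrow> \<phi> v w = (if w = v then unit_of (comp_of v) else 0)" by blast
  have Wfill: "W (fill us \<xi>) = prod_nonempty (concat (map (\<lambda>k. us ! k # map \<xi> (vs k)) [0..<?N]))" for \<xi>
    by (simp add: W_def word_slots_def map_concat comp_def)
  have main: "W (fill us (\<lambda>v. \<phi> v v)) = prod_nonempty us"
  proof -
    have "us ! k * \<phi> v v = us ! k" if "v \<in> set (vs k)" for k v
    proof -
      have v: "v \<in> \<D>" "pos (comp_of v) = k" using that vs(1) by auto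
      then have "us ! k \<in> Bs (comp_of v)" using pos(2) comp_of by blast
      then show ?thesis using unit_of(2) comp_of[OF v(1)] \<phi>(2)[OF v(1,1)] by simp
    qed
    then have "W (fill us (\<lambda>v. \<phi> v v)) = prod_nonempty (map (\<lambda>k. us ! k) [0..<?N])"
      unfolding Wfill by (intro prod_nonempty_absorb_concat) auto
    then show ?thesis by (simp add: map_nth)
  qed
  have other: "W (fill us (\<lambda>v. \<phi> v (\<pi> v))) = 0" if \<pi>: "\<pi> permutes \<D>" "\<pi> \<noteq> id" for \<pi>
  proof -
    obtain v where "\<pi> v \<noteq> v" using \<pi>(2) by (auto simp: fun_eq_iff)
    then have v: "v \<in> \<D>" "\<pi> v \<noteq> v" using \<pi>(1) unfolding permutes_def by blast+
    then have "\<phi> v (\<pi> v) = 0" using \<phi>(2)[OF v(1)] permutes_in_image[OF \<pi>(1)] by simp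
    then show ?thesis using v(1) by (intro hfun_zero_at[OF W, of "Arg v"]) auto
  qed
  have "alternated_sum W us \<phi> = (\<Sum>\<pi> | \<pi> permutes \<D>. if \<pi> = id then prod_nonempty us else 0)"
    unfolding alternated_sum_def
  proof (intro sum.cong refl)
    fix \<pi> assume "\<pi> \<in> {\<pi>. \<pi> permutes \<D>}"
    then show "scaleA (of_int (sign \<pi>)) (W (fill us (\<lambda>v. \<phi> v (\<pi> v)))) = (if \<pi> = id then prod_nonempty us else 0)"
      using main other[of \<pi>] by (cases "\<pi> = id") (simp_all add: sign_id)
  qed
  also have "\<dots> = prod_nonempty us" using finite_permutations[OF finite_\<D>] by (simp add: permutes_id)
  finally have "alternated_sum W us \<phi> \<noteq> 0" using us(2) by simp
  from alternated_sum_monomial_multipliers[OF W WI \<phi>(1) this]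
  obtain b h c where bhc: "alternated_sum W us (\<lambda>v x. b v * (act (h v) x * c v)) \<noteq> 0" by blast
  define F0 where "F0 x = W (\<lambda>j. case j of
      Arg v \<Rightarrow> if v \<in> \<D> then x (LCoef v) * (act (h v) (x (Arg v)) * x (RCoef v)) else x j | _ \<Rightarrow> x j)" for x
  have F0: "hfun (base_slots ?N) F0"
    unfolding F0_def[abs_def] base_slots_def
    by (rule hfun_sandwich[OF W WI _ _ finite_\<D> subset_refl]) auto
  define z where "z j = (case j of Letter k \<Rightarrow> us ! k | LCoef v \<Rightarrow> b v | RCoef v \<Rightarrow> c v | Arg v \<Rightarrow> v | _ \<Rightarrow> 0)" for j
  have "alternate F0 z = alternated_sum W us (\<lambda>v x. b v * (act (h v) x * c v))"
    unfolding alternate_def alternated_sum_def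
  proof (intro sum.cong refl arg_cong[where f = "scaleA _"])
    fix \<pi> assume \<pi>: "\<pi> \<in> {\<pi>. \<pi> permutes \<D>}"
    show "F0 (\<lambda>j. z (permute_args \<pi> j)) = W (fill us (\<lambda>v. b v * (act (h v) (\<pi> v) * c v)))"
      unfolding F0_def
    proof (rule hfun_cong[OF W])
      fix j assume "j \<in> ?I"
      then show "(case j of Arg v \<Rightarrow> if v \<in> \<D> then z (permute_args \<pi> (LCoef v)) *
          (act (h v) (z (permute_args \<pi> (Arg v))) * z (permute_args \<pi> (RCoef v))) else z (permute_args \<pi> j)
          | _ \<Rightarrow> z (permute_args \<pi> j)) = fill us (\<lambda>v. b v * (act (h v) (\<pi> v) * c v)) j"
        by (auto simp: z_def)
    qed
  qed
  then have "alternate F0 z \<noteq> 0" using bhc by simp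
  moreover have "hfun (base_slots ?N) (alternate F0)"
    by (rule hfun_alternate[OF F0]) (auto simp: base_slots_def)
  ultimately show ?thesis using alternating_alternate[of F0]
    by (intro exI[of _ "alternate F0"] exI[of _ z]) (simp add: z_def)
qed

text \<open>Besides the \<open>2 m\<close> variables that enter through traces there are the factors of the product and three
variables for each basis vector.\<close>

theorem H_codimension_lower_bound:
  assumes \<Gamma>: "\<not> module.dependent scaleH \<Gamma>" "module.span scaleH \<Gamma> = UNIV" "finite \<Gamma>"
    and us: "us \<noteq> []" "prod_nonempty us \<noteq> 0" "\<And>i. i \<in> Ix \<Longrightarrow> \<exists>u\<in>set us. u \<in> Bs i" and ne: "\<D> \<noteq> {}"
  shows "real (card \<D>) ^ (2 * m) \<le>
    real (H_codimension scaleH scaleA act \<Gamma> (length us + 3 * card \<D> + 2 * m)) * real (Suc m) ^ ((card \<D>)\<^sup>2)"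
proof -
  let ?base = "base_slots (length us)"
  obtain F z where F: "hfun ?base F" "alternating F" "\<forall>v\<in>\<D>. z (Arg v) = v" "F z \<noteq> 0"
    using alternating_hfun_ex[OF us] by blast
  obtain \<delta> where \<delta>: "\<And>v. v \<in> \<D> \<Longrightarrow> \<delta> v \<in> D" "\<And>u v. u \<in> \<D> \<Longrightarrow> v \<in> \<D> \<Longrightarrow> trD (u * \<delta> v) = (if u = v then 1 else 0)"
    using dual_basis_ex by blast
  let ?W = "PiE {..<m} (\<lambda>_. \<D>)"
  obtain P where P: "P \<subseteq> {s. s permutes {..<m}}"
    and rank: "real (card \<D>) ^ (2 * m) \<le> real (card P) * real (Suc m) ^ ((card \<D>)\<^sup>2)"
    and indep: "\<And>c :: _ \<Rightarrow> 'f. \<forall>u\<in>?W. \<forall>v\<in>?W. (\<Sum>s\<in>P. if \<forall>i<m. u i = v (s i) then c s else 0) = 0 \<Longrightarrow> \<forall>s\<in>P. c s = 0"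
    using permutation_matrices_rank[OF finite_\<D>, of m] by blast
  have finP: "finite P" using P finite_permutations[of "{..<m}"] finite_subset by blast
  have I0: "Arg ` \<D> \<subseteq> ?base" "\<And>j. Pair1 j \<notin> ?base" "\<And>j. Pair2 j \<notin> ?base" by (auto simp: base_slots_def)
  let ?I = "?base \<union> Pair1 ` {..<m} \<union> Pair2 ` {..<m}"
  have fin: "finite ?I" using finite_\<D> by (simp add: base_slots_def)
  have card0: "card ?base = length us + 3 * card \<D>"
  proof -
    let ?A = "Letter ` {..<length us} :: 'a slot set"
    have "card (?A \<union> Arg ` \<D> \<union> LCoef ` \<D> \<union> RCoef ` \<D>) = card (?A \<union> Arg ` \<D> \<union> LCoef ` \<D>) + card (RCoef ` \<D>)"
      by (rule card_Un_disjoint) (use finite_\<D> in auto)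
    also have "card (?A \<union> Arg ` \<D> \<union> LCoef ` \<D>) = card (?A \<union> Arg ` \<D>) + card (LCoef ` \<D>)"
      by (rule card_Un_disjoint) (use finite_\<D> in auto)
    also have "card (?A \<union> Arg ` \<D>) = card ?A + card (Arg ` \<D>)"
      by (rule card_Un_disjoint) (use finite_\<D> in auto)
    finally show ?thesis by (simp add: base_slots_def card_image inj_on_def)
  qed
  have cardI: "card ?I = length us + 3 * card \<D> + 2 * m"
  proof -
    have f0: "finite ?base" using fin by simp
    have "card ?I = card (?base \<union> Pair1 ` {..<m}) + card (Pair2 ` {..<m} :: 'a slot set)"
      by (rule card_Un_disjoint) (use f0 I0(3) in auto)
    also have "card (?base \<union> Pair1 ` {..<m}) = card ?base + card (Pair1 ` {..<m} :: 'a slot set)"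
      by (rule card_Un_disjoint) (use f0 I0(2) in auto)
    finally show ?thesis by (simp add: card0 card_image inj_on_def)
  qed
  define n where "n = length us + 3 * card \<D> + 2 * m"
  obtain \<rho> where \<rho>: "bij_betw \<rho> ?I {1..n}"
    using finite_same_card_bij[OF fin, of "{1..n}"] cardI by (auto simp: n_def)
  define f where "f s a = trace_steps s F m (\<lambda>j. a (\<rho> j))" for s and a :: "nat \<Rightarrow> 'a"
  have s_inj: "inj s" and s_img: "s ` {..<m} = {..<m}" if "s \<in> P" for s
    using P that permutes_inj permutes_image by blast+
  have "card P \<le> H_codimension scaleH scaleA act \<Gamma> n"
  proof (rule H_codimension_ge_card[OF \<Gamma> _ finP])
    show "n \<ge> 1" using us(1) by (cases us) (simp_all add: n_def)
    fix s assume s: "s \<in> P"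
    have "hfun ?I (trace_steps s F m)"
      using trace_steps_properties[OF F(1,2) I0 ne s_inj[OF s], of m] by (simp only: s_img[OF s])
    from hfun_relabel[OF this bij_betw_imp_inj_on[OF \<rho>]]
    show "hfun {1..n} (f s)" unfolding f_def[abs_def] by (simp only: bij_betw_imp_surj_on[OF \<rho>])
  next
    fix c assume c: "\<forall>a. (\<Sum>s\<in>P. scaleA (c s) (f s a)) = 0"
    show "\<forall>s\<in>P. c s = 0"
    proof (rule indep, intro ballI)
      fix u v assume uv: "u \<in> ?W" "v \<in> ?W"
      define x where "x j = (case j of Pair1 i \<Rightarrow> u i | Pair2 i \<Rightarrow> \<delta> (v i) | _ \<Rightarrow> z j)" for j
      define a where "a k = x (inv_into ?I \<rho> k)" for k
      have uD: "u i \<in> \<D>" "v i \<in> \<D>" if "i < m" for i using uv that by auto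
      have uD': "u i \<in> D" if "i < m" for i unfolding D_def by (rule A.span_base[OF uD(1)[OF that]])
      have Fx: "F x = F z"
        by (rule hfun_cong[OF F(1)]) (auto simp: base_slots_def x_def)
      have fs: "f s a = scaleA (if \<forall>i<m. u i = v (s i) then 1 else 0) (F z)" if s: "s \<in> P" for s
      proof -
        have hf: "hfun ?I (trace_steps s F m)"
          using trace_steps_properties[OF F(1,2) I0 ne s_inj[OF s], of m] by (simp only: s_img[OF s])
        have sl: "s i < m" if "i < m" for i using s_img[OF s] that by blast
        have "f s a = trace_steps s F m x"
          unfolding f_def by (rule hfun_cong[OF hf]) (simp add: a_def inv_into_f_f[OF bij_betw_imp_inj_on[OF \<rho>]])
        also have "\<dots> = scaleA (\<Prod>i<m. trD (x (Pair1 i) * x (Pair2 (s i)))) (F x)"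
          by (rule trace_steps_value[OF F(1,2) I0 ne s_inj[OF s]])
            (use F(3) uD' sl \<delta>(1) uD in \<open>auto simp: x_def\<close>)
        also have "(\<Prod>i<m. trD (x (Pair1 i) * x (Pair2 (s i)))) = (\<Prod>i<m. if u i = v (s i) then 1 else 0)"
          by (intro prod.cong refl) (simp add: x_def \<delta>(2) uD sl)
        also have "\<dots> = (if \<forall>i<m. u i = v (s i) then 1 else 0 :: 'f)"
        proof (cases "\<forall>i<m. u i = v (s i)")
          case False
          then obtain i where "i < m" "u i \<noteq> v (s i)" by blast
          then have "(\<Prod>i<m. if u i = v (s i) then 1 else 0 :: 'f) = 0" by (intro prod_zero) auto
          then show ?thesis using False by simp
        qed simp
        finally show ?thesis by (simp only: Fx)
      qed
      have "0 = (\<Sum>s\<in>P. scaleA (c s) (f s a))" using c by simp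
      also have "\<dots> = (\<Sum>s\<in>P. scaleA (if \<forall>i<m. u i = v (s i) then c s else 0) (F z))"
        by (intro sum.cong refl) (auto simp: fs)
      also have "\<dots> = scaleA (\<Sum>s\<in>P. if \<forall>i<m. u i = v (s i) then c s else 0) (F z)"
        by (rule A.scale_sum_left[symmetric])
      finally show "(\<Sum>s\<in>P. if \<forall>i<m. u i = v (s i) then c s else 0) = 0" using F(4) by simp
    qed
  qed
  then have "real (card P) * real (Suc m) ^ ((card \<D>)\<^sup>2) \<le>
      real (H_codimension scaleH scaleA act \<Gamma> n) * real (Suc m) ^ ((card \<D>)\<^sup>2)"
    by (intro mult_right_mono) simp_all
  then show ?thesis using rank unfolding n_def by linarith
qed

end

section \<open>The exponent and the two bounds\<close>

text \<open>Lengthening the product by a unit changes the parity of the number of variables in the lower bound,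
which is \<open>N + 2 m\<close> for a given product.\<close>

lemma prod_nonempty_insert_unit:
  assumes "u * e = u"
  shows "prod_nonempty (xs @ u # e # ys) = prod_nonempty (xs @ u # ys)"
proof -
  have *: "prod_nonempty (u # e # ys) = prod_nonempty (u # ys)"
  proof (cases "ys = []")
    case False
    then have "prod_nonempty (u # e # ys) = (u * e) * prod_nonempty ys"
      by (simp add: prod_nonempty_Cons mult.assoc)
    then show ?thesis using assms False by (simp add: prod_nonempty_Cons)
  qed (simp add: assms)
  show ?thesis
    by (cases "xs = []") (simp_all add: * prod_nonempty_append del: prod_nonempty.simps)
qed

context fd_hopf_module_algebra
begin

abbreviation "word_value xs x \<equiv> prod_nonempty (map (\<lambda>(h, i). act h (x i)) xs)"

lemma hfun_in_span_words:
  assumes "hfun I f"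
  shows "f x \<in> A.span {word_value xs x | xs. xs \<noteq> [] \<and> distinct (map snd xs) \<and> snd ` set xs = I}"
    (is "_ \<in> A.span (?W I)")
  using assms
proof induction
  case (var i h)
  show ?case by (intro A.span_base CollectI exI[of _ "[(h, i)]"]) simp
next
  case (mult I f K g)
  have one: "word_value xs x * b \<in> A.span (?W (I \<union> K))"
    if xs: "xs \<noteq> []" "distinct (map snd xs)" "snd ` set xs = I" and b: "b \<in> A.span (?W K)" for xs b
    using b
  proof (induction rule: A.span_induct)
    case base
    show ?case
      by (simp add: A.subspace_def A.span_zero A.span_add A.span_scale distrib_left A.scale_mult_right[symmetric])
  next
    case (step b)
    then obtain ys where ys: "b = word_value ys x" "ys \<noteq> []" "distinct (map snd ys)" "snd ` set ys = K" by blast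
    have "word_value xs x * b = word_value (xs @ ys) x"
      using xs(1) ys(1,2) by (simp add: prod_nonempty_append)
    moreover have "snd ` set (xs @ ys) = I \<union> K" "distinct (map snd (xs @ ys))"
      using xs ys mult.hyps(3) by (auto simp: image_Un)
    ultimately show ?case using xs(1) by (intro A.span_base CollectI exI[of _ "xs @ ys"]) simp
  qed
  have "a * g x \<in> A.span (?W (I \<union> K))" if "a \<in> A.span (?W I)" for a
    using that
  proof (induction rule: A.span_induct)
    case base
    show ?case
      by (simp add: A.subspace_def A.span_zero A.span_add A.span_scale distrib_right A.scale_mult_left[symmetric])
  next
    case (step a)
    then show ?case using one mult.IH(2) by blast
  qed
  then show ?case using mult.IH(1) by blast
next
  case (add I f g)
  then show ?case by (simp add: A.span_add)
next
  case (scale I f c)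
  then show ?case by (simp add: A.span_scale)
qed

lemma hfun_nonzero_word:
  assumes "hfun I f" "f x \<noteq> 0"
  shows "\<exists>xs. xs \<noteq> [] \<and> distinct (map snd xs) \<and> snd ` set xs = I \<and> word_value xs x \<noteq> 0"
proof (rule ccontr)
  assume "\<not> ?thesis"
  then have "{word_value xs x | xs. xs \<noteq> [] \<and> distinct (map snd xs) \<and> snd ` set xs = I} \<subseteq> {0}" by blast
  then have "A.span {word_value xs x | xs. xs \<noteq> [] \<and> distinct (map snd xs) \<and> snd ` set xs = I} \<subseteq> A.span {0}"
    by (rule A.span_mono)
  then show False using hfun_in_span_words[OF assms(1), of x] assms(2) by auto
qed

text \<open>Expand the arguments in the spanning set one after the other.\<close>

lemma hfun_zero_if_zero_on_spanning:
  assumes f: "hfun I f" and \<B>: "A.span \<B> = UNIV"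
    and zero: "\<And>x. (\<And>i. i \<in> I \<Longrightarrow> x i \<in> \<B>) \<Longrightarrow> f x = 0"
  shows "f x = 0"
proof -
  have "f x = 0" if "finite K" "K \<subseteq> I" "\<And>i. i \<in> I - K \<Longrightarrow> x i \<in> \<B>" for K x
    using that
  proof (induction K arbitrary: x rule: finite_induct)
    case empty
    then show ?case by (intro zero) blast
  next
    case (insert k K)
    have kI: "k \<in> I" using insert.prems(1) by blast
    have "x k \<in> A.span \<B>" using \<B> by simp
    then have "f (x(k := x k)) = 0"
    proof (induction rule: A.span_induct)
      case base
      have "f (x(k := 0)) = 0" by (rule hfun_zero_at[OF f kI]) simp
      then show ?case unfolding A.subspace_def mem_Collect_eq
        by (simp only: hfun_add_at[OF f kI] hfun_scale_at[OF f kI]) simp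
    next
      case (step b)
      show ?case by (rule insert.IH) (use insert.prems step in auto)
    qed
    then show ?case by simp
  qed
  from this[of I x] show ?thesis using hfun_finite[OF f] by blast
qed

lemma H_codimension_pos:
  fixes xs :: "'a list"
  assumes \<Gamma>: "\<not> module.dependent scaleH \<Gamma>" "module.span scaleH \<Gamma> = UNIV" "finite \<Gamma>" and "n \<ge> 1"
    and xs: "length xs = n" "prod_nonempty xs \<noteq> 0"
  shows "1 \<le> H_codimension scaleH scaleA act \<Gamma> n"
proof -
  let ?w = "map (\<lambda>i. (1 :: 'h, i)) [1..<Suc n]"
  have w: "?w \<noteq> []" "distinct (map snd ?w)"
    using assms(4) by (simp_all add: comp_def del: upt_Suc)
  have img: "snd ` set ?w = {1..n}" by (auto simp: image_image simp del: upt_Suc)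
  have hf: "hfun {1..n} (word_value ?w)" using hfun_monomial[OF w] unfolding img .
  have "word_value ?w (\<lambda>i. xs ! (i - 1)) = prod_nonempty xs"
  proof -
    have "map (\<lambda>(h, i). act h (xs ! (i - 1))) ?w = xs"
      by (rule nth_equalityI) (simp_all add: xs(1) act_one del: upt_Suc)
    then show ?thesis by simp
  qed
  then have nz: "word_value ?w (\<lambda>i. xs ! (i - 1)) \<noteq> 0" using xs(2) by simp
  have "\<exists>W y. hfun {1..n} W \<and> W y \<noteq> 0"
    by (intro exI[of _ "word_value ?w"] exI[of _ "\<lambda>i. xs ! (i - 1)"] conjI hf nz)
  then obtain W y where W: "hfun {1..n} W" "W y \<noteq> 0" by blast
  have "card {()} \<le> H_codimension scaleH scaleA act \<Gamma> n"
  proof (rule H_codimension_ge_card[OF \<Gamma> assms(4), where f = "\<lambda>_. W"])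
    show "hfun {1..n} W" for s :: unit by (rule W(1))
    fix c :: "unit \<Rightarrow> 'f" assume "\<forall>a. (\<Sum>s\<in>{()}. scaleA (c s) (W a)) = 0"
    then have "scaleA (c ()) (W y) = 0" by auto
    then show "\<forall>s\<in>{()}. c s = 0" using W(2) by simp
  qed simp
  then show ?thesis by simp
qed

end

lemma (in H_simple_sum) H_simple_sum_subset:
  assumes "T \<subseteq> Ix"
  shows "H_simple_sum scaleH \<Delta> \<epsilon> S scaleA act Basis T Bs \<beta>"
proof (unfold_locales)
  show "finite T" using assms finite_Ix finite_subset by blast
  fix f i assume f: "\<And>i. i \<in> T \<Longrightarrow> f i \<in> Bs i" "(\<Sum>i\<in>T. f i) = 0" "i \<in> T"
  let ?f = "\<lambda>i. if i \<in> T then f i else 0"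
  have "(\<Sum>i\<in>Ix. ?f i) = (\<Sum>i\<in>T. f i)"
    using assms finite_Ix by (simp add: sum.If_cases Int_absorb1)
  then have "(\<Sum>i\<in>Ix. ?f i) = 0" using f(2) by simp
  moreover have "?f i \<in> Bs i" if "i \<in> Ix" for i
    using f(1) A.subspace_0[OF Bs_subspace[OF that]] by simp
  moreover have "i \<in> Ix" using assms f(3) by blast
  ultimately have "?f i = 0" by (intro Bs_direct[of ?f i])
  then show "f i = 0" using f(3) by simp
next
  fix i j x y assume "i \<in> T" "j \<in> T" "i \<noteq> j" "x \<in> Bs i" "y \<in> Bs j"
  then show "x * y = 0" using assms by (intro Bs_orth[of i j x y]) auto
next
  fix i U assume i: "i \<in> T" and U: "two_sided_ideal scaleA (Bs i) U" "invariant act U"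
  have "i \<in> Ix" using assms i by blast
  then show "U = {0} \<or> U = Bs i" using U by (rule Bs_simple)
next
  fix i assume "i \<in> T"
  then have i: "i \<in> Ix" using assms by blast
  show "A.independent (\<beta> i)" "A.span (\<beta> i) = Bs i" using \<beta>[OF i] .
qed (use assms in \<open>auto intro: Bs_subspace Bs_mult Bs_act Bs_semisimple\<close>)

text \<open>An algebra that is the sum of its radical and of H-simple components, described by a spanning set
adapted to this decomposition, on which the values of multilinear functions are going to be tested.\<close>

locale H_wedderburn = H_simple_sum scaleH \<Delta> \<epsilon> S scaleA act Basis Ix Bs \<beta>
  for scaleH :: "'f::{alg_closed_field, field_char_0} \<Rightarrow> 'h::ring_1 \<Rightarrow> 'h"
    and \<Delta> :: "'h \<Rightarrow> ('h \<times> 'h \<Rightarrow>\<^sub>0 'f)" and \<epsilon> :: "'h \<Rightarrow> 'f" and S :: "'h \<Rightarrow> 'h"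
    and scaleA :: "'f \<Rightarrow> 'a::ring \<Rightarrow> 'a" and act :: "'h \<Rightarrow> 'a \<Rightarrow> 'a" and Basis :: "'a set"
    and Ix :: "'i set" and Bs :: "'i \<Rightarrow> 'a set" and \<beta> :: "'i \<Rightarrow> 'a set" +
  fixes \<beta>J :: "'a set"
  assumes J_act: "x \<in> jacobson_radical scaleA UNIV \<Longrightarrow> act h x \<in> jacobson_radical scaleA UNIV"
    and \<beta>J: "finite \<beta>J" "\<beta>J \<subseteq> jacobson_radical scaleA UNIV"
    and spanning: "A.span ((\<Union>i\<in>Ix. \<beta> i) \<union> \<beta>J) = UNIV"
begin

abbreviation "J \<equiv> jacobson_radical scaleA UNIV"

definition "nilpotency_index = (SOME p. p \<ge> 1 \<and> (\<forall>xs. p \<le> length (filter (\<lambda>x. x \<in> J) xs) \<longrightarrow> prod_nonempty xs = 0))"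

lemma nilpotency_index: "nilpotency_index \<ge> 1"
  "nilpotency_index \<le> length (filter (\<lambda>x. x \<in> J) xs) \<Longrightarrow> prod_nonempty xs = 0"
  using someI_ex[OF AF.words_with_many_radical_letters_vanish] unfolding nilpotency_index_def by blast+

text \<open>The factors of the product may be arbitrary elements of the algebra; factors from the radical
connect the components, which annihilate each other.\<close>

definition linked :: "'i set \<Rightarrow> bool" where
  "linked T \<longleftrightarrow> T \<subseteq> Ix \<and> (\<exists>us. us \<noteq> [] \<and> prod_nonempty us \<noteq> 0 \<and> (\<forall>i\<in>T. \<exists>u\<in>set us. u \<in> Bs i))"

definition exponent :: nat where
  "exponent = Max ((\<lambda>T. \<Sum>i\<in>T. A.dim (Bs i)) ` {T. linked T})"

lemma finite_linked: "finite {T. linked T}"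
  by (rule finite_subset[of _ "Pow Ix"]) (auto simp: linked_def finite_Ix)

lemma dim_le_exponent: "linked T \<Longrightarrow> (\<Sum>i\<in>T. A.dim (Bs i)) \<le> exponent"
  unfolding exponent_def using finite_linked by (intro Max_ge) auto

lemma exponent_attained:
  assumes "linked T0" shows "\<exists>T. linked T \<and> (\<Sum>i\<in>T. A.dim (Bs i)) = exponent"
proof -
  have "exponent \<in> (\<lambda>T. \<Sum>i\<in>T. A.dim (Bs i)) ` {T. linked T}"
    unfolding exponent_def using finite_linked assms by (intro Max_in) auto
  then obtain T where T: "exponent = (\<Sum>i\<in>T. A.dim (Bs i))" "T \<in> {T. linked T}" by (rule imageE)
  then show ?thesis by (intro exI[of _ T]) simp
qed

lemma card_\<beta>: "i \<in> Ix \<Longrightarrow> card (\<beta> i) = A.dim (Bs i)"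
  using A.dim_span_eq_card_independent[OF \<beta>(1)[of i]] \<beta>(2)[of i] by simp

abbreviation "basis_of T \<equiv> \<Union>i\<in>T. \<beta> i"

text \<open>A nonzero value is a combination of products of translates of the arguments, so one of these
products is nonzero. The components are invariant under \<open>H\<close>, hence that product witnesses that the
components of the arguments are linked.\<close>

lemma nonvanishing_basis_tuple:
  assumes f: "hfun I f" "f x \<noteq> 0" and x: "\<And>k. k \<in> I \<Longrightarrow> x k \<in> basis_of Ix \<union> \<beta>J"
  shows "\<exists>T. linked T \<and> (\<forall>k\<in>I. x k \<in> basis_of T \<union> \<beta>J) \<and> card {k \<in> I. x k \<in> \<beta>J} < nilpotency_index"
proof -
  obtain xs where xs: "xs \<noteq> []" "distinct (map snd xs)" "snd ` set xs = I" "word_value xs x \<noteq> 0"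
    using hfun_nonzero_word[OF f] by blast
  let ?us = "map (\<lambda>(h, i). act h (x i)) xs"
  define T where "T = {i \<in> Ix. \<exists>k\<in>I. x k \<in> \<beta> i}"
  have "\<exists>u\<in>set ?us. u \<in> Bs i" if i: "i \<in> T" for i
  proof -
    obtain k where k: "k \<in> I" "x k \<in> \<beta> i" "i \<in> Ix" using i by (auto simp: T_def)
    obtain y where y: "y \<in> set xs" "k = snd y" using k(1) xs(3) by blast
    then have "act (fst y) (x k) \<in> set ?us" by (force simp: case_prod_unfold)
    moreover have "act (fst y) (x k) \<in> Bs i" using Bs_act[OF k(3) \<beta>_in[OF k(3,2)]] .
    ultimately show ?thesis by blast
  qed
  then have "linked T" unfolding linked_def using xs(1,4) by (intro conjI exI[of _ ?us]) (auto simp: T_def)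
  moreover have "\<forall>k\<in>I. x k \<in> basis_of T \<union> \<beta>J"
  proof
    fix k assume k: "k \<in> I"
    show "x k \<in> basis_of T \<union> \<beta>J"
    proof (cases "x k \<in> \<beta>J")
      case False
      then obtain i where i: "i \<in> Ix" "x k \<in> \<beta> i" using x[OF k] by blast
      then have "i \<in> T" using k unfolding T_def by blast
      then show ?thesis using i(2) by blast
    qed simp
  qed
  moreover have "card {k \<in> I. x k \<in> \<beta>J} < nilpotency_index"
  proof (rule ccontr)
    assume "\<not> ?thesis"
    then have "nilpotency_index \<le> card {k \<in> I. x k \<in> \<beta>J}" by simp
    also have "{k \<in> I. x k \<in> \<beta>J} = snd ` set (filter (\<lambda>y. x (snd y) \<in> \<beta>J) xs)" using xs(3) by auto
    also have "card \<dots> \<le> card (set (filter (\<lambda>y. x (snd y) \<in> \<beta>J) xs))" by (intro card_image_le) simp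
    also have "\<dots> \<le> length (filter (\<lambda>y. x (snd y) \<in> \<beta>J) xs)" by (rule card_length)
    also have "\<dots> \<le> length (filter (\<lambda>y. act (fst y) (x (snd y)) \<in> J) xs)"
    proof -
      have "act (fst y) (x (snd y)) \<in> J" if "x (snd y) \<in> \<beta>J" for y using that J_act \<beta>J(2) by blast
      then show ?thesis by (induction xs) auto
    qed
    also have "\<dots> = length (filter (\<lambda>u. u \<in> J) ?us)" by (simp add: filter_map comp_def case_prod_unfold)
    finally have "word_value xs x = 0" by (rule nilpotency_index(2))
    then show False using xs(4) by simp
  qed
  ultimately show ?thesis by blast
qed

lemma exponent_pos:
  assumes "\<not> nilpotent_algebra TYPE('a)" shows "exponent \<ge> 1"
proof -
  let ?p = nilpotency_index
  obtain xs :: "'a list" where xs: "length xs = ?p" "prod_nonempty xs \<noteq> 0"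
    using assms nilpotency_index(1) unfolding nilpotent_algebra_def by blast
  let ?w = "map (\<lambda>i. (1 :: 'h, i)) [0..<?p]"
  have w: "?w \<noteq> []" "distinct (map snd ?w)" using nilpotency_index(1) by (simp_all add: comp_def)
  have img: "snd ` set ?w = {..<?p}" by (auto simp: image_image)
  have hf: "hfun {..<?p} (word_value ?w)" using hfun_monomial[OF w] unfolding img .
  have "map (\<lambda>(h, i). act h (xs ! i)) ?w = xs" by (rule nth_equalityI) (simp_all add: xs(1) act_one)
  then have nz: "word_value ?w (\<lambda>i. xs ! i) \<noteq> 0" using xs(2) by simp
  have "\<exists>W y. hfun {..<?p} W \<and> W y \<noteq> 0"
    by (intro exI[of _ "word_value ?w"] exI[of _ "\<lambda>i. xs ! i"] conjI hf nz)
  then obtain W y where W: "hfun {..<?p} W" "W y \<noteq> 0" by blast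
  have "\<exists>x. (\<forall>i\<in>{..<?p}. x i \<in> basis_of Ix \<union> \<beta>J) \<and> W x \<noteq> 0"
  proof (rule ccontr)
    assume neg: "\<not> ?thesis"
    have "W y = 0"
    proof (rule hfun_zero_if_zero_on_spanning[OF W(1) spanning])
      fix x assume "\<And>i. i \<in> {..<?p} \<Longrightarrow> x i \<in> basis_of Ix \<union> \<beta>J"
      then have "\<forall>i\<in>{..<?p}. x i \<in> basis_of Ix \<union> \<beta>J" by (rule ballI)
      then show "W x = 0" using neg by (metis (no_types, lifting))
    qed
    then show False using W(2) by simp
  qed
  then obtain x where x: "\<forall>i\<in>{..<?p}. x i \<in> basis_of Ix \<union> \<beta>J" "W x \<noteq> 0" by blast
  obtain T where T: "linked T" "\<forall>k\<in>{..<?p}. x k \<in> basis_of T \<union> \<beta>J" "card {k \<in> {..<?p}. x k \<in> \<beta>J} < ?p"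
    using nonvanishing_basis_tuple[OF W(1) x(2) bspec[OF x(1)]] by blast
  have "{k \<in> {..<?p}. x k \<in> \<beta>J} \<noteq> {..<?p}"
  proof
    assume "{k \<in> {..<?p}. x k \<in> \<beta>J} = {..<?p}"
    then show False using T(3) by simp
  qed
  then obtain k where "k < ?p" "x k \<notin> \<beta>J" by blast
  then obtain i where i: "i \<in> T" "x k \<in> \<beta> i" using T(2) by auto
  have iI: "i \<in> Ix" "T \<subseteq> Ix" using T(1) i(1) by (auto simp: linked_def)
  have "1 \<le> card (\<beta> i)" using i(2) finite_\<beta>[OF iI(1)] by (auto simp: Suc_le_eq card_gt_0_iff)
  also have "\<dots> = A.dim (Bs i)" by (rule card_\<beta>[OF iI(1)])
  also have "\<dots> \<le> (\<Sum>i\<in>T. A.dim (Bs i))"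
    using i(1) finite_subset[OF iI(2) finite_Ix] by (intro member_le_sum) auto
  also have "\<dots> \<le> exponent" by (rule dim_le_exponent[OF T(1)])
  finally show ?thesis .
qed

lemma card_small_subsets:
  assumes "n \<ge> 1"
  shows "card {Q. Q \<subseteq> {1..n} \<and> card Q < p} \<le> p * n ^ p"
proof -
  have "{Q. Q \<subseteq> {1..n} \<and> card Q < p} = (\<Union>j<p. {Q. Q \<subseteq> {1..n} \<and> card Q = j})" by auto
  then have "card {Q. Q \<subseteq> {1..n} \<and> card Q < p} \<le> (\<Sum>j<p. card {Q. Q \<subseteq> {1..n} \<and> card Q = j})"
    by (simp add: card_UN_le)
  also have "\<dots> = (\<Sum>j<p. n choose j)" by (simp add: n_subsets)
  also have "\<dots> \<le> (\<Sum>j<p. n ^ p)"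
  proof (rule sum_mono)
    fix j assume j: "j \<in> {..<p}"
    have "n choose j \<le> n ^ j" by (cases "j \<le> n") (simp_all add: binomial_le_pow binomial_eq_0)
    also have "\<dots> \<le> n ^ p" using assms j by (intro power_increasing) auto
    finally show "n choose j \<le> n ^ p" .
  qed
  finally show ?thesis by simp
qed

text \<open>The tuples to be counted are sorted by the linked set \<open>T\<close> of the components and by the set \<open>Q\<close> of the
positions of radical vectors, of which there are fewer than \<open>nilpotency_index\<close>.\<close>

theorem H_codimension_upper_bound:
  assumes \<Gamma>: "\<not> module.dependent scaleH \<Gamma>" "module.span scaleH \<Gamma> = UNIV" "finite \<Gamma>" and n: "n \<ge> 1"
    and pos: "exponent \<ge> 1"
  shows "H_codimension scaleH scaleA act \<Gamma> n \<le>
    2 ^ card Ix * (nilpotency_index * n ^ nilpotency_index) * ((Suc (card \<beta>J)) ^ nilpotency_index * exponent ^ n) * card Basis"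
proof -
  let ?p = nilpotency_index
  define Y where "Y T Q = PiE {1..n} (\<lambda>k. if k \<in> Q then \<beta>J else basis_of T)" for T Q
  define X where "X = (\<Union>T\<in>{T. linked T}. \<Union>Q\<in>{Q. Q \<subseteq> {1..n} \<and> card Q < ?p}. Y T Q)"
  have finQ: "finite {Q. Q \<subseteq> {1..n} \<and> card Q < ?p}" by simp
  have fb: "finite (basis_of T)" if "linked T" for T
    using that finite_subset[OF _ finite_Ix] finite_\<beta> by (auto simp: linked_def)
  \<comment> \<open>Taking \<open>Suc\<close> makes the bound monotone in the number of positions even if there are no radical vectors.\<close>
  have cardY: "card (Y T Q) \<le> (Suc (card \<beta>J)) ^ ?p * exponent ^ n"
    if T: "linked T" and Q: "Q \<subseteq> {1..n}" "card Q < ?p" for T Q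
  proof -
    have TI: "T \<subseteq> Ix" using T by (simp add: linked_def)
    have "card (basis_of T) \<le> (\<Sum>i\<in>T. card (\<beta> i))"
      using finite_subset[OF TI finite_Ix] by (rule card_UN_le)
    also have "\<dots> = (\<Sum>i\<in>T. A.dim (Bs i))" using TI card_\<beta> by (intro sum.cong) auto
    also have "\<dots> \<le> exponent" by (rule dim_le_exponent[OF T])
    finally have cb: "card (basis_of T) \<le> exponent" .
    have "card (Y T Q) = (\<Prod>k\<in>{1..n}. card (if k \<in> Q then \<beta>J else basis_of T))"
      by (simp add: Y_def card_PiE)
    also have "\<dots> \<le> (\<Prod>k\<in>{1..n}. (if k \<in> Q then Suc (card \<beta>J) else 1) * exponent)"
    proof (rule prod_mono)
      fix k assume "k \<in> {1..n}"
      have "Suc (card \<beta>J) * 1 \<le> Suc (card \<beta>J) * exponent" using pos by (intro mult_le_mono2)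
      then show "0 \<le> card (if k \<in> Q then \<beta>J else basis_of T) \<and> card (if k \<in> Q then \<beta>J else basis_of T)
          \<le> (if k \<in> Q then Suc (card \<beta>J) else 1) * exponent" using cb by auto
    qed
    also have "\<dots> = (\<Prod>k\<in>{1..n}. if k \<in> Q then Suc (card \<beta>J) else 1) * exponent ^ n"
      by (simp add: prod.distrib)
    also have "(\<Prod>k\<in>{1..n}. if k \<in> Q then Suc (card \<beta>J) else 1) = Suc (card \<beta>J) ^ card Q"
    proof -
      have "{1..n} \<inter> Q = Q" using Q(1) by blast
      then show ?thesis by (simp add: prod.If_cases)
    qed
    also have "\<dots> * exponent ^ n \<le> Suc (card \<beta>J) ^ ?p * exponent ^ n"
      using Q(2) by (intro mult_le_mono1 power_increasing) auto
    finally show ?thesis .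
  qed
  have "card X \<le> (\<Sum>T\<in>{T. linked T}. card (\<Union>Q\<in>{Q. Q \<subseteq> {1..n} \<and> card Q < ?p}. Y T Q))"
    unfolding X_def by (rule card_UN_le[OF finite_linked])
  also have "\<dots> \<le> (\<Sum>T\<in>{T. linked T}. \<Sum>Q\<in>{Q. Q \<subseteq> {1..n} \<and> card Q < ?p}. card (Y T Q))"
    by (intro sum_mono card_UN_le[OF finQ])
  also have "\<dots> \<le> (\<Sum>T\<in>{T. linked T}. \<Sum>Q\<in>{Q. Q \<subseteq> {1..n} \<and> card Q < ?p}. Suc (card \<beta>J) ^ ?p * exponent ^ n)"
    using cardY by (intro sum_mono) auto
  also have "\<dots> = card {T. linked T} * card {Q. Q \<subseteq> {1..n} \<and> card Q < ?p} * (Suc (card \<beta>J) ^ ?p * exponent ^ n)"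
    by simp
  also have "\<dots> \<le> 2 ^ card Ix * (?p * n ^ ?p) * (Suc (card \<beta>J) ^ ?p * exponent ^ n)"
  proof (intro mult_le_mono1 mult_le_mono card_small_subsets[OF n])
    have "card {T. linked T} \<le> card (Pow Ix)" by (intro card_mono) (auto simp: finite_Ix linked_def)
    then show "card {T. linked T} \<le> 2 ^ card Ix" by (simp add: card_Pow finite_Ix)
  qed
  finally have cardX: "card X \<le> 2 ^ card Ix * (?p * n ^ ?p) * (Suc (card \<beta>J) ^ ?p * exponent ^ n)" .
  have "H_codimension scaleH scaleA act \<Gamma> n \<le> card X * card Basis"
  proof (rule H_codimension_le_card[OF \<Gamma> n _ AF.finite_Basis AF.independent_Basis AF.span_Basis])
    have finY: "finite (Y T Q)" if "linked T" for T Q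
      unfolding Y_def using fb[OF that] \<beta>J(1) by (intro finite_PiE) simp_all
    show "finite X" unfolding X_def
      by (intro finite_UN_I[OF finite_linked] finite_UN_I[OF finQ] finY) (simp only: mem_Collect_eq)
    fix f assume f: "hfun {1..n} f" and X0: "\<forall>x\<in>X. f x = 0"
    show "\<forall>x. f x = 0"
    proof (rule allI, rule hfun_zero_if_zero_on_spanning[OF f spanning])
      fix x assume x: "\<And>i. i \<in> {1..n} \<Longrightarrow> x i \<in> basis_of Ix \<union> \<beta>J"
      show "f x = 0"
      proof (rule ccontr)
        assume nz: "f x \<noteq> 0"
        obtain T where T: "linked T" "\<forall>k\<in>{1..n}. x k \<in> basis_of T \<union> \<beta>J" "card {k \<in> {1..n}. x k \<in> \<beta>J} < ?p"
          using nonvanishing_basis_tuple[OF f nz x] by blast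
        let ?Q = "{k \<in> {1..n}. x k \<in> \<beta>J}"
        have "x k \<in> (if k \<in> ?Q then \<beta>J else basis_of T)" if "k \<in> {1..n}" for k
          using bspec[OF T(2) that] that by (cases "x k \<in> \<beta>J") simp_all
        then have "restrict x {1..n} \<in> Y T ?Q" unfolding Y_def by (simp only: restrict_PiE_iff) blast
        moreover have "?Q \<subseteq> {1..n}" by blast
        ultimately have "restrict x {1..n} \<in> X" unfolding X_def using T(1,3) by blast
        then have "f (restrict x {1..n}) = 0" using X0 by blast
        moreover have "f (restrict x {1..n}) = f x" by (rule hfun_cong[OF f]) simp
        ultimately show False using nz by simp
      qed
    qed
  qed
  also have "\<dots> \<le> 2 ^ card Ix * (?p * n ^ ?p) * (Suc (card \<beta>J) ^ ?p * exponent ^ n) * card Basis"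
    by (rule mult_le_mono1[OF cardX])
  finally show ?thesis .
qed

text \<open>For \<open>n > N\<close> the lower bound is known in the form \<open>n = N + 2 m\<close> or \<open>n = N + 1 + 2 m\<close>; replacing \<open>d\<^sup>2\<^sup>m\<close> by
\<open>d\<^sup>n\<close> costs at most a factor \<open>d\<^sup>N\<^sup>+\<^sup>1\<close>; for \<open>n \<le> N\<close> this factor makes the bound trivial, since codimensions of a
nonnilpotent algebra are positive.\<close>

theorem H_codimension_bounds:
  assumes \<Gamma>: "\<not> module.dependent scaleH \<Gamma>" "module.span scaleH \<Gamma> = UNIV" "finite \<Gamma>"
    and nonnil: "\<not> nilpotent_algebra TYPE('a)"
  shows "\<exists>C1 C2 r1 r2 :: real. \<exists>d :: nat. C1 > 0 \<and> C2 > 0 \<and> d \<ge> 1 \<and>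
    (\<forall>n\<ge>1. C1 * real n powr r1 * real d ^ n \<le> real (H_codimension scaleH scaleA act \<Gamma> n) \<and>
       real (H_codimension scaleH scaleA act \<Gamma> n) \<le> C2 * real n powr r2 * real d ^ n)"
proof -
  let ?c = "H_codimension scaleH scaleA act \<Gamma>"
  define d where "d = exponent"
  have d1: "d \<ge> 1" unfolding d_def by (rule exponent_pos[OF nonnil])
  have words: "\<exists>xs :: 'a list. length xs = n \<and> prod_nonempty xs \<noteq> 0" if "n \<ge> 1" for n
    using nonnil that unfolding nilpotent_algebra_def by blast
  have c1: "1 \<le> ?c n" if n: "n \<ge> 1" for n
  proof -
    obtain xs :: "'a list" where "length xs = n" "prod_nonempty xs \<noteq> 0" using words[OF n] by blast
    then show ?thesis by (rule H_codimension_pos[OF \<Gamma> n])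
  qed
  obtain x0 :: "'a list" where "length x0 = 1" "prod_nonempty x0 \<noteq> 0" using words[of 1] by auto
  then have "linked {}" unfolding linked_def by (intro conjI exI[of _ x0]) auto
  then obtain T where T: "linked T" "(\<Sum>i\<in>T. A.dim (Bs i)) = d" using exponent_attained d_def by blast
  then obtain us where us: "us \<noteq> []" "prod_nonempty us \<noteq> 0" "\<And>i. i \<in> T \<Longrightarrow> \<exists>u\<in>set us. u \<in> Bs i"
    and TI: "T \<subseteq> Ix" unfolding linked_def by blast
  interpret T: H_simple_sum scaleH \<Delta> \<epsilon> S scaleA act Basis T Bs \<beta> by (rule H_simple_sum_subset[OF TI])
  have cD: "card T.\<D> = d" using T.card_\<D> T(2) by simp
  have neD: "T.\<D> \<noteq> {}" using cD d1 by auto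
  then obtain i where i: "i \<in> T" unfolding T.\<D>_def by blast
  obtain u where u: "u \<in> set us" "u \<in> Bs i" using us(3)[OF i] by blast
  obtain xs ys where split: "us = xs @ u # ys" using split_list[OF u(1)] by blast
  let ?us = "xs @ u # T.unit_of i # ys"
  have ue: "u * T.unit_of i = u" using T.unit_of(2)[OF i u(2)] by blast
  have us': "?us \<noteq> []" "prod_nonempty ?us \<noteq> 0" "\<And>i. i \<in> T \<Longrightarrow> \<exists>u\<in>set ?us. u \<in> Bs i"
    using us prod_nonempty_insert_unit[OF ue, of xs ys] unfolding split by auto
  define N where "N = length us + 3 * d"
  define E where "E = d\<^sup>2"
  have low1: "real d ^ (2 * m) \<le> real (?c (N + 2 * m)) * real (Suc m) ^ E" for m
    using T.H_codimension_lower_bound[OF \<Gamma> us neD, of m] by (simp only: cD N_def E_def)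
  have low2: "real d ^ (2 * m) \<le> real (?c (Suc N + 2 * m)) * real (Suc m) ^ E" for m
  proof -
    have "length ?us + 3 * d + 2 * m = Suc N + 2 * m" by (simp add: N_def split)
    then show ?thesis using T.H_codimension_lower_bound[OF \<Gamma> us' neD, of m] by (simp only: cD E_def)
  qed
  have dr: "real d \<ge> 1" using d1 by simp
  have low: "real d ^ n \<le> real (?c n) * (real d ^ Suc N * (2 * real n) ^ E)" if n: "n \<ge> 1" for n
  proof (cases "n \<le> N")
    case True
    have "real d ^ n \<le> real d ^ Suc N" using dr True by (intro power_increasing) auto
    also have "\<dots> \<le> 1 * (real d ^ Suc N * 1)" by simp
    also have "\<dots> \<le> real (?c n) * (real d ^ Suc N * (2 * real n) ^ E)"
    proof (rule mult_mono)
      have h: "1 \<le> (2 * real n) ^ E" using n by (intro one_le_power) simp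
      then show "real d ^ Suc N * 1 \<le> real d ^ Suc N * (2 * real n) ^ E" by (intro mult_left_mono) simp_all
    qed (use c1[OF n] in simp_all)
    finally show ?thesis .
  next
    case False
    define m where "m = (n - N) div 2"
    have nm: "n = N + 2 * m \<or> n = Suc N + 2 * m" using False unfolding m_def by presburger
    then have "real d ^ (2 * m) \<le> real (?c n) * real (Suc m) ^ E" using low1[of m] low2[of m] by blast
    also have "\<dots> \<le> real (?c n) * (2 * real n) ^ E"
    proof -
      have "Suc m \<le> 2 * n" using nm n by linarith
      then have "real (Suc m) \<le> 2 * real n" by linarith
      then show ?thesis by (intro mult_left_mono power_mono) auto
    qed
    finally have b: "real d ^ (2 * m) \<le> real (?c n) * (2 * real n) ^ E" .
    have "real d ^ n \<le> real d ^ (Suc N + 2 * m)" using dr nm by (intro power_increasing) auto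
    also have "\<dots> = real d ^ Suc N * real d ^ (2 * m)" by (rule power_add)
    also have "\<dots> \<le> real d ^ Suc N * (real (?c n) * (2 * real n) ^ E)" using b by (intro mult_left_mono) auto
    finally show ?thesis by (simp only: mult_ac)
  qed
  define C1 where "C1 = 1 / (real d ^ Suc N * 2 ^ E)"
  have C1: "C1 > 0" using d1 by (simp add: C1_def)
  define K where "K = 2 ^ card Ix * nilpotency_index * Suc (card \<beta>J) ^ nilpotency_index * card Basis"
  define C2 where "C2 = real K + 1"
  have C2: "C2 > 0" by (simp add: C2_def)
  have "C1 * real n powr (- real E) * real d ^ n \<le> real (?c n) \<and>
      real (?c n) \<le> C2 * real n powr (real nilpotency_index) * real d ^ n" if n: "n \<ge> 1" for n
  proof
    have pos: "real n ^ E > 0" "real d ^ Suc N * 2 ^ E > 0" using n d1 by simp_all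
    have "C1 * real n powr (- real E) * real d ^ n = real d ^ n / (real d ^ Suc N * 2 ^ E * real n ^ E)"
      using n by (simp add: C1_def powr_minus powr_realpow field_simps)
    also have "\<dots> \<le> real (?c n)"
      unfolding pos_divide_le_eq[OF mult_pos_pos[OF pos(2,1)]]
      using low[OF n] by (simp only: power_mult_distrib mult.assoc)
    finally show "C1 * real n powr (- real E) * real d ^ n \<le> real (?c n)" .
    have "?c n \<le> K * n ^ nilpotency_index * d ^ n"
      using H_codimension_upper_bound[OF \<Gamma> n d1[unfolded d_def]] by (simp only: K_def d_def mult_ac)
    then have "real (?c n) \<le> real (K * n ^ nilpotency_index * d ^ n)" by (simp only: of_nat_le_iff)
    also have "\<dots> = real K * (real n powr (real nilpotency_index) * real d ^ n)"
      using n by (simp add: powr_realpow)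
    also have "\<dots> \<le> C2 * (real n powr (real nilpotency_index) * real d ^ n)"
      by (intro mult_right_mono) (simp_all add: C2_def)
    finally show "real (?c n) \<le> C2 * real n powr (real nilpotency_index) * real d ^ n"
      by (simp only: mult.assoc)
  qed
  note bounds = this
  show ?thesis
    by (rule exI[of _ C1], rule exI[of _ C2], rule exI[of _ "- real E"],
        rule exI[of _ "real nilpotency_index"], rule exI[of _ d], intro conjI allI impI C1 C2 d1)
      (drule bounds, erule conjunct1, drule bounds, erule conjunct2)
qed

end

theorem theorem2:
  fixes scaleH :: "'f::{alg_closed_field, field_char_0} \<Rightarrow> 'h::ring_1 \<Rightarrow> 'h"
    and \<Delta> :: "'h \<Rightarrow> ('h \<times> 'h \<Rightarrow>\<^sub>0 'f)"
    and \<epsilon> :: "'h \<Rightarrow> 'f"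
    and S :: "'h \<Rightarrow> 'h"
    and scaleA :: "'f \<Rightarrow> 'a::ring \<Rightarrow> 'a"
    and act :: "'h \<Rightarrow> 'a \<Rightarrow> 'a"
    and \<Gamma> :: "'h set"
    and B J :: "'a set"
    and q :: nat
    and Bs :: "nat \<Rightarrow> 'a set"
  assumes "hopf_module_algebra scaleH \<Delta> \<epsilon> S scaleA act"
    and "finite_dim scaleH"
    and "finite_dim scaleA"
    and "\<not> nilpotent_algebra TYPE('a)"
    and "\<not> module.dependent scaleH \<Gamma>" and "module.span scaleH \<Gamma> = UNIV"
    and "J = jacobson_radical scaleA UNIV"
    and "invariant act J"
    and "subalgebra scaleA B"
    and "invariant act B"
    and "{b + j | b j. b \<in> B \<and> j \<in> J} = UNIV" and "B \<inter> J = {0}"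
    and "direct_sum {1..q} Bs B"
    and "\<forall>i\<in>{1..q}. two_sided_ideal scaleA B (Bs i) \<and> invariant act (Bs i) \<and>
           H_simple scaleA act (Bs i) \<and> semisimple_algebra scaleA (Bs i)"
  shows "\<exists>C1 C2 r1 r2 :: real. \<exists>d :: nat. C1 > 0 \<and> C2 > 0 \<and> d \<ge> 1 \<and>
    (\<forall>n\<ge>1. C1 * real n powr r1 * real d ^ n \<le> real (H_codimension scaleH scaleA act \<Gamma> n) \<and>
       real (H_codimension scaleH scaleA act \<Gamma> n) \<le> C2 * real n powr r2 * real d ^ n)"
proof -
  interpret hopf_module_algebra scaleH \<Delta> \<epsilon> S scaleA act by fact
  obtain F where F: "finite F" "A.span F = UNIV" using assms(3) unfolding finite_dim_def by blast
  obtain Basis where Basis: "Basis \<subseteq> UNIV" "A.independent Basis" "UNIV \<subseteq> A.span Basis"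
    by (rule A.maximal_independent_subset)
  have "finite Basis" using A.independent_span_bound[OF F(1) Basis(2)] F(2) by simp
  then interpret fd_hopf_module_algebra scaleH \<Delta> \<epsilon> S scaleA act Basis
    by unfold_locales (use Basis in auto)
  obtain FH where FH: "finite FH" "H.span FH = UNIV" using assms(2) unfolding finite_dim_def by blast
  have fin\<Gamma>: "finite \<Gamma>" using H.independent_span_bound[OF FH(1) assms(5)] FH(2) by simp
  have Bi: "A.subspace (Bs i)" "Bs i \<subseteq> B" "\<And>b x. b \<in> B \<Longrightarrow> x \<in> Bs i \<Longrightarrow> b * x \<in> Bs i \<and> x * b \<in> Bs i"
    "\<And>h x. x \<in> Bs i \<Longrightarrow> act h x \<in> Bs i" "H_simple scaleA act (Bs i)" "semisimple_algebra scaleA (Bs i)"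
    if "i \<in> {1..q}" for i
    using bspec[OF assms(14) that] by (auto simp: two_sided_ideal_def invariant_def)
  have direct: "f i = 0" if "\<And>k. k \<in> {1..q} \<Longrightarrow> f k \<in> Bs k" "(\<Sum>k\<in>{1..q}. f k) = 0" "i \<in> {1..q}" for f i
    using assms(13) that unfolding direct_sum_def by blast
  have orth: "x * y = 0" if ij: "i \<in> {1..q}" "j \<in> {1..q}" "i \<noteq> j" and xy: "x \<in> Bs i" "y \<in> Bs j" for i j x y
  proof (rule unique_sum_Int_trivial[of "{1..q}" Bs i j])
    show "f k = 0" if "\<And>k. k \<in> {1..q} \<Longrightarrow> f k \<in> Bs k" "(\<Sum>k\<in>{1..q}. f k) = 0" "k \<in> {1..q}" for f k
      using that by (rule direct)
    show "0 \<in> Bs k" if "k \<in> {1..q}" for k using A.subspace_0[OF Bi(1)[OF that]] .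
    show "x * y \<in> Bs i" using Bi(3)[OF ij(1) _ xy(1)] Bi(2)[OF ij(2)] xy(2) by blast
    have "x * y \<in> Bs j" using Bi(3)[OF ij(2) _ xy(2)] Bi(2)[OF ij(1)] xy(1) by blast
    then show "- (x * y) \<in> Bs j" by (rule A.subspace_neg[OF Bi(1)[OF ij(2)]])
  qed (use ij in simp_all)
  have basis: "\<exists>b. b \<subseteq> V \<and> A.independent b \<and> A.span b = V" if "A.subspace V" for V
  proof -
    obtain b where b: "b \<subseteq> V" "A.independent b" "V \<subseteq> A.span b" by (rule A.maximal_independent_subset)
    then have "A.span b = V" using that by (intro A.span_subspace)
    then show ?thesis using b by blast
  qed
  have "\<forall>i\<in>{1..q}. \<exists>b. b \<subseteq> Bs i \<and> A.independent b \<and> A.span b = Bs i" using basis Bi(1) by blast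
  from bchoice[OF this] obtain \<beta> where
    \<beta>: "\<And>i. i \<in> {1..q} \<Longrightarrow> A.independent (\<beta> i)" "\<And>i. i \<in> {1..q} \<Longrightarrow> A.span (\<beta> i) = Bs i" by blast
  have Jsub: "A.subspace J" using AF.jacobson_radical_left_ideal assms(7) by (simp add: left_ideal_def)
  obtain \<beta>J where \<beta>J: "\<beta>J \<subseteq> J" "A.independent \<beta>J" "A.span \<beta>J = J" using basis[OF Jsub] by blast
  let ?G = "(\<Union>i\<in>{1..q}. \<beta> i) \<union> \<beta>J"
  have "x \<in> A.span ?G" for x
  proof -
    obtain b j where x: "x = b + j" "b \<in> B" "j \<in> J" using assms(11) by blast
    obtain f where f: "b = (\<Sum>i\<in>{1..q}. f i)" "\<forall>i\<in>{1..q}. f i \<in> Bs i"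
      using assms(13) x(2) unfolding direct_sum_def by blast
    have "f i \<in> A.span ?G" if i: "i \<in> {1..q}" for i
    proof -
      have "\<beta> i \<subseteq> ?G" using i by blast
      then have "A.span (\<beta> i) \<subseteq> A.span ?G" by (rule A.span_mono)
      then show ?thesis using f(2) i \<beta>(2)[OF i] by blast
    qed
    then have "b \<in> A.span ?G" unfolding f(1) by (rule A.span_sum)
    moreover have "j \<in> A.span ?G" using A.span_mono[of \<beta>J ?G] x(3) \<beta>J(3) by blast
    ultimately show ?thesis unfolding x(1) by (rule A.span_add)
  qed
  then have spanning: "A.span ?G = UNIV" by blast
  interpret H_wedderburn scaleH \<Delta> \<epsilon> S scaleA act Basis "{1..q}" Bs \<beta> \<beta>J
  proof unfold_locales
    show "x * y \<in> Bs i" if "i \<in> {1..q}" "x \<in> Bs i" "y \<in> Bs i" for i x y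
      using Bi(3)[OF that(1) _ that(3)] Bi(2)[OF that(1)] that(2) by blast
    show "x * y = 0" if "i \<in> {1..q}" "j \<in> {1..q}" "i \<noteq> j" "x \<in> Bs i" "y \<in> Bs j" for i j x y
      by (rule orth[OF that])
    show "f i = 0" if "\<And>i. i \<in> {1..q} \<Longrightarrow> f i \<in> Bs i" "(\<Sum>i\<in>{1..q}. f i) = 0" "i \<in> {1..q}" for f i
      using that by (rule direct)
    show "U = {0} \<or> U = Bs i" if "i \<in> {1..q}" "two_sided_ideal scaleA (Bs i) U" "invariant act U" for i U
      using Bi(5)[OF that(1)] that(2,3) unfolding H_simple_def by blast
    show "act h x \<in> jacobson_radical scaleA UNIV" if "x \<in> jacobson_radical scaleA UNIV" for h x
      using assms(7,8) that by (simp add: invariant_def)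
    show "finite \<beta>J" by (rule AF.finiteI_independent[OF \<beta>J(2)])
    show "\<beta>J \<subseteq> jacobson_radical scaleA UNIV" using \<beta>J(1) assms(7) by simp
    show "A.span ?G = UNIV" by (rule spanning)
  qed (use Bi(1,4,6) \<beta> in auto)
  show ?thesis by (rule H_codimension_bounds[OF assms(5,6) fin\<Gamma> assms(4)])
qed

end
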